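(* Let $\Omega\subset\mathbb{C}^n$ be a bounded domain and let $\psi\ge 0$ be a continuous function on $\overline\Omega\times\mathbb{R}$ which is non-decreasing in the last variable. Let $\Gamma$, $f$, $F$ be as in the context. Let $v:\overline\Omega\to\mathbb{R}$ be bounded and lower semicontinuous, a viscosity supersolution of $$F(Hw)=\psi(z,w)$$ in $\Omega$, such that $\lim_{\Omega\ni z\to\hat z}v(z)=v(\hat z)$ for all $\hat z\in\partial\Omega$ and $$\lim_{R\to\infty}f(R,R,\dots,R)>\sup_{z\in\Omega}\psi(z,v(z)).$$ Denote by $S$ the set of all viscosity subsolutions $w$ of $F(Hw)=\psi(z,w)$ in $\Omega$ satisfying $w\le v$. Then the function $$u(z)=\sup\{w(z):w\in S\}$$ is a discontinuous viscosity solution of $F(Hw)=\psi(z,w)$ in $\Omega$, and $u=u^*\in S$.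
   Context: Cone and operator. For $1\le k\le n$ let $\sigma_k(x)=\sum_{1\le j_1<\dots<j_k\le n}x_{j_1}\cdots x_{j_k}$ and $\Gamma_k=\{x\in\mathbb{R}^n:\sigma_1(x)>0,\dots,\sigma_k(x)>0\}$. $\Gamma\subsetneq\mathbb{R}^n$ is an open, convex, symmetric (permutation invariant) cone with vertex at the origin with $\Gamma_n\subseteq\Gamma\subseteq\Gamma_1$. $f:\overline{\Gamma}\to[0,\infty)$ is continuous, symmetric, concave, strictly increasing in each variable on $\Gamma$, with $f>0$ on $\Gamma$ and $f=0$ on $\partial\Gamma$. $\mathcal{H}^n$ is the set of $n\times n$ Hermitian matrices, $\lambda(H)\in\mathbb{R}^n$ denotes the eigenvalues of $H$, $M(\Gamma,n)=\{H\in\mathcal{H}^n:\lambda(H)\in\Gamma\}$, and $F:\mathcal{H}^n\to[-\infty,\infty)$ is $F(H)=f(\lambda(H))$ if $H\in\overline{M(\Gamma,n)}$ and $F(H)=-\infty$ otherwise. $Hu=\left(\frac{\partial^2u}{\partial z_\alpha\partial\overline{z_\beta}}\right)$ is the complex Hessian. Viscosity sub/supersolutions. Upper semicontinuous functions take values in $[-\infty,\infty)$. An upper (resp. lower) test function for $w$ at $z_0$ is a $C^2$ function $q$ near $z_0$ with $w(z_0)=q(z_0)$ and $w\le q$ (resp. $w\ge q$) near $z_0$. An upper semicontinuous $u$ is a viscosity subsolution of $F(Hw)=\psi(z,w)$ in $\Omega$ if $F(Hq(z_0))\ge\psi(z_0,u(z_0))$ for every $z_0\in\Omega$ and every upper test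 function $q$ for $u$ at $z_0$. A lower semicontinuous $v$ is a viscosity supersolution if $F(Hq(z_0))\le\psi(z_0,v(z_0))$ for every $z_0\in\Omega$ and every lower test function $q$ for $v$ at $z_0$. $u^*$ and $u_*$ denote the upper and lower semicontinuous regularizations of $u$. A bounded function $u$ on $\Omega$ is a discontinuous viscosity solution if $u^*$ is a viscosity subsolution and $u_*$ is a viscosity supersolution in $\Omega$. *)

theory Defs
  imports "HOL-Analysis.Analysis"
begin

section \<open>The cone and the operator\<close>

definition elem_sym :: "nat \<Rightarrow> real ^ 'n \<Rightarrow> real" where
  "elem_sym k x = (\<Sum>J | J \<subseteq> (UNIV :: 'n set) \<and> card J = k. \<Prod>j\<in>J. x $ j)"

definition Gamma_cone :: "nat \<Rightarrow> (real ^ 'n) set" where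
  "Gamma_cone k = {x. \<forall>j\<in>{1..k}. elem_sym j x > 0}"

text \<open>
  The library predicates \<open>cone\<close> and \<open>conic\<close> force a nonempty cone to contain the
  origin. The open cones considered here do not contain it, so only positive scalars are used.
\<close>

definition admissible_cone :: "(real ^ 'n) set \<Rightarrow> bool" where
  "admissible_cone \<Gamma> \<longleftrightarrow>
     \<Gamma> \<noteq> UNIV \<and> open \<Gamma> \<and> convex \<Gamma> \<and>
     (\<forall>x\<in>\<Gamma>. \<forall>c>0. c *\<^sub>R x \<in> \<Gamma>) \<and>
     (\<forall>x\<in>\<Gamma>. \<forall>\<pi>. bij \<pi> \<longrightarrow> (\<chi> i. x $ \<pi> i) \<in> \<Gamma>) \<and>
     Gamma_cone CARD('n) \<subseteq> \<Gamma> \<and> \<Gamma> \<subseteq> Gamma_cone 1"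

definition admissible_fun :: "(real ^ 'n) set \<Rightarrow> (real ^ 'n \<Rightarrow> real) \<Rightarrow> bool" where
  "admissible_fun \<Gamma> f \<longleftrightarrow>
     (\<forall>x\<in>closure \<Gamma>. f x \<ge> 0) \<and>
     continuous_on (closure \<Gamma>) f \<and>
     (\<forall>x\<in>closure \<Gamma>. \<forall>\<pi>. bij \<pi> \<longrightarrow> f (\<chi> i. x $ \<pi> i) = f x) \<and>
     concave_on (closure \<Gamma>) f \<and>
     (\<forall>x\<in>\<Gamma>. \<forall>i. \<forall>t>0. x + t *\<^sub>R axis i 1 \<in> \<Gamma> \<longrightarrow> f x < f (x + t *\<^sub>R axis i 1)) \<and>
     (\<forall>x\<in>\<Gamma>. f x > 0) \<and>
     (\<forall>x\<in>frontier \<Gamma>. f x = 0)"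

definition hermitian_matrices :: "(complex ^ 'n ^ 'n) set" where
  "hermitian_matrices = {H. \<forall>i j. H $ i $ j = cnj (H $ j $ i)}"

text \<open>
  The vector of eigenvalues, repeated according to multiplicity. It is determined by the
  characteristic polynomial only up to the order of its entries; the choice of an order is
  immaterial, because it is only ever used with symmetric cones and symmetric functions.
\<close>

definition eigenvalues :: "complex ^ 'n ^ 'n \<Rightarrow> real ^ 'n" where
  "eigenvalues H =
     (SOME x. \<forall>t. det (mat t - H) = (\<Prod>i\<in>UNIV. t - complex_of_real (x $ i)))"

definition M_cone :: "(real ^ 'n) set \<Rightarrow> (complex ^ 'n ^ 'n) set" where
  "M_cone \<Gamma> = {H \<in> hermitian_matrices. eigenvalues H \<in> \<Gamma>}"

definition F_op ::
  "(real ^ 'n) set \<Rightarrow> (real ^ 'n \<Rightarrow> real) \<Rightarrow> complex ^ 'n ^ 'n \<Rightarrow> ereal" where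
  "F_op \<Gamma> f H = (if H \<in> closure (M_cone \<Gamma>) then ereal (f (eigenvalues H)) else - \<infinity>)"

section \<open>The complex Hessian\<close>

definition partial_deriv ::
  "'a::real_normed_vector \<Rightarrow> ('a \<Rightarrow> 'b::real_normed_vector) \<Rightarrow> 'a \<Rightarrow> 'b" where
  "partial_deriv e g z = vector_derivative (\<lambda>t::real. g (z + t *\<^sub>R e)) (at 0)"

text \<open>
  For \<open>z\<^sub>\<alpha> = x\<^sub>\<alpha> + \<i> y\<^sub>\<alpha>\<close>, the derivatives in \<open>x\<^sub>\<alpha>\<close> and \<open>y\<^sub>\<alpha>\<close> are those in the directions
  \<open>axis \<alpha> 1\<close> and \<open>axis \<alpha> \<i>\<close>.
\<close>

definition deriv_z :: "'n \<Rightarrow> (complex ^ 'n \<Rightarrow> complex) \<Rightarrow> complex ^ 'n \<Rightarrow> complex" where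
  "deriv_z \<alpha> g z =
     (partial_deriv (axis \<alpha> 1) g z - \<i> * partial_deriv (axis \<alpha> \<i>) g z) / 2"

definition deriv_zbar :: "'n \<Rightarrow> (complex ^ 'n \<Rightarrow> complex) \<Rightarrow> complex ^ 'n \<Rightarrow> complex" where
  "deriv_zbar \<alpha> g z =
     (partial_deriv (axis \<alpha> 1) g z + \<i> * partial_deriv (axis \<alpha> \<i>) g z) / 2"

definition complex_hessian :: "(complex ^ 'n \<Rightarrow> real) \<Rightarrow> complex ^ 'n \<Rightarrow> complex ^ 'n ^ 'n" where
  "complex_hessian u z = (\<chi> \<alpha> \<beta>. deriv_z \<alpha> (deriv_zbar \<beta> (\<lambda>w. complex_of_real (u w))) z)"

definition C2_on :: "'a::real_normed_vector set \<Rightarrow> ('a \<Rightarrow> real) \<Rightarrow> bool" where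
  "C2_on U q \<longleftrightarrow>
     (\<exists>(D :: 'a \<Rightarrow> 'a \<Rightarrow>\<^sub>L real) (D2 :: 'a \<Rightarrow> 'a \<Rightarrow>\<^sub>L 'a \<Rightarrow>\<^sub>L real).
        (\<forall>z\<in>U. (q has_derivative blinfun_apply (D z)) (at z)) \<and>
        (\<forall>z\<in>U. (D has_derivative blinfun_apply (D2 z)) (at z)) \<and>
        continuous_on U D2)"

section \<open>Semicontinuity and viscosity solutions\<close>

definition usc_on :: "'a::topological_space set \<Rightarrow> ('a \<Rightarrow> 'b::linorder) \<Rightarrow> bool" where
  "usc_on A w \<longleftrightarrow> (\<forall>z\<in>A. \<forall>c. w z < c \<longrightarrow> (\<forall>\<^sub>F y in at z within A. w y < c))"

definition lsc_on :: "'a::topological_space set \<Rightarrow> ('a \<Rightarrow> 'b::linorder) \<Rightarrow> bool" where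
  "lsc_on A w \<longleftrightarrow> (\<forall>z\<in>A. \<forall>c. c < w z \<longrightarrow> (\<forall>\<^sub>F y in at z within A. c < w y))"

definition usc_reg :: "'a::metric_space set \<Rightarrow> ('a \<Rightarrow> ereal) \<Rightarrow> 'a \<Rightarrow> ereal" where
  "usc_reg A u z = (INF r\<in>{0<..}. SUP y\<in>ball z r \<inter> A. u y)"

definition lsc_reg :: "'a::metric_space set \<Rightarrow> ('a \<Rightarrow> ereal) \<Rightarrow> 'a \<Rightarrow> ereal" where
  "lsc_reg A u z = (SUP r\<in>{0<..}. INF y\<in>ball z r \<inter> A. u y)"

text \<open>
  Functions on an open set \<open>\<Omega>\<close> are represented by functions on the whole type. Below, test
  points lie in \<open>\<Omega>\<close>, so only the values on \<open>\<Omega>\<close> matter. The equation \<open>w z\<^sub>0 = ereal (q z\<^sub>0)\<close>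
  means that there are no test functions where \<open>w\<close> is infinite, so \<open>real_of_ereal\<close> is only
  applied to finite values.
\<close>

definition upper_test ::
  "('a::real_normed_vector \<Rightarrow> ereal) \<Rightarrow> 'a \<Rightarrow> ('a \<Rightarrow> real) \<Rightarrow> bool" where
  "upper_test w z\<^sub>0 q \<longleftrightarrow>
     (\<exists>U. open U \<and> z\<^sub>0 \<in> U \<and> C2_on U q) \<and>
     w z\<^sub>0 = ereal (q z\<^sub>0) \<and> (\<forall>\<^sub>F z in nhds z\<^sub>0. w z \<le> ereal (q z))"

definition lower_test ::
  "('a::real_normed_vector \<Rightarrow> ereal) \<Rightarrow> 'a \<Rightarrow> ('a \<Rightarrow> real) \<Rightarrow> bool" where
  "lower_test w z\<^sub>0 q \<longleftrightarrow>
     (\<exists>U. open U \<and> z\<^sub>0 \<in> U \<and> C2_on U q) \<and>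
     w z\<^sub>0 = ereal (q z\<^sub>0) \<and> (\<forall>\<^sub>F z in nhds z\<^sub>0. w z \<ge> ereal (q z))"

definition viscosity_subsolution ::
  "(complex ^ 'n) set \<Rightarrow> (complex ^ 'n ^ 'n \<Rightarrow> ereal) \<Rightarrow> (complex ^ 'n \<Rightarrow> real \<Rightarrow> real) \<Rightarrow>
   (complex ^ 'n \<Rightarrow> ereal) \<Rightarrow> bool" where
  "viscosity_subsolution \<Omega> F \<psi> w \<longleftrightarrow>
     usc_on \<Omega> w \<and> (\<forall>z\<in>\<Omega>. w z < \<infinity>) \<and>
     (\<forall>z\<^sub>0\<in>\<Omega>. \<forall>q. upper_test w z\<^sub>0 q \<longrightarrow>
        F (complex_hessian q z\<^sub>0) \<ge> ereal (\<psi> z\<^sub>0 (real_of_ereal (w z\<^sub>0))))"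

definition viscosity_supersolution ::
  "(complex ^ 'n) set \<Rightarrow> (complex ^ 'n ^ 'n \<Rightarrow> ereal) \<Rightarrow> (complex ^ 'n \<Rightarrow> real \<Rightarrow> real) \<Rightarrow>
   (complex ^ 'n \<Rightarrow> ereal) \<Rightarrow> bool" where
  "viscosity_supersolution \<Omega> F \<psi> w \<longleftrightarrow>
     lsc_on \<Omega> w \<and> (\<forall>z\<in>\<Omega>. w z > - \<infinity>) \<and>
     (\<forall>z\<^sub>0\<in>\<Omega>. \<forall>q. lower_test w z\<^sub>0 q \<longrightarrow>
        F (complex_hessian q z\<^sub>0) \<le> ereal (\<psi> z\<^sub>0 (real_of_ereal (w z\<^sub>0))))"

definition discontinuous_viscosity_solution ::
  "(complex ^ 'n) set \<Rightarrow> (complex ^ 'n ^ 'n \<Rightarrow> ereal) \<Rightarrow> (complex ^ 'n \<Rightarrow> real \<Rightarrow> real) \<Rightarrow>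
   (complex ^ 'n \<Rightarrow> ereal) \<Rightarrow> bool" where
  "discontinuous_viscosity_solution \<Omega> F \<psi> u \<longleftrightarrow>
     (\<exists>B::real. \<forall>z\<in>\<Omega>. \<bar>u z\<bar> \<le> ereal B) \<and>
     viscosity_subsolution \<Omega> F \<psi> (usc_reg \<Omega> u) \<and>
     viscosity_supersolution \<Omega> F \<psi> (lsc_reg \<Omega> u)"

end

theory Submission
  imports Defs "HOL-Combinatorics.Permutations" "HOL-Probability.Distributions"
begin

text \<open>
  Write \<open>u\<^sup>*\<close> and \<open>u\<^sub>*\<close> for the regularizations of the Perron envelope \<open>u\<close> of the family \<open>S\<close>. Two of
  the three steps are the classical ones. The function \<open>u\<^sup>*\<close> is a subsolution, because a test function
  that touches \<open>u\<^sup>*\<close> from above touches, after a small perturbation, some member of \<open>S\<close> at a nearby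
  point, and the superlevel sets of \<open>F\<close> are closed (\<open>sup_of_subsolutions\<close>). The function \<open>u\<^sub>*\<close> is a
  supersolution: if a lower test function \<open>q\<close> violated the inequality at \<open>z\<^sub>0\<close>, then either \<open>q\<close>
  would touch \<open>v\<close> there, which \<open>v\<close> forbids, or \<open>q\<close> could be lifted to a subsolution that exceeds \<open>u\<close>
  near \<open>z\<^sub>0\<close> and still stays below \<open>v\<close> (\<open>envelope_supersolution\<close>).

  The third step is \<open>u\<^sup>* \<le> v\<close>, which puts \<open>u\<^sup>*\<close> into \<open>S\<close> and so yields \<open>u = u\<^sup>*\<close>. It is not
  automatic, as \<open>v\<close> is only lower semicontinuous and \<open>u \<le> v\<close> passes to \<open>u\<^sup>* \<le> v\<^sup>*\<close> at best. It is an
  instance of the comparison principle (\<open>comparison\<close>); the continuity of \<open>v\<close> at the boundary provides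
  the boundary ordering.

  Comparison of a semicontinuous sub- and supersolution usually rests on the almost everywhere second
  differentiability of convex functions. Here concavity of \<open>F\<close> permits a detour through smooth
  subsolutions. Let \<open>K\<^sub>c = {x \<in> closure \<Gamma>. c \<le> f x}\<close>, a closed convex symmetric set. By Schur's theorem
  on the diagonal of a Hermitian matrix, \<open>F(H) \<ge> c\<close> holds iff for every unitary \<open>U\<close> the diagonal of
  \<open>U\<^sup>* H U\<close> lies in \<open>K\<^sub>c\<close> (\<open>F_op_ge_iff\<close>). Since \<open>K\<^sub>c\<close> is an intersection of half-spaces with positive
  normals (\<open>level_halfspaces\<close>), the inequality \<open>F(Hw) \<ge> c\<close> is a conjunction of linear elliptic
  inequalities with constant coefficients. Each of them survives convolution with a mollifier
  (\<open>mollified_linear_subsolution\<close>): after a linear change of variables it reads \<open>\<Delta>w \<ge> b\<close>, the maximum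
  principle against the heat flow turns this viscosity inequality into a mean value inequality for
  Gaussian averages (\<open>heat_flow_submean\<close>), and mean value inequalities are stable under averaging.

  So one first makes a subsolution continuous by sup-convolution, which costs only a small shift of the
  point in \<open>\<psi>\<close>, and then mollifies it to a function \<open>J\<close>. The hypothesis \<open>lim f(R,\<dots>,R) > sup \<psi>(z,v(z))\<close>
  gives a paraboloid \<open>P \<le> v\<close> that is a strict subsolution, and by concavity \<open>(1-\<theta>)J + \<theta>P\<close> is then
  strict as well. It is smooth, so it may be used as a test function for \<open>v\<close> at the point where it
  exceeds \<open>v\<close> the most, and this contradicts the supersolution property.
\<close>

section \<open>Doubly stochastic matrices and symmetric convex sets\<close>

text \<open>
  Subtracting from \<open>a\<close> a constant \<open>c\<close> that separates its values on \<open>S\<close> from those off \<open>S\<close> does not change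
  the sum, since all row and column sums of \<open>D\<close> agree, and it makes every term nonnegative.
\<close>

lemma oppositely_ordered_indicator:
  fixes D :: "'n::finite \<Rightarrow> 'n \<Rightarrow> real" and a :: "'n \<Rightarrow> real"
  assumes nn: "\<And>i j. D i j \<ge> 0" and row: "\<And>i. (\<Sum>j\<in>UNIV. D i j) = 1"
    and col: "\<And>j. (\<Sum>i\<in>UNIV. D i j) = 1"
    and ord: "\<And>i j. i \<in> S \<Longrightarrow> j \<notin> S \<Longrightarrow> a i \<le> a j"
  defines "s \<equiv> \<lambda>j. if j \<in> S then 1 else (0::real)"
  shows "(\<Sum>i\<in>UNIV. \<Sum>j\<in>UNIV. D i j * a i * (s j - s i)) \<ge> 0"
proof -
  obtain c where c: "\<And>i. i \<in> S \<Longrightarrow> a i \<le> c" "\<And>j. j \<notin> S \<Longrightarrow> c \<le> a j"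
  proof (cases "S = {}")
    case True
    show ?thesis by (rule that[of "Min (range a)"]) (auto simp: True)
  next
    case False
    show ?thesis
      by (rule that[of "Max (a ` S)"]) (use False ord in \<open>auto intro: Max.boundedI\<close>)
  qed
  have 1: "(\<Sum>i\<in>UNIV. \<Sum>j\<in>UNIV. D i j * (a i - c) * (s j - s i)) \<ge> 0"
  proof (intro sum_nonneg)
    fix i j
    have "(a i - c) * (s j - s i) \<ge> 0"
      using c[of i] by (auto simp: s_def)
    then show "D i j * (a i - c) * (s j - s i) \<ge> 0"
      using nn[of i j] by (simp add: mult.assoc)
  qed
  have "(\<Sum>i\<in>UNIV. \<Sum>j\<in>UNIV. D i j * s j) = (\<Sum>j\<in>UNIV. s j)"
    by (subst sum.swap) (simp add: sum_distrib_right[symmetric] col)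
  moreover have "(\<Sum>i\<in>UNIV. \<Sum>j\<in>UNIV. D i j * s i) = (\<Sum>j\<in>UNIV. s j)"
    by (simp add: sum_distrib_right[symmetric] row)
  ultimately have 2: "(\<Sum>i\<in>UNIV. \<Sum>j\<in>UNIV. D i j * (s j - s i)) = 0"
    by (simp add: right_diff_distrib sum_subtractf)
  have "(\<Sum>i\<in>UNIV. \<Sum>j\<in>UNIV. D i j * a i * (s j - s i)) =
    (\<Sum>i\<in>UNIV. \<Sum>j\<in>UNIV. D i j * (a i - c) * (s j - s i)) + c * (\<Sum>i\<in>UNIV. \<Sum>j\<in>UNIV. D i j * (s j - s i))"
    by (simp add: sum_distrib_left sum.distrib[symmetric] algebra_simps)
  then show ?thesis using 1 2 by simp
qed

text \<open>
  The rearrangement inequality with a doubly stochastic matrix in place of a permutation. It is linear in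
  \<open>y\<close>, so \<open>y\<close> can be built up from indicator functions of its superlevel sets: the induction lowers the
  largest value of \<open>y\<close> to the second largest one.
\<close>

lemma oppositely_ordered_le_doubly_stochastic:
  fixes D :: "'n::finite \<Rightarrow> 'n \<Rightarrow> real" and a y :: "'n \<Rightarrow> real"
  assumes nn: "\<And>i j. D i j \<ge> 0" and row: "\<And>i. (\<Sum>j\<in>UNIV. D i j) = 1"
    and col: "\<And>j. (\<Sum>i\<in>UNIV. D i j) = 1"
    and ord: "\<And>i j. y j < y i \<Longrightarrow> a i \<le> a j"
  shows "(\<Sum>i\<in>UNIV. \<Sum>j\<in>UNIV. D i j * a i * (y j - y i)) \<ge> 0"
  using ord
proof (induction "card (range y)" arbitrary: y rule: less_induct)
  case less
  define M where "M = Max (range y)"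
  have yM: "y i \<le> M" for i by (simp add: M_def)
  have Min: "M \<in> range y" unfolding M_def by (rule Max_in) auto
  show ?case
  proof (cases "range y = {M}")
    case True
    then have "y i = M" for i by (metis rangeI singletonD)
    then show ?thesis by simp
  next
    case False
    define M2 where "M2 = Max (range y - {M})"
    have ne: "range y - {M} \<noteq> {}" using False Min by auto
    have M2in: "M2 \<in> range y - {M}" unfolding M2_def by (rule Max_in) (use ne in auto)
    have M2M: "M2 < M" using M2in yM by (force simp: order_less_le)
    have yM2: "y i \<le> M2" if "y i \<noteq> M" for i
      unfolding M2_def by (rule Max_ge) (use that in auto)
    define y' where "y' = (\<lambda>i. min (y i) M2)"
    define s where "s = (\<lambda>j. if j \<in> {i. y i = M} then 1 else (0::real))"
    have y'r: "range y' \<subseteq> range y - {M}"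
      using M2in yM2 M2M by (auto simp: y'_def min_def)
    have "card (range y') < card (range y)"
      by (rule psubset_card_mono) (use y'r Min in auto)
    moreover have "a i \<le> a j" if "y' j < y' i" for i j
      using that less.prems[of j i] by (auto simp: y'_def min_def split: if_splits)
    ultimately have 1: "(\<Sum>i\<in>UNIV. \<Sum>j\<in>UNIV. D i j * a i * (y' j - y' i)) \<ge> 0"
      using less.hyps by blast
    have 2: "(\<Sum>i\<in>UNIV. \<Sum>j\<in>UNIV. D i j * a i * (s j - s i)) \<ge> 0"
      unfolding s_def
    proof (rule oppositely_ordered_indicator[OF nn row col])
      fix i j assume "i \<in> {i. y i = M}" "j \<notin> {i. y i = M}"
      then show "a i \<le> a j" using less.prems[of j i] yM[of j] by force
    qed
    have ys: "y i = y' i + (M - M2) * s i" for i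
      using yM2[of i] M2M by (auto simp: y'_def s_def min_def)
    have "(\<Sum>i\<in>UNIV. \<Sum>j\<in>UNIV. D i j * a i * (y j - y i)) =
      (\<Sum>i\<in>UNIV. \<Sum>j\<in>UNIV. D i j * a i * (y' j - y' i)) + (M - M2) * (\<Sum>i\<in>UNIV. \<Sum>j\<in>UNIV. D i j * a i * (s j - s i))"
      unfolding ys by (simp add: sum_distrib_left sum.distrib[symmetric] algebra_simps)
    then show ?thesis using 1 2 M2M by simp
  qed
qed

definition symmetric_set :: "(real ^ 'n) set \<Rightarrow> bool" where
  "symmetric_set K \<longleftrightarrow> (\<forall>x\<in>K. \<forall>\<pi>. bij \<pi> \<longrightarrow> (\<chi> i. x $ \<pi> i) \<in> K)"

text \<open>
  This replaces the theorem of Birkhoff and von Neumann. If the image of \<open>x\<close> could be separated from \<open>K\<close>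
  by a linear functional \<open>a\<close>, choose the rearrangement of \<open>x\<close> that minimizes \<open>a\<close>. Transpositions do not
  lower the value further, so it is ordered oppositely to \<open>a\<close>, and the rearrangement inequality says that
  no doubly stochastic matrix gets below it.
\<close>

lemma doubly_stochastic_image_in_symmetric_convex:
  fixes D :: "'n::finite \<Rightarrow> 'n \<Rightarrow> real" and x :: "real ^ 'n"
  assumes nn: "\<And>i j. D i j \<ge> 0" and row: "\<And>i. (\<Sum>j\<in>UNIV. D i j) = 1"
    and col: "\<And>j. (\<Sum>i\<in>UNIV. D i j) = 1"
    and K: "closed K" "convex K" "symmetric_set K" and x: "x \<in> K"
  shows "(\<chi> i. \<Sum>j\<in>UNIV. D i j * x $ j) \<in> K"
proof (rule ccontr)
  define d where "d = (\<chi> i. \<Sum>j\<in>UNIV. D i j * x $ j)"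
  assume "(\<chi> i. \<Sum>j\<in>UNIV. D i j * x $ j) \<notin> K"
  then obtain a b where ab: "inner a d < b" "\<And>y. y \<in> K \<Longrightarrow> b < inner a y"
    using separating_hyperplane_closed_point[OF K(2,1), of d] unfolding d_def by blast
  define P where "P = {\<pi>::'n \<Rightarrow> 'n. bij \<pi>}"
  define g where "g = (\<lambda>\<pi>. \<Sum>i\<in>UNIV. a $ i * x $ \<pi> i)"
  have "finite P" "P \<noteq> {}" unfolding P_def by (auto intro!: exI[of _ id])
  then obtain \<pi> where \<pi>: "\<pi> \<in> P" "\<And>\<sigma>. \<sigma> \<in> P \<Longrightarrow> g \<pi> \<le> g \<sigma>"
    using arg_min_if_finite[of P g] by (metis not_less)
  have bp: "bij \<pi>" using \<pi>(1) by (simp add: P_def)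
  define y where "y = (\<lambda>i. x $ \<pi> i)"
  have ord: "a $ i \<le> a $ j" if "y j < y i" for i j
  proof -
    have ij: "i \<noteq> j" using that by auto
    \<comment> \<open>Exchanging the values at i and j changes the functional by a product of two differences.\<close>
    define \<sigma> where "\<sigma> = \<pi> \<circ> Transposition.transpose i j"
    have "\<sigma> \<in> P" using bp by (simp add: \<sigma>_def P_def bij_comp)
    then have "g \<pi> \<le> g \<sigma>" using \<pi>(2) by blast
    moreover have "g \<sigma> - g \<pi> = (\<Sum>k\<in>UNIV. a $ k * (y (Transposition.transpose i j k) - y k))"
      by (simp add: g_def \<sigma>_def y_def sum_subtractf right_diff_distrib)
    moreover have "\<dots> = (\<Sum>k\<in>{i,j}. a $ k * (y (Transposition.transpose i j k) - y k))"
      by (rule sum.mono_neutral_right) (auto simp: Transposition.transpose_def)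
    moreover have "\<dots> = (a $ i - a $ j) * (y j - y i)"
      using ij by (simp add: algebra_simps)
    ultimately have "(a $ i - a $ j) * (y j - y i) \<ge> 0" by linarith
    then show ?thesis using that by (simp add: zero_le_mult_iff)
  qed
  have r': "(\<Sum>j\<in>UNIV. D i (\<pi> j) * h (\<pi> j)) = (\<Sum>j\<in>UNIV. D i j * h j)" for i and h :: "'n \<Rightarrow> real"
    using sum.reindex_bij_betw[OF bp, of "\<lambda>j. D i j * h j"] by simp
  have "(\<Sum>i\<in>UNIV. \<Sum>j\<in>UNIV. D i (\<pi> j) * a $ i * (y j - y i)) \<ge> 0"
    by (rule oppositely_ordered_le_doubly_stochastic)
       (use nn ord r'[of _ "\<lambda>_. 1"] row col in auto)
  moreover have "(\<Sum>i\<in>UNIV. \<Sum>j\<in>UNIV. D i (\<pi> j) * a $ i * (y j - y i)) =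
    (\<Sum>i\<in>UNIV. a $ i * (\<Sum>j\<in>UNIV. D i (\<pi> j) * y j)) - (\<Sum>i\<in>UNIV. (\<Sum>j\<in>UNIV. D i (\<pi> j)) * (a $ i * y i))"
    by (simp add: sum_distrib_left sum_distrib_right sum_subtractf[symmetric] algebra_simps)
  moreover have "(\<Sum>i\<in>UNIV. a $ i * (\<Sum>j\<in>UNIV. D i (\<pi> j) * y j)) = inner a d"
    by (simp add: inner_vec_def d_def y_def r')
  moreover have "(\<Sum>i\<in>UNIV. (\<Sum>j\<in>UNIV. D i (\<pi> j)) * (a $ i * y i)) = inner a (\<chi> i. x $ \<pi> i)"
    using r'[of _ "\<lambda>_. 1"] row by (simp add: inner_vec_def y_def)
  ultimately have "inner a (\<chi> i. x $ \<pi> i) \<le> inner a d" by simp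
  moreover have "(\<chi> i. x $ \<pi> i) \<in> K" using K(3) x bp by (auto simp: symmetric_set_def)
  ultimately show False using ab by fastforce
qed

section \<open>Hermitian matrices\<close>

definition herm :: "complex ^ 'n \<Rightarrow> complex ^ 'n \<Rightarrow> complex" where
  "herm x y = (\<Sum>k\<in>UNIV. cnj (x $ k) * y $ k)"

definition unitary_matrix :: "complex ^ 'n ^ 'n \<Rightarrow> bool" where
  "unitary_matrix U \<longleftrightarrow> (\<forall>i j. herm (column i U) (column j U) = (if i = j then 1 else 0))"

definition adj :: "complex ^ 'n ^ 'n \<Rightarrow> complex ^ 'n ^ 'n" where
  "adj U = (\<chi> i j. cnj (U $ j $ i))"

definition hform :: "complex ^ 'n ^ 'n \<Rightarrow> complex ^ 'n \<Rightarrow> real" where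
  "hform H x = Re (herm x (H *v x))"

definition diag_in :: "complex ^ 'n ^ 'n \<Rightarrow> complex ^ 'n ^ 'n \<Rightarrow> real ^ 'n" where
  "diag_in U H = (\<chi> i. hform H (column i U))"

definition diagonalizes :: "complex ^ 'n ^ 'n \<Rightarrow> real ^ 'n \<Rightarrow> complex ^ 'n ^ 'n \<Rightarrow> bool" where
  "diagonalizes U l H \<longleftrightarrow>
     unitary_matrix U \<and> (\<forall>i. H *v column i U = complex_of_real (l $ i) *s column i U)"

lemma herm_cnj: "cnj (herm x y) = herm y x"
  by (simp add: herm_def mult.commute)

lemma herm_scale_right: "herm x (c *s y) = c * herm x y"
  and herm_scale_left: "herm (c *s x) y = cnj c * herm x y"
  by (simp_all add: herm_def sum.distrib sum_distrib_left sum_subtractf algebra_simps)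

lemma Re_herm: "Re (herm x y) = inner x y"
  by (simp add: herm_def inner_vec_def inner_complex_def)

lemma Im_herm: "Im (herm x y) = inner (\<i> *s x) y"
  by (simp add: herm_def inner_vec_def inner_complex_def)

lemma herm_eq_0_iff: "herm x y = 0 \<longleftrightarrow> inner x y = 0 \<and> inner (\<i> *s x) y = 0"
  by (simp add: complex_eq_iff Re_herm Im_herm)

lemma herm_self: "herm x x = complex_of_real (inner x x)"
  by (simp add: complex_eq_iff Re_herm Im_herm inner_vec_def inner_complex_def)

lemma hermitian_swap:
  assumes "H \<in> hermitian_matrices"
  shows "herm x (H *v y) = herm (H *v x) y"
proof -
  have c: "cnj (H $ j $ i) = H $ i $ j" for i j
    using assms unfolding hermitian_matrices_def mem_Collect_eq by metis
  have "(\<Sum>i\<in>UNIV. \<Sum>j\<in>UNIV. cnj (x $ i) * (H $ i $ j * y $ j)) =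
    (\<Sum>i\<in>UNIV. \<Sum>j\<in>UNIV. cnj (H $ j $ i) * cnj (x $ i) * y $ j)"
    unfolding c by (intro sum.cong refl) (simp only: mult.left_commute mult.assoc)
  also have "\<dots> = (\<Sum>j\<in>UNIV. \<Sum>i\<in>UNIV. cnj (H $ j $ i) * cnj (x $ i) * y $ j)"
    by (rule sum.swap)
  finally show ?thesis
    by (simp add: herm_def matrix_vector_mult_def sum_distrib_left sum_distrib_right)
qed

lemma unitary_left: "unitary_matrix U \<longleftrightarrow> adj U ** U = mat 1"
  by (simp add: unitary_matrix_def adj_def matrix_matrix_mult_def mat_def vec_eq_iff herm_def column_def)

lemma unitary_right:
  assumes "unitary_matrix U" shows "U ** adj U = mat 1"
  using assms matrix_left_right_inverse by (metis unitary_left)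

lemma adj_adj: "adj (adj U) = U"
  by (simp add: adj_def vec_eq_iff)

lemma unitary_adj: "unitary_matrix U \<Longrightarrow> unitary_matrix (adj U)"
  using unitary_right[of U] unitary_left[of "adj U"] by (simp only: adj_adj)

lemma unitary_mult:
  assumes "unitary_matrix U" "unitary_matrix V" shows "unitary_matrix (U ** V)"
proof -
  have "adj (U ** V) = adj V ** adj U"
    by (simp add: adj_def matrix_matrix_mult_def vec_eq_iff mult.commute)
  then show ?thesis using assms unfolding unitary_left
    by (metis matrix_mul_assoc matrix_mul_lid)
qed

lemma hform_continuous: "continuous_on UNIV (\<lambda>x. hform H x)"
  unfolding hform_def herm_def matrix_vector_mult_def
  by (simp, intro continuous_intros)

lemma inner_matvec_hform: "inner x (H *v x) = hform H x"
  by (simp add: hform_def Re_herm)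

text \<open>
  Moving from \<open>x\<close> in the direction of the residual \<open>r = H x - m x\<close> would increase the Rayleigh quotient
  to first order unless \<open>r = 0\<close>.
\<close>

lemma rayleigh_maximizer_eigenvector:
  fixes H :: "complex ^ 'n ^ 'n"
  assumes H: "H \<in> hermitian_matrices" and V: "subspace V" "\<And>x. x \<in> V \<Longrightarrow> H *v x \<in> V"
    and x: "x \<in> V" "inner x x = 1"
    and mx: "\<And>y. y \<in> V \<Longrightarrow> hform H y \<le> m * inner y y" and m: "hform H x = m"
  shows "H *v x = complex_of_real m *s x"
proof -
  define r where "r = H *v x - m *\<^sub>R x"
  have sm: "complex_of_real m *s x = m *\<^sub>R x"
    by (simp add: vec_eq_iff) (simp add: scaleR_conv_of_real)
  have rV: "r \<in> V" unfolding r_def using V x by (simp add: subspace_diff subspace_scale)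
  have sym: "inner y (H *v z) = inner (H *v y) z" for y z
    using hermitian_swap[OF H, of y z] by (metis Re_herm)
  have lin: "H *v (y + t *\<^sub>R z) = H *v y + t *\<^sub>R (H *v z)" for y z and t :: real
    by (simp add: matrix_vector_right_distrib vec_eq_iff matrix_vector_mult_def scaleR_sum_right sum.distrib distrib_left)
  have key: "2 * t * inner r r + t\<^sup>2 * (hform H r - m * inner r r) \<le> 0" for t
  proof -
    have "x + t *\<^sub>R r \<in> V" using x rV V by (simp add: subspace_add subspace_scale)
    then have "hform H (x + t *\<^sub>R r) - m * inner (x + t *\<^sub>R r) (x + t *\<^sub>R r) \<le> 0" using mx by fastforce
    moreover have "hform H (x + t *\<^sub>R r) = hform H x + 2 * t * inner r (H *v x) + t\<^sup>2 * hform H r"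
      using sym[of x r] unfolding inner_matvec_hform[symmetric] lin
      using sym[of r x]
      by (simp add: inner_add_left inner_add_right inner_commute power2_eq_square algebra_simps)
    moreover have "inner (x + t *\<^sub>R r) (x + t *\<^sub>R r) = 1 + 2 * t * inner r x + t\<^sup>2 * inner r r"
      using x by (simp add: inner_add_left inner_add_right inner_commute power2_eq_square algebra_simps)
    moreover have rr: "inner r (H *v x) = inner r r + m * inner r x"
      by (subst (2) r_def) (simp add: inner_diff_right)
    ultimately have "m + 2 * t * (inner r r + m * inner r x) + t\<^sup>2 * hform H r - m * (1 + 2 * t * inner r x + t\<^sup>2 * inner r r) \<le> 0"
      using m by metis
    then show ?thesis by (simp add: algebra_simps)
  qed
  have "inner r r = 0"
  proof (rule ccontr)
    assume "inner r r \<noteq> 0"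
    then have pos: "inner r r > 0" by (metis inner_gt_zero_iff inner_zero_left)
    define c where "c = hform H r - m * inner r r"
    define t where "t = inner r r / (1 + \<bar>c\<bar>)"
    have t: "t > 0" using pos by (simp add: t_def add_pos_nonneg)
    have "t * (2 * inner r r + t * c) \<le> 0" using key[of t] by (simp add: c_def power2_eq_square algebra_simps)
    then have "2 * inner r r + t * c \<le> 0" using t by (simp add: mult_le_0_iff)
    moreover have "\<bar>t * c\<bar> \<le> inner r r"
    proof -
      have "t * \<bar>c\<bar> \<le> t * (1 + \<bar>c\<bar>)" using t by (simp add: mult_left_mono)
      also have "\<dots> = inner r r" by (simp add: t_def)
      finally show ?thesis using t by (simp add: abs_mult)
    qed
    ultimately show False using pos by linarith
  qed
  then show ?thesis by (simp add: r_def sm)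
qed

lemma hermitian_eigenvector_in_subspace:
  fixes H :: "complex ^ 'n ^ 'n"
  assumes H: "H \<in> hermitian_matrices" and V: "subspace V" "\<And>x. x \<in> V \<Longrightarrow> H *v x \<in> V"
    and ne: "w \<in> V" "w \<noteq> 0"
  obtains x m where "x \<in> V" "inner x x = 1" "H *v x = complex_of_real m *s x"
proof -
  have nw: "(1 / norm w) *\<^sub>R w \<in> V \<inter> sphere 0 1" using ne V by (simp add: subspace_scale)
  have "compact (V \<inter> sphere 0 1)" by (simp add: closed_subspace[OF V(1)] closed_Int_compact)
  then obtain x where x: "x \<in> V \<inter> sphere 0 1" "\<And>y. y \<in> V \<inter> sphere 0 1 \<Longrightarrow> hform H y \<le> hform H x"
    using continuous_attains_sup[of "V \<inter> sphere 0 1" "hform H"] nw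
      continuous_on_subset[OF hform_continuous] by blast
  have sc: "hform H (t *\<^sub>R y) = t\<^sup>2 * hform H y" for t y
  proof -
    have "H *v (t *\<^sub>R y) = t *\<^sub>R (H *v y)"
      by (simp add: vec_eq_iff matrix_vector_mult_def scaleR_sum_right)
    then show ?thesis by (simp add: inner_matvec_hform[symmetric] power2_eq_square)
  qed
  have "hform H y \<le> hform H x * inner y y" if "y \<in> V" for y
  proof (cases "y = 0")
    case True then show ?thesis by (simp add: hform_def herm_def)
  next
    case False
    have "(1 / norm y) *\<^sub>R y \<in> V \<inter> sphere 0 1" using False that V by (simp add: subspace_scale)
    from x(2)[OF this] have "(1 / norm y)\<^sup>2 * hform H y \<le> hform H x" by (simp add: sc)
    then show ?thesis using False by (simp add: field_simps power2_norm_eq_inner)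
  qed
  moreover have "inner x x = 1" using x(1) by (simp add: norm_eq_sqrt_inner)
  ultimately show ?thesis
    using rayleigh_maximizer_eigenvector[OF H V, of x "hform H x"] x(1) that by blast
qed

text \<open>
  Eigenvectors are split off one at a time. The induction runs over finite sets of column indices; the
  next eigenvector is found in the complex orthogonal complement of the previous ones, which is nonzero by
  counting real dimensions: \<open>k\<close> vectors and their multiples by \<open>\<i>\<close> span at most \<open>2k\<close> of them.
\<close>

theorem hermitian_diagonalizable:
  fixes H :: "complex ^ 'n ^ 'n"
  assumes H: "H \<in> hermitian_matrices"
  obtains U l where "diagonalizes U l H"
proof -
  have "\<exists>e m. (\<forall>i\<in>A. \<forall>j\<in>A. herm (e i) (e j) = (if i = j then 1 else 0)) \<and>
     (\<forall>i\<in>A. H *v e i = complex_of_real (m i) *s e i)" if "finite A" for A :: "'n set"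
    using that
  proof (induction A rule: finite_induct)
    case empty then show ?case by simp
  next
    case (insert k A)
    then obtain e m where e: "\<And>i j. i \<in> A \<Longrightarrow> j \<in> A \<Longrightarrow> herm (e i) (e j) = (if i = j then 1 else 0)"
      and m: "\<And>i. i \<in> A \<Longrightarrow> H *v e i = complex_of_real (m i) *s e i" by blast
    define V where "V = {x. \<forall>i\<in>A. herm (e i) x = 0}"
    have subV: "subspace V"
      unfolding subspace_def V_def herm_eq_0_iff by (auto simp: inner_add_right)
    have inv: "H *v x \<in> V" if "x \<in> V" for x
      using that unfolding V_def by (simp add: hermitian_swap[OF H] m herm_scale_left)
    define B where "B = e ` A \<union> (\<lambda>i. \<i> *s e i) ` A"
    have "dim B \<le> card B" by (rule dim_le_card') (use insert in \<open>auto simp: B_def\<close>)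
    also have "\<dots> \<le> card A + card A" unfolding B_def
      by (intro order.trans[OF card_Un_le] add_mono card_image_le insert)
    also have "\<dots> < 2 * CARD('n)"
      using psubset_card_mono[of "UNIV::'n set" A] insert.hyps(2) by force
    also have "\<dots> = DIM(complex ^ 'n)" by simp
    finally obtain w where w: "w \<noteq> 0" "\<And>y. y \<in> span B \<Longrightarrow> orthogonal w y"
      using orthogonal_to_subspace_exists by blast
    have "w \<in> V"
      unfolding V_def herm_eq_0_iff using w(2) by (auto simp: B_def orthogonal_def inner_commute[of _ w] intro!: span_base)
    then obtain x \<mu> where x: "x \<in> V" "inner x x = 1" "H *v x = complex_of_real \<mu> *s x"
      using hermitian_eigenvector_in_subspace[OF H subV inv] w(1) by metis
    have x0: "herm (e i) x = 0" "herm x (e i) = 0" if "i \<in> A" for i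
      using x(1) that herm_cnj[of "e i" x] by (auto simp: V_def)
    have hx: "herm x x = 1" using x(2) by (simp add: herm_self)
    let ?e = "e(k := x)" and ?m = "m(k := \<mu>)"
    have "herm (?e i) (?e j) = (if i = j then 1 else 0)" if "i \<in> insert k A" "j \<in> insert k A" for i j
      using that insert.hyps(2) e[of i j] hx x0 by (cases "i = k"; cases "j = k") auto
    moreover have "H *v ?e i = complex_of_real (?m i) *s ?e i" if "i \<in> insert k A" for i
      using that m[of i] x(3) by (cases "i = k") auto
    ultimately show ?case by blast
  qed
  from this[of UNIV] obtain e :: "'n \<Rightarrow> complex ^ 'n" and m :: "'n \<Rightarrow> real" where
    em: "\<And>i j. herm (e i) (e j) = (if i = j then 1 else 0)" "\<And>i. H *v e i = complex_of_real (m i) *s e i" by auto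
  define U :: "complex ^ 'n ^ 'n" where "U = (\<chi> i j. e j $ i)"
  have "column j U = e j" for j by (simp add: U_def column_def vec_eq_iff)
  then show ?thesis using em that[of U "\<chi> i. m i"]
    by (simp add: diagonalizes_def unitary_matrix_def)
qed

lemma diagonalizes_det:
  fixes H :: "complex ^ 'n ^ 'n"
  assumes "diagonalizes U l H"
  shows "det (mat t - H) = (\<Prod>i\<in>UNIV. t - complex_of_real (l $ i))"
proof -
  define L :: "complex ^ 'n ^ 'n" where "L = (\<chi> i j. if i = j then t - complex_of_real (l $ i) else 0)"
  have U: "unitary_matrix U" and e: "\<And>i. H *v column i U = complex_of_real (l $ i) *s column i U"
    using assms by (auto simp: diagonalizes_def)
  have e': "(\<Sum>k\<in>UNIV. H $ i $ k * U $ k $ j) = l $ j * U $ i $ j" for i j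
    using arg_cong[OF e[of j], of "\<lambda>v. v $ i"] by (simp add: matrix_vector_mult_def column_def)
  then have "((mat t - H) ** U) $ i $ j = (U ** L) $ i $ j" for i j
  proof -
    have "((mat t - H) ** U) $ i $ j = (\<Sum>k\<in>UNIV. (if i = k then t * U $ k $ j else 0)) - (\<Sum>k\<in>UNIV. H $ i $ k * U $ k $ j)"
      unfolding sum_subtractf[symmetric] by (simp add: matrix_matrix_mult_def mat_def) (auto intro!: sum.cong simp: algebra_simps)
    also have "\<dots> = (t - l $ j) * U $ i $ j" using e' by (simp add: algebra_simps)
    also have "\<dots> = (\<Sum>k\<in>UNIV. (if k = j then U $ i $ k * (t - l $ k) else 0))" by (simp add: mult.commute)
    also have "\<dots> = (\<Sum>k\<in>UNIV. U $ i $ k * L $ k $ j)"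
      by (rule sum.cong) (auto simp: L_def)
    also have "\<dots> = (U ** L) $ i $ j" by (simp add: matrix_matrix_mult_def)
    finally show ?thesis .
  qed
  then have "(mat t - H) ** U = U ** L" by (simp add: vec_eq_iff)
  then have "det (mat t - H) * det U = det U * det L" by (metis det_mul)
  moreover have "det (adj U) * det U = 1" using U by (metis det_mul det_I unitary_left)
  then have "det U \<noteq> 0" by auto
  moreover have "det L = (\<Prod>i\<in>UNIV. t - complex_of_real (l $ i))"
    by (subst det_diagonal) (auto simp: L_def)
  ultimately show ?thesis by simp
qed

text \<open>
  A polynomial determines the multiset of its roots.
\<close>

lemma prod_linear_eq_imp_permutation:
  fixes x y :: "real ^ 'n"
  assumes "\<And>t::complex. (\<Prod>i\<in>UNIV. t - complex_of_real (x $ i)) = (\<Prod>i\<in>UNIV. t - complex_of_real (y $ i))"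
  obtains \<pi> where "bij \<pi>" "x = (\<chi> i. y $ \<pi> i)"
proof -
  define p where "p = (\<lambda>x::real^'n. \<Prod>i\<in>UNIV. [:- complex_of_real (x $ i), 1:])"
  have "poly (p x) = poly (p y)"
    using assms by (simp add: p_def poly_prod fun_eq_iff)
  then have "p x = p y" by (simp add: poly_eq_poly_eq_iff)
  moreover have "proots (p z) = image_mset (\<lambda>i. complex_of_real (z $ i)) (mset_set UNIV)" for z
  proof -
    have "proots (p z) = (\<Sum>i\<in>UNIV. {#complex_of_real (z $ i)#})"
      unfolding p_def by (subst proots_prod) auto
    also have "(\<Sum>i\<in>A. {#complex_of_real (z $ i)#}) = image_mset (\<lambda>i. complex_of_real (z $ i)) (mset_set A)" if "finite A" for A
      using that by (induction A rule: finite_induct) auto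
    finally show ?thesis by simp
  qed
  ultimately have eq: "image_mset (\<lambda>i. complex_of_real (x $ i)) (mset_set UNIV) = image_mset (\<lambda>i. complex_of_real (y $ i)) (mset_set UNIV)"
    by metis
  obtain \<pi> where "\<pi> permutes UNIV" and \<pi>: "\<forall>i\<in>UNIV. complex_of_real (x $ i) = complex_of_real (y $ \<pi> i)"
    by (rule image_mset_eq_implies_permutes[OF finite_class.finite_UNIV eq])
  then show ?thesis using that[of \<pi>] by (auto simp: vec_eq_iff permutes_bij)
qed

lemma eigenvalues_permutation:
  assumes "diagonalizes U l H"
  obtains \<pi> where "bij \<pi>" "eigenvalues H = (\<chi> i. l $ \<pi> i)"
proof -
  have "\<forall>t. det (mat t - H) = (\<Prod>i\<in>UNIV. t - complex_of_real (eigenvalues H $ i))"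
    unfolding eigenvalues_def by (rule someI_ex) (use diagonalizes_det[OF assms] in blast)
  then show ?thesis
    using prod_linear_eq_imp_permutation[of "eigenvalues H" l] diagonalizes_det[OF assms] that by metis
qed

text \<open>
  For closed convex symmetric \<open>K\<close> this is membership of the eigenvalue vector in \<open>K\<close>. In this form the
  condition is visibly convex and closed in the matrix and needs no choice of eigenvalues.
\<close>

definition spectral_in :: "(real ^ 'n) set \<Rightarrow> complex ^ 'n ^ 'n \<Rightarrow> bool" where
  "spectral_in K H \<longleftrightarrow> H \<in> hermitian_matrices \<and> (\<forall>U. unitary_matrix U \<longrightarrow> diag_in U H \<in> K)"

lemma diag_in_diagonalizes:
  assumes "diagonalizes U l H" shows "diag_in U H = l"
proof -
  have "H *v column i U = complex_of_real (l $ i) *s column i U" "herm (column i U) (column i U) = 1" for i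
    using assms by (auto simp: diagonalizes_def unitary_matrix_def)
  then have "hform H (column i U) = l $ i" for i
    by (simp only: hform_def herm_scale_right) simp
  then show ?thesis by (simp add: diag_in_def vec_eq_iff)
qed

text \<open>
  Schur's theorem: the diagonal of \<open>H\<close> in another orthonormal basis arises from the eigenvalues through the
  matrix of the numbers \<open>|V\<^sub>j\<^sub>i|\<^sup>2\<close> with \<open>V\<close> unitary, and this matrix is doubly stochastic.
\<close>

lemma spectral_in_if_diagonalizes:
  fixes H :: "complex ^ 'n ^ 'n"
  assumes H: "H \<in> hermitian_matrices" and d: "diagonalizes E l H"
    and K: "closed K" "convex K" "symmetric_set K" and l: "l \<in> K"
  shows "spectral_in K H"
  unfolding spectral_in_def
proof (intro conjI allI impI H)
  fix U :: "complex ^ 'n ^ 'n" assume U: "unitary_matrix U"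
  have E: "unitary_matrix E" and e: "\<And>i. H *v column i E = complex_of_real (l $ i) *s column i E"
    using d by (auto simp: diagonalizes_def)
  define V where "V = adj E ** U"
  have V: "unitary_matrix V" unfolding V_def by (intro unitary_mult unitary_adj E U)
  define D where "D = (\<lambda>i j. (cmod (V $ j $ i))\<^sup>2)"
  have D: "complex_of_real (D i j) = cnj (V $ j $ i) * V $ j $ i" for i j
    by (simp only: D_def complex_norm_square mult.commute)
  have colU: "column i U = (\<Sum>j\<in>UNIV. V $ j $ i *s column j E)" for i
  proof -
    have "U = E ** V" unfolding V_def by (simp add: matrix_mul_assoc unitary_right[OF E])
    then show ?thesis
      by (simp add: vec_eq_iff column_def matrix_matrix_mult_def mult.commute)
  qed
  have Hs: "H *v (\<Sum>j\<in>UNIV. c j *s w j) = (\<Sum>j\<in>UNIV. c j *s (H *v w j))" for c :: "'n \<Rightarrow> complex" and w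
    by (simp add: vec.sum vector_scalar_commute)
  have herm_sum: "herm x (\<Sum>j\<in>UNIV. w j) = (\<Sum>j\<in>UNIV. herm x (w j))" for x :: "complex ^ 'n" and w :: "'n \<Rightarrow> _"
    by (simp add: herm_def sum_distrib_left sum_component) (rule sum.swap)
  have hVE: "herm (column i U) (column j E) = cnj (V $ j $ i)" for i j
  proof -
    have "herm (column j E) (column i U) = V $ j $ i"
    proof -
      have "herm (column j E) (column k E) = (if j = k then 1 else 0)" for k
        using E by (auto simp: unitary_matrix_def)
      then show ?thesis unfolding colU herm_sum by (simp only: herm_scale_right) (simp add: if_distrib cong: if_cong)
    qed
    then show ?thesis by (metis herm_cnj)
  qed
  have "herm (column i U) (H *v column i U) = (\<Sum>j\<in>UNIV. V $ j $ i * (l $ j * cnj (V $ j $ i)))" for i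
  proof -
    have "H *v column i U = (\<Sum>j\<in>UNIV. V $ j $ i *s (complex_of_real (l $ j) *s column j E))"
      by (subst colU) (simp only: Hs e)
    then show ?thesis by (simp only: herm_sum herm_scale_right hVE)
  qed
  moreover have "(\<Sum>j\<in>UNIV. V $ j $ i * (l $ j * cnj (V $ j $ i))) = complex_of_real (\<Sum>j\<in>UNIV. D i j * l $ j)" for i
    unfolding of_real_sum of_real_mult D by (intro sum.cong refl) (simp only: mult.commute mult.left_commute)
  ultimately have hf: "herm (column i U) (H *v column i U) = complex_of_real (\<Sum>j\<in>UNIV. D i j * l $ j)" for i
    by simp
  have *: "(\<chi> i. \<Sum>j\<in>UNIV. D i j * l $ j) \<in> K"
  proof (rule doubly_stochastic_image_in_symmetric_convex[OF _ _ _ K l])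
    show "D i j \<ge> 0" for i j by (simp add: D_def)
    have "complex_of_real (\<Sum>j\<in>UNIV. D i j) = 1" for i
      using V by (simp add: D unitary_matrix_def herm_def column_def)
    then show "(\<Sum>j\<in>UNIV. D i j) = 1" for i by (metis of_real_eq_1_iff)
    have "complex_of_real (\<Sum>i\<in>UNIV. D i j) = (V ** adj V) $ j $ j" for j
      by (simp add: D adj_def matrix_matrix_mult_def mult.commute)
    then have "complex_of_real (\<Sum>i\<in>UNIV. D i j) = 1" for j
      using unitary_right[OF V] by (simp add: mat_def)
    then show "(\<Sum>i\<in>UNIV. D i j) = 1" for j by (metis of_real_eq_1_iff)
  qed
  have "diag_in U H = (\<chi> i. \<Sum>j\<in>UNIV. D i j * l $ j)"
    by (simp add: diag_in_def hform_def hf)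
  then show "diag_in U H \<in> K" using * by simp
qed

lemma spectral_in_iff_eigenvalues:
  assumes H: "H \<in> hermitian_matrices" and K: "closed K" "convex K" "symmetric_set K"
  shows "spectral_in K H \<longleftrightarrow> eigenvalues H \<in> K"
proof -
  obtain U l where d: "diagonalizes U l H" using hermitian_diagonalizable[OF H] .
  obtain \<pi> where \<pi>: "bij \<pi>" "eigenvalues H = (\<chi> i. l $ \<pi> i)" using eigenvalues_permutation[OF d] .
  have "l = (\<chi> i. eigenvalues H $ inv \<pi> i)"
    using \<pi> by (simp add: vec_eq_iff bij_is_surj surj_f_inv_f)
  moreover have "bij (inv \<pi>)" using \<pi> bij_imp_bij_inv by blast
  ultimately have 1: "l \<in> K" if "eigenvalues H \<in> K" using that K(3) unfolding symmetric_set_def by metis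
  have 2: "eigenvalues H \<in> K" if "l \<in> K" using that K(3) \<pi> unfolding symmetric_set_def by metis
  show ?thesis
  proof
    assume "spectral_in K H"
    then have "diag_in U H \<in> K" using d by (auto simp: spectral_in_def diagonalizes_def)
    then show "eigenvalues H \<in> K" using 2 by (simp add: diag_in_diagonalizes[OF d])
  next
    assume "eigenvalues H \<in> K"
    then show "spectral_in K H" using spectral_in_if_diagonalizes[OF H d K] 1 by blast
  qed
qed

section \<open>The operator and its superlevel sets\<close>

lemma closed_spectral_in:
  assumes "closed K" shows "closed {H :: complex ^ 'n ^ 'n. spectral_in K H}"
proof -
  have 1: "closed (hermitian_matrices :: (complex ^ 'n ^ 'n) set)"
    unfolding hermitian_matrices_def
    by (intro closed_Collect_all closed_Collect_eq continuous_intros)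
  have "continuous_on UNIV (\<lambda>H :: complex ^ 'n ^ 'n. diag_in U H)" for U
    unfolding diag_in_def hform_def herm_def matrix_vector_mult_def
    by (intro continuous_on_vec_lambda) (simp, intro continuous_intros)
  then have 2: "closed {H. diag_in U H \<in> K}" for U :: "complex ^ 'n ^ 'n"
    using continuous_closed_vimage[OF assms, of "diag_in U"] by (simp add: vimage_def continuous_on_eq_continuous_at)
  have "{H :: complex ^ 'n ^ 'n. spectral_in K H} =
      hermitian_matrices \<inter> {H. \<forall>U. unitary_matrix U \<longrightarrow> diag_in U H \<in> K}"
    by (auto simp: spectral_in_def)
  moreover have "closed {H :: complex ^ 'n ^ 'n. \<forall>U. unitary_matrix U \<longrightarrow> diag_in U H \<in> K}"
  proof (intro closed_Collect_all)
    fix U :: "complex ^ 'n ^ 'n"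
    show "closed {H. unitary_matrix U \<longrightarrow> diag_in U H \<in> K}"
      using 2[of U] by (cases "unitary_matrix U") auto
  qed
  ultimately show ?thesis using closed_Int[OF 1] by simp
qed

lemma matrix_vector_add_scaled_identity:
  fixes H :: "complex ^ 'n ^ 'n"
  shows "(H + t *\<^sub>R mat 1) *v x = H *v x + t *\<^sub>R x"
proof -
  have "(t *\<^sub>R A) *v x = t *\<^sub>R (A *v x)" for A :: "complex ^ 'n ^ 'n"
    by (simp add: vec_eq_iff matrix_vector_mult_def scaleR_sum_right)
  then show ?thesis by (simp add: matrix_vector_mult_add_rdistrib)
qed

lemma hform_add_scaled_identity: "hform (H + t *\<^sub>R mat 1) x = hform H x + t * inner x x"
  by (simp add: matrix_vector_add_scaled_identity inner_matvec_hform[symmetric] inner_add_right)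

lemma diagonalizes_add_scaled_identity:
  assumes "diagonalizes U l H"
  shows "diagonalizes U (\<chi> i. l $ i + t) (H + t *\<^sub>R mat 1)"
proof -
  have "(H + t *\<^sub>R mat 1) *v x = H *v x + complex_of_real t *s x" for x
    unfolding matrix_vector_add_scaled_identity
    by (simp add: vec_eq_iff) (simp add: scaleR_conv_of_real)
  then show ?thesis using assms by (simp add: diagonalizes_def vec_eq_iff algebra_simps)
qed

lemma hermitian_add_scaled_identity:
  "H \<in> hermitian_matrices \<Longrightarrow> H + t *\<^sub>R mat 1 \<in> hermitian_matrices"
  unfolding hermitian_matrices_def mem_Collect_eq
proof (intro allI)
  fix i j assume "\<forall>i j. H $ i $ j = cnj (H $ j $ i)"
  then have h: "cnj (H $ j $ i) = H $ i $ j" by metis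
  show "(H + t *\<^sub>R mat 1) $ i $ j = cnj ((H + t *\<^sub>R mat 1) $ j $ i)"
    by (simp add: h mat_def)
qed

lemma inner_column_unitary: "unitary_matrix U \<Longrightarrow> inner (column i U) (column i U) = 1"
  using Re_herm[of "column i U" "column i U"] by (simp add: unitary_matrix_def)

text \<open>
  The superlevel sets \<open>level c\<close> of \<open>f\<close> carry all that is used about \<open>f\<close>: they are closed, convex and
  symmetric, and adding vectors with nonnegative entries does not leave them.
\<close>

locale admissible =
  fixes \<Gamma> :: "(real ^ 'n) set" and f :: "real ^ 'n \<Rightarrow> real"
  assumes cone: "admissible_cone \<Gamma>" and fn: "admissible_fun \<Gamma> f"
begin

definition level :: "real \<Rightarrow> (real ^ 'n) set" where
  "level c = {x \<in> closure \<Gamma>. c \<le> f x}"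

lemma cone_open: "open \<Gamma>"
  by (rule cone[unfolded admissible_cone_def, THEN conjunct2, THEN conjunct1])

lemma cone_convex: "convex \<Gamma>"
  by (rule cone[unfolded admissible_cone_def, THEN conjunct2, THEN conjunct2, THEN conjunct1])

lemma cone_scale: "x \<in> \<Gamma> \<Longrightarrow> c > 0 \<Longrightarrow> c *\<^sub>R x \<in> \<Gamma>"
  by (rule cone[unfolded admissible_cone_def, THEN conjunct2, THEN conjunct2, THEN conjunct2, THEN conjunct1, rule_format])

lemma cone_symmetric: "symmetric_set \<Gamma>"
  unfolding symmetric_set_def by (rule cone[unfolded admissible_cone_def, THEN conjunct2, THEN conjunct2, THEN conjunct2, THEN conjunct2, THEN conjunct1])

lemma positive_cone_subset: "Gamma_cone CARD('n) \<subseteq> \<Gamma>"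
  by (rule cone[unfolded admissible_cone_def, THEN conjunct2, THEN conjunct2, THEN conjunct2, THEN conjunct2, THEN conjunct2, THEN conjunct1])

lemma cone_subset: "\<Gamma> \<subseteq> Gamma_cone 1"
  by (rule cone[unfolded admissible_cone_def, THEN conjunct2, THEN conjunct2, THEN conjunct2, THEN conjunct2, THEN conjunct2, THEN conjunct2])

lemma f_nonneg: "x \<in> closure \<Gamma> \<Longrightarrow> f x \<ge> 0"
  by (rule fn[unfolded admissible_fun_def, THEN conjunct1, rule_format])

lemma f_continuous: "continuous_on (closure \<Gamma>) f"
  by (rule fn[unfolded admissible_fun_def, THEN conjunct2, THEN conjunct1])

lemma f_symmetric: "x \<in> closure \<Gamma> \<Longrightarrow> bij \<pi> \<Longrightarrow> f (\<chi> i. x $ \<pi> i) = f x"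
  by (rule fn[unfolded admissible_fun_def, THEN conjunct2, THEN conjunct2, THEN conjunct1, rule_format])

lemma f_concave: "concave_on (closure \<Gamma>) f"
  by (rule fn[unfolded admissible_fun_def, THEN conjunct2, THEN conjunct2, THEN conjunct2, THEN conjunct1])

lemma f_frontier: "x \<in> frontier \<Gamma> \<Longrightarrow> f x = 0"
  by (rule fn[unfolded admissible_fun_def, THEN conjunct2, THEN conjunct2, THEN conjunct2, THEN conjunct2, THEN conjunct2, THEN conjunct2, rule_format])

lemma f_concaveD:
  assumes "x \<in> closure \<Gamma>" "y \<in> closure \<Gamma>" "u \<ge> 0" "v \<ge> 0" "u + v = 1"
  shows "u * f x + v * f y \<le> f (u *\<^sub>R x + v *\<^sub>R y)"
  using f_concave assms by (auto simp: concave_on_iff)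

lemma closure_scale:
  assumes "x \<in> closure \<Gamma>" "c > 0" shows "c *\<^sub>R x \<in> closure \<Gamma>"
proof -
  have "(\<lambda>x. c *\<^sub>R x) ` closure \<Gamma> \<subseteq> closure \<Gamma>"
    by (rule image_closure_subset)
       (use cone_scale assms closure_subset in \<open>auto intro!: continuous_intros\<close>)
  then show ?thesis using assms by auto
qed

lemma closure_symmetric: "symmetric_set (closure \<Gamma>)"
  unfolding symmetric_set_def
proof (intro ballI allI impI)
  fix x and \<pi> :: "'n \<Rightarrow> 'n" assume x: "x \<in> closure \<Gamma>" and \<pi>: "bij \<pi>"
  have "(\<lambda>x. (\<chi> i. x $ \<pi> i)) ` closure \<Gamma> \<subseteq> closure \<Gamma>"
    by (rule image_closure_subset)
       (use cone_symmetric \<pi> closure_subset in \<open>auto simp: symmetric_set_def intro!: continuous_intros\<close>)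
  then show "(\<chi> i. x $ \<pi> i) \<in> closure \<Gamma>" using x by auto
qed

lemma positive_in_cone:
  assumes "\<And>i. x $ i > 0" shows "x \<in> \<Gamma>"
proof -
  have "elem_sym j x > 0" if j: "j \<in> {1..CARD('n)}" for j
  proof -
    obtain J :: "'n set" where "card J = j" "J \<subseteq> UNIV"
      using obtain_subset_with_card_n[of j UNIV] j by auto
    then have "{J. J \<subseteq> (UNIV :: 'n set) \<and> card J = j} \<noteq> {}" by blast
    then show ?thesis unfolding elem_sym_def
      by (intro sum_pos) (auto intro!: prod_pos assms)
  qed
  then have "x \<in> Gamma_cone CARD('n)" by (simp add: Gamma_cone_def)
  then show ?thesis using positive_cone_subset by blast
qed

lemma nonneg_in_closure:
  assumes "\<And>i. x $ i \<ge> 0" shows "x \<in> closure \<Gamma>"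
proof -
  have "(\<lambda>t. x + t *\<^sub>R (\<chi> i. 1)) ` closure {0<..} \<subseteq> closure \<Gamma>"
  proof (rule image_closure_subset)
    show "(\<lambda>t. x + t *\<^sub>R (\<chi> i. 1)) ` {0<..} \<subseteq> closure \<Gamma>"
      using assms by (auto intro!: subsetD[OF closure_subset] positive_in_cone add_nonneg_pos)
  qed (auto intro!: continuous_intros)
  then have "x + 0 *\<^sub>R (\<chi> i. 1) \<in> closure \<Gamma>" by (rule subsetD) (rule image_eqI[of _ _ 0], simp_all)
  then show ?thesis by simp
qed

text \<open>
  The point \<open>x + p\<close> is the midpoint of \<open>2p\<close>, an interior point of the cone, and of \<open>2x\<close>, a point of its
  closure.
\<close>

lemma closure_add_constant:
  assumes x: "x \<in> closure \<Gamma>" and t: "t > 0" shows "(\<chi> i. x $ i + t) \<in> \<Gamma>"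
proof -
  define p where "p = (\<chi> i::'n. t)"
  have p: "p \<in> \<Gamma>" using t by (intro positive_in_cone) (simp add: p_def)
  have e: "(\<chi> i. x $ i + t) = x + p" by (simp add: vec_eq_iff p_def)
  show ?thesis
  proof (cases "x = p")
    case True
    have "p + p \<in> \<Gamma>" using cone_scale[OF p, of 2] unfolding scaleR_2 by auto
    then show ?thesis unfolding e using True by (simp only:)
  next
    case False
    have "2 *\<^sub>R p \<in> interior \<Gamma>" using p cone_scale cone_open by (simp add: interior_open)
    moreover have "2 *\<^sub>R x \<in> closure \<Gamma>" using closure_scale x by simp
    ultimately have "open_segment (2 *\<^sub>R p) (2 *\<^sub>R x) \<subseteq> interior \<Gamma>"
      using in_interior_closure_convex_segment[OF cone_convex] by blast
    moreover have "x + p \<in> open_segment (2 *\<^sub>R p) (2 *\<^sub>R x)"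
      using False by (auto simp: in_segment intro!: exI[of _ "1/2"])
    ultimately show ?thesis using e interior_subset by auto
  qed
qed

lemma closure_sum_nonneg:
  assumes "x \<in> closure \<Gamma>" shows "(\<Sum>i\<in>UNIV. x $ i) \<ge> 0"
proof -
  have "elem_sym 1 y = (\<Sum>i\<in>UNIV. y $ i)" for y :: "real ^ 'n"
  proof -
    have "{J. J \<subseteq> (UNIV :: 'n set) \<and> card J = 1} = (\<lambda>i. {i}) ` UNIV" by (auto simp: card_1_singleton_iff)
    then show ?thesis by (simp add: elem_sym_def sum.reindex inj_on_def)
  qed
  then have "\<Gamma> \<subseteq> {x. (\<Sum>i\<in>UNIV. x $ i) \<ge> 0}"
    using cone_subset by (force simp: Gamma_cone_def)
  moreover have "closed {x :: real ^ 'n. (\<Sum>i\<in>UNIV. x $ i) \<ge> 0}"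
    by (intro closed_Collect_le continuous_intros)
  ultimately show ?thesis using assms closure_minimal by blast
qed

lemma closed_level: "closed (level c)"
proof -
  have "level c = closure \<Gamma> \<inter> f -` {c..}" by (auto simp: level_def)
  then show ?thesis using continuous_closed_preimage[OF f_continuous, of "{c..}"] by simp
qed

lemma level_convex_combination:
  assumes "x \<in> level c" "y \<in> level d" "u \<ge> 0" "v \<ge> 0" "u + v = 1"
  shows "u *\<^sub>R x + v *\<^sub>R y \<in> level (u * c + v * d)"
proof -
  have "u *\<^sub>R x + v *\<^sub>R y \<in> closure \<Gamma>"
    using convexD[OF convex_closure[OF cone_convex]] assms by (auto simp: level_def)
  moreover have "u * c + v * d \<le> u * f x + v * f y"
    using assms by (intro add_mono mult_left_mono) (auto simp: level_def)
  ultimately show ?thesis using f_concaveD[of x y u v] assms by (auto simp: level_def)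
qed

lemma convex_level: "convex (level c)"
proof (rule convexI)
  fix x y u v assume *: "x \<in> level c" "y \<in> level c" and uv: "u \<ge> (0::real)" "v \<ge> 0" "u + v = 1"
  have "u * c + v * c = c" using uv(3) by (metis distrib_right mult_1)
  then show "u *\<^sub>R x + v *\<^sub>R y \<in> level c" using level_convex_combination[OF * uv] by simp
qed

lemma level_symmetric: "symmetric_set (level c)"
  using closure_symmetric f_symmetric unfolding symmetric_set_def level_def by simp

text \<open>
  Monotonicity up to the boundary is a consequence of concavity: \<open>x + p\<close> is a convex combination of
  \<open>s x\<close> and a large multiple of \<open>p\<close>, where \<open>f\<close> is nonnegative. Hence \<open>f (s x) / s \<le> f (x + p)\<close> for
  \<open>s > 1\<close>, and \<open>s\<close> tends to 1.
\<close>

lemma level_mono: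
  assumes x: "x \<in> level c" and p: "\<And>i. p $ i \<ge> 0" shows "x + p \<in> level c"
proof -
  have xc: "x \<in> closure \<Gamma>" and fx: "c \<le> f x" using x by (auto simp: level_def)
  have pc: "p \<in> closure \<Gamma>" using p by (rule nonneg_in_closure)
  have comb: "(1/s) * f (s *\<^sub>R x) \<le> f (x + p) \<and> x + p \<in> closure \<Gamma>" if s: "s > 1" for s
  proof -
    define v where "v = 1 - 1/s"
    have v: "v > 0" using s by (simp add: v_def)
    have sx: "s *\<^sub>R x \<in> closure \<Gamma>" using closure_scale[OF xc] s by simp
    have pv: "(1/v) *\<^sub>R p \<in> closure \<Gamma>" using closure_scale[OF pc] v by simp
    have uv: "1/s \<ge> 0" "v \<ge> 0" "1/s + v = 1" using s v by (auto simp: v_def)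
    have e: "(1/s) *\<^sub>R (s *\<^sub>R x) + v *\<^sub>R ((1/v) *\<^sub>R p) = x + p" using s v by simp
    have "(1/s) * f (s *\<^sub>R x) + v * f ((1/v) *\<^sub>R p) \<le> f (x + p)"
      using f_concaveD[OF sx pv uv] unfolding e .
    moreover have "v * f ((1/v) *\<^sub>R p) \<ge> 0" using f_nonneg[OF pv] v by simp
    moreover have "x + p \<in> closure \<Gamma>"
      using convexD[OF convex_closure[OF cone_convex] sx pv uv] unfolding e .
    ultimately show ?thesis by linarith
  qed
  define g where "g = (\<lambda>s. (1/s) * f (s *\<^sub>R x))"
  have "continuous_on {0<..} g" unfolding g_def
    by (intro continuous_intros continuous_on_compose2[OF f_continuous]) (auto intro: closure_scale xc)
  then have "isCont g 1" by (simp add: continuous_on_eq_continuous_at)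
  then have "(g \<longlongrightarrow> g 1) (at_right 1)" by (simp add: isCont_def filterlim_at_split)
  moreover have "\<forall>\<^sub>F s in at_right 1. g s \<le> f (x + p)"
    unfolding g_def using comb by (auto simp: eventually_at_filter)
  ultimately have "g 1 \<le> f (x + p)" by (rule tendsto_upperbound) simp
  then show ?thesis using fx comb[of 2] by (simp add: g_def level_def)
qed

lemma positive_level_interior: "x \<in> level c \<Longrightarrow> c > 0 \<Longrightarrow> x \<in> \<Gamma>"
proof (rule ccontr)
  assume x: "x \<in> level c" "c > 0" "x \<notin> \<Gamma>"
  then have "x \<in> frontier \<Gamma>" by (simp add: frontier_def level_def interior_open[OF cone_open])
  then have "f x = 0" by (rule f_frontier)
  then show False using x by (simp add: level_def)
qed

lemmas level_closed_convex_symmetric = closed_level convex_level level_symmetric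

text \<open>
  The closure in the definition of the operator is taken in the space of matrices, whereas \<open>level\<close> is
  about the closure of the cone. The two match since the diagonal condition is closed in \<open>H\<close>, and since
  adding \<open>t\<close> times the identity moves the eigenvalues into the open cone for each \<open>t > 0\<close>.
\<close>

theorem F_op_ge_iff: "ereal c \<le> F_op \<Gamma> f H \<longleftrightarrow> spectral_in (level c) H"
proof
  assume *: "ereal c \<le> F_op \<Gamma> f H"
  then have H: "H \<in> closure (M_cone \<Gamma>)" and fe: "c \<le> f (eigenvalues H)"
    by (auto simp: F_op_def split: if_splits)
  have "M_cone \<Gamma> \<subseteq> {H. spectral_in (closure \<Gamma>) H}"
    using subsetD[OF closure_subset] by (auto simp: M_cone_def spectral_in_iff_eigenvalues closure_symmetric convex_closure cone_convex)
  then have "spectral_in (closure \<Gamma>) H"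
    using H closure_minimal[OF _ closed_spectral_in[of "closure \<Gamma>"]] by auto
  then have "H \<in> hermitian_matrices" "eigenvalues H \<in> closure \<Gamma>"
    using spectral_in_iff_eigenvalues[of H "closure \<Gamma>"] closure_symmetric convex_closure cone_convex
    by (auto simp: spectral_in_def)
  then show "spectral_in (level c) H"
    using spectral_in_iff_eigenvalues[OF _ level_closed_convex_symmetric] fe by (auto simp: level_def)
next
  assume *: "spectral_in (level c) H"
  then have H: "H \<in> hermitian_matrices" by (simp add: spectral_in_def)
  then have e: "eigenvalues H \<in> level c"
    using * spectral_in_iff_eigenvalues[OF _ level_closed_convex_symmetric] by auto
  obtain U l where d: "diagonalizes U l H" using hermitian_diagonalizable[OF H] .
  have l: "l \<in> closure \<Gamma>"
    using * d diag_in_diagonalizes[OF d] by (auto simp: spectral_in_def diagonalizes_def level_def)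
  have "H + t *\<^sub>R mat 1 \<in> M_cone \<Gamma>" if t: "t > 0" for t
  proof -
    obtain \<pi> where "bij \<pi>" "eigenvalues (H + t *\<^sub>R mat 1) = (\<chi> i. (\<chi> i. l $ i + t) $ \<pi> i)"
      using eigenvalues_permutation[OF diagonalizes_add_scaled_identity[OF d]] .
    then have "eigenvalues (H + t *\<^sub>R mat 1) \<in> \<Gamma>"
      using closure_add_constant[OF l t] cone_symmetric unfolding symmetric_set_def by metis
    then show ?thesis using hermitian_add_scaled_identity[OF H] by (simp add: M_cone_def)
  qed
  then have "(\<lambda>t. H + t *\<^sub>R mat 1) ` {0<..} \<subseteq> closure (M_cone \<Gamma>)"
    using closure_subset by fastforce
  then have "(\<lambda>t. H + t *\<^sub>R mat 1) ` closure {0<..} \<subseteq> closure (M_cone \<Gamma>)"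
    by (intro image_closure_subset) (auto intro!: continuous_intros)
  then have "H + 0 *\<^sub>R mat 1 \<in> closure (M_cone \<Gamma>)" by (rule subsetD) (rule image_eqI[of _ _ 0], simp_all)
  then show "ereal c \<le> F_op \<Gamma> f H" using e by (simp add: F_op_def level_def)
qed

lemma spectral_in_level_mono:
  assumes "spectral_in (level c) H" "H' \<in> hermitian_matrices" "\<And>x. hform H x \<le> hform H' x"
  shows "spectral_in (level c) H'"
  unfolding spectral_in_def
proof (intro conjI allI impI assms(2))
  fix U :: "complex ^ 'n ^ 'n" assume "unitary_matrix U"
  then have "diag_in U H \<in> level c" using assms(1) by (simp add: spectral_in_def)
  then have "diag_in U H + (diag_in U H' - diag_in U H) \<in> level c"
    by (rule level_mono) (simp add: diag_in_def assms(3))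
  then show "diag_in U H' \<in> level c" by simp
qed

text \<open>
  Lower semicontinuity of \<open>F\<close> where it is positive: there the eigenvalues lie in the open cone, because
  \<open>f\<close> vanishes on its frontier, and may be decreased a little. Monotonicity then yields all matrices
  above \<open>H - \<eta>\<close>.
\<close>

lemma spectral_in_level_stable:
  assumes H: "spectral_in (level c) H" and c: "0 < c" "c' < c"
  obtains \<eta> where "\<eta> > 0"
    "\<And>H'. H' \<in> hermitian_matrices \<Longrightarrow> (\<And>x. hform H x - \<eta> * inner x x \<le> hform H' x) \<Longrightarrow> spectral_in (level c') H'"
proof -
  have Hh: "H \<in> hermitian_matrices" using H by (simp add: spectral_in_def)
  obtain U l where d: "diagonalizes U l H" using hermitian_diagonalizable[OF Hh] .
  have l: "l \<in> level c" using H d diag_in_diagonalizes[OF d] by (auto simp: spectral_in_def diagonalizes_def)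
  then have l\<Gamma>: "l \<in> \<Gamma>" using positive_level_interior c by blast
  have fc: "continuous_on \<Gamma> f" using f_continuous closure_subset continuous_on_subset by blast
  have "open (\<Gamma> \<inter> f -` {c'<..})" using continuous_open_preimage[OF fc cone_open, of "{c'<..}"] by simp
  moreover have "l \<in> \<Gamma> \<inter> f -` {c'<..}" using l\<Gamma> l c by (auto simp: level_def)
  ultimately have "open ((\<lambda>t. l + t *\<^sub>R (\<chi> i. -1)) -` (\<Gamma> \<inter> f -` {c'<..}))"
    and "0 \<in> ((\<lambda>t. l + t *\<^sub>R (\<chi> i. -1)) -` (\<Gamma> \<inter> f -` {c'<..}))"
     apply -
    subgoal by (erule open_vimage) (intro continuous_intros)
    subgoal by simp
    done
  then obtain e where e: "e > 0" "ball 0 e \<subseteq> (\<lambda>t. l + t *\<^sub>R (\<chi> i. -1)) -` (\<Gamma> \<inter> f -` {c'<..})"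
    using openE by blast
  define \<eta> where "\<eta> = e / 2"
  have \<eta>: "\<eta> > 0" "\<eta> \<in> ball 0 e" using e by (auto simp: \<eta>_def)
  then have "l + \<eta> *\<^sub>R (\<chi> i. -1) \<in> \<Gamma> \<inter> f -` {c'<..}" using e(2) by blast
  then have "l + \<eta> *\<^sub>R (\<chi> i. -1) \<in> level c'"
    using subsetD[OF closure_subset, of _ \<Gamma>] unfolding level_def by simp
  moreover have "l + \<eta> *\<^sub>R (\<chi> i. -1) = (\<chi> i. l $ i + (-\<eta>))" by (simp add: vec_eq_iff)
  ultimately have "spectral_in (level c') (H + (-\<eta>) *\<^sub>R mat 1)"
    using spectral_in_if_diagonalizes[OF hermitian_add_scaled_identity[OF Hh] diagonalizes_add_scaled_identity[OF d]
        level_closed_convex_symmetric] by metis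
  then have "spectral_in (level c') H'" if "H' \<in> hermitian_matrices" "\<And>x. hform H x - \<eta> * inner x x \<le> hform H' x" for H'
    by (rule spectral_in_level_mono) (use that in \<open>auto simp: hform_add_scaled_identity simp del: scaleR_minus_left\<close>)
  then show ?thesis using that \<eta> by blast
qed

text \<open>
  A separating functional is nonnegative on the coordinate directions, as \<open>level c\<close> is stable under
  adding them. A small multiple of the sum of the coordinates, which is nonnegative on the cone, makes it
  strictly positive. Positive normals are what makes the linear operators below uniformly elliptic.
\<close>

lemma level_halfspaces:
  assumes ne: "level c \<noteq> {}"
    and hs: "\<And>a b. (\<And>i. a $ i > 0) \<Longrightarrow> (\<And>y. y \<in> level c \<Longrightarrow> b \<le> inner a y) \<Longrightarrow> b \<le> inner a x"
  shows "x \<in> level c"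
proof (rule ccontr)
  assume "x \<notin> level c"
  then obtain a b where ab: "inner a x < b" "\<And>y. y \<in> level c \<Longrightarrow> b < inner a y"
    using separating_hyperplane_closed_point[OF convex_level closed_level, of x c] by blast
  obtain y0 where y0: "y0 \<in> level c" using ne by blast
  have a: "a $ i \<ge> 0" for i
  proof (rule ccontr)
    assume "\<not> a $ i \<ge> 0"
    then have neg: "a $ i < 0" by simp
    define t where "t = (inner a y0 - b) / (- a $ i)"
    have "t \<ge> 0" unfolding t_def by (rule divide_nonneg_nonneg) (use neg ab(2)[OF y0] in auto)
    then have "y0 + t *\<^sub>R axis i 1 \<in> level c"
      by (intro level_mono y0) (simp add: axis_def)
    from ab(2)[OF this] have "b < inner a y0 + t * a $ i" by (simp add: inner_add_right inner_axis)
    moreover have "t * a $ i = b - inner a y0" using neg by (simp add: t_def)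
    ultimately show False by simp
  qed
  define s where "s = (\<Sum>i\<in>UNIV. x $ i)"
  define \<eta> where "\<eta> = (b - inner a x) / (2 * (\<bar>s\<bar> + 1))"
  have \<eta>: "\<eta> > 0" using ab(1) by (simp add: \<eta>_def)
  define a' where "a' = a + \<eta> *\<^sub>R (\<chi> i. 1)"
  have i1: "inner a' y = inner a y + \<eta> * (\<Sum>i\<in>UNIV. y $ i)" for y
    by (simp add: a'_def inner_vec_def sum.distrib sum_distrib_left algebra_simps)
  have "b \<le> inner a' x"
  proof (rule hs)
    show "a' $ i > 0" for i using a[of i] \<eta> by (simp add: a'_def)
    show "b \<le> inner a' y" if "y \<in> level c" for y
      using ab(2)[OF that] closure_sum_nonneg[of y] that \<eta> by (simp add: i1 level_def add_increasing2 less_imp_le)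
  qed
  moreover have "\<eta> * s < b - inner a x"
  proof -
    have "\<eta> * s \<le> \<eta> * (\<bar>s\<bar> + 1)" using \<eta> by (intro mult_left_mono) auto
    also have "\<dots> = (b - inner a x) / 2"
    proof -
      have "\<bar>s\<bar> + 1 \<noteq> 0" by linarith
      then show ?thesis unfolding \<eta>_def by (metis (no_types, lifting) divide_divide_eq_left mult.commute nonzero_mult_div_cancel_left times_divide_eq_right)
    qed
    also have "\<dots> < b - inner a x" using ab(1) by simp
    finally show ?thesis .
  qed
  ultimately show False by (simp add: i1 s_def)
qed

end

section \<open>Twice continuously differentiable functions and the complex Hessian\<close>

text \<open>
  The property \<open>C2_on\<close> with its two derivatives made explicit, so that statements can refer to them.
\<close>

definition C2w :: "'a::real_normed_vector set \<Rightarrow> ('a \<Rightarrow> real) \<Rightarrow> ('a \<Rightarrow> 'a \<Rightarrow>\<^sub>L real) \<Rightarrow>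
    ('a \<Rightarrow> 'a \<Rightarrow>\<^sub>L 'a \<Rightarrow>\<^sub>L real) \<Rightarrow> bool" where
  "C2w U q D D2 \<longleftrightarrow>
     (\<forall>z\<in>U. (q has_derivative blinfun_apply (D z)) (at z)) \<and>
     (\<forall>z\<in>U. (D has_derivative blinfun_apply (D2 z)) (at z)) \<and>
     continuous_on U D2"

lemma C2_on_iff: "C2_on U q \<longleftrightarrow> (\<exists>D D2. C2w U q D D2)"
  by (simp add: C2_on_def C2w_def)

lemma C2w_subset: "C2w U q D D2 \<Longrightarrow> V \<subseteq> U \<Longrightarrow> C2w V q D D2"
  by (auto simp: C2w_def intro: continuous_on_subset)

lemma C2w_add:
  assumes "C2w U q D D2" "C2w U p E E2"
  shows "C2w U (\<lambda>z. q z + p z) (\<lambda>z. D z + E z) (\<lambda>z. D2 z + E2 z)"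
  using assms unfolding C2w_def
  by (auto simp: plus_blinfun.rep_eq intro!: has_derivative_add continuous_on_add)

lemma C2w_scale:
  assumes "C2w U q D D2"
  shows "C2w U (\<lambda>z. c * q z) (\<lambda>z. c *\<^sub>R D z) (\<lambda>z. c *\<^sub>R D2 z)"
  using assms unfolding C2w_def
  by (auto simp: scaleR_blinfun.rep_eq intro!: has_derivative_scaleR_right
     has_derivative_mult_right continuous_on_scaleR continuous_on_const)

lemma C2w_const: "C2w U (\<lambda>z. c) (\<lambda>z. 0) (\<lambda>z. 0)"
  by (auto simp: C2w_def zero_blinfun.rep_eq)

lemma C2w_continuous: "C2w U q D D2 \<Longrightarrow> continuous_on U q"
  unfolding C2w_def by (meson continuous_at_imp_continuous_on has_derivative_continuous)

lemma isCont_tendsto_nhds: "isCont g x \<Longrightarrow> (g \<longlongrightarrow> g x) (nhds x)"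
  unfolding isCont_def by (rule tendsto_at_iff_tendsto_nhds[THEN iffD1])

lemma C2w_tendsto:
  assumes "C2w U q D D2" "open U" "z \<in> U" shows "(q \<longlongrightarrow> q z) (nhds z)"
  by (rule isCont_tendsto_nhds) (use C2w_continuous[OF assms(1)] assms in \<open>simp add: continuous_on_eq_continuous_at\<close>)

text \<open>
  Composition with \<open>T\<close> on the right as a bounded linear map of functionals, which is the form in which
  the chain rule delivers the second derivative along \<open>T\<close>.
\<close>

definition precomp :: "('b::real_normed_vector \<Rightarrow>\<^sub>L 'a::real_normed_vector) \<Rightarrow> ('a \<Rightarrow>\<^sub>L real) \<Rightarrow>\<^sub>L ('b \<Rightarrow>\<^sub>L real)" where
  "precomp T = Blinfun (\<lambda>g. g o\<^sub>L T)"

lemma precomp_apply: "blinfun_apply (precomp T) g = g o\<^sub>L T"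
  unfolding precomp_def
  by (subst bounded_linear_Blinfun_apply)
     (auto intro: bounded_bilinear.bounded_linear_left[OF bounded_bilinear_blinfun_compose])

lemma C2w_affine:
  fixes T :: "'b::real_normed_vector \<Rightarrow>\<^sub>L 'a::real_normed_vector"
  assumes "C2w U q D D2" "\<And>x. x \<in> V \<Longrightarrow> y + T x \<in> U"
  shows "C2w V (\<lambda>x. q (y + T x)) (\<lambda>x. D (y + T x) o\<^sub>L T) (\<lambda>x. (precomp T o\<^sub>L D2 (y + T x)) o\<^sub>L T)"
  unfolding C2w_def
proof (intro conjI ballI)
  fix x assume x: "x \<in> V"
  have a: "((\<lambda>x. y + T x) has_derivative blinfun_apply T) (at x)"
    by (auto intro!: derivative_eq_intros bounded_linear_imp_has_derivative blinfun.bounded_linear_right)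
  have "(q has_derivative blinfun_apply (D (y + T x))) (at (y + T x))"
    using assms x by (auto simp: C2w_def)
  from diff_chain_at[OF a this]
  show "((\<lambda>x. q (y + T x)) has_derivative blinfun_apply (D (y + T x) o\<^sub>L T)) (at x)"
    by (simp add: o_def blinfun_compose.rep_eq)
  have "(D has_derivative blinfun_apply (D2 (y + T x))) (at (y + T x))"
    using assms x by (auto simp: C2w_def)
  from diff_chain_at[OF a this]
  have "((\<lambda>x. D (y + T x)) has_derivative (\<lambda>h. D2 (y + T x) (T h))) (at x)" by (simp add: o_def)
  from bounded_linear.has_derivative[OF blinfun.bounded_linear_right[of "precomp T"] this]
  moreover have "(\<lambda>h. precomp T (D2 (y + T x) (T h))) = blinfun_apply (precomp T o\<^sub>L D2 (y + T x) o\<^sub>L T)"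
    by (simp add: fun_eq_iff)
  ultimately show "((\<lambda>x. D (y + T x) o\<^sub>L T) has_derivative blinfun_apply (precomp T o\<^sub>L D2 (y + T x) o\<^sub>L T)) (at x)"
    by (simp only: precomp_apply)
next
  have "continuous_on V (\<lambda>x. D2 (y + T x))"
    by (rule continuous_on_compose2[of U D2]) (use assms in \<open>auto simp: C2w_def intro!: continuous_intros\<close>)
  then show "continuous_on V (\<lambda>x. precomp T o\<^sub>L D2 (y + T x) o\<^sub>L T)"
    by (intro continuous_intros)
qed

lemma C2w_affine_apply:
  "blinfun_apply (blinfun_apply ((precomp T o\<^sub>L G) o\<^sub>L T) h) k = blinfun_apply (blinfun_apply G (T h)) (T k)"
  by (simp add: precomp_apply)

text \<open>
  The Gaussian kernel, the exponential barrier, the mollifier and all paraboloids used below are radial.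
\<close>

lemma C2w_radial:
  fixes h h' h'' :: "real \<Rightarrow> real"
  assumes h: "\<And>s. (h has_real_derivative h' s) (at s)" "\<And>s. (h' has_real_derivative h'' s) (at s)"
    and c: "continuous_on UNIV h''"
  shows "C2w UNIV (\<lambda>x::'a::euclidean_space. h (x \<bullet> x)) (\<lambda>x. (2 * h' (x \<bullet> x)) *\<^sub>R blinfun_inner_right x)
     (\<lambda>x. (4 * h'' (x \<bullet> x)) *\<^sub>R (blinfun_scaleR_left (blinfun_inner_right x) o\<^sub>L blinfun_inner_right x)
        + (2 * h' (x \<bullet> x)) *\<^sub>R Blinfun blinfun_inner_right)"
proof -
  have bl: "bounded_linear (blinfun_inner_right :: 'a \<Rightarrow> _)"
    by (rule bounded_linear_blinfun_inner_right)
  have n: "((\<lambda>x::'a. x \<bullet> x) has_derivative (\<lambda>d. 2 * (x \<bullet> d))) (at x)" for x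
    by (auto intro!: derivative_eq_intros simp: inner_commute)
  have 1: "((\<lambda>x::'a. h (x \<bullet> x)) has_derivative (\<lambda>d. h' (x \<bullet> x) * (2 * (x \<bullet> d)))) (at x)" for x
    using has_derivative_compose[OF n h(1)[unfolded has_field_derivative_def]] by simp
  have 2: "((\<lambda>x::'a. h' (x \<bullet> x)) has_derivative (\<lambda>d. h'' (x \<bullet> x) * (2 * (x \<bullet> d)))) (at x)" for x
    using has_derivative_compose[OF n h(2)[unfolded has_field_derivative_def]] by simp
  have ch': "continuous_on UNIV h'" using h(2)
    by (meson DERIV_isCont continuous_at_imp_continuous_on)
  have ci: "continuous_on UNIV (blinfun_inner_right :: 'a \<Rightarrow> _)"
    using linear_continuous_on[OF bl] .
  have 3: "((\<lambda>x::'a. (2 * h' (x \<bullet> x)) *\<^sub>R blinfun_inner_right x) has_derivative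
     (\<lambda>d. (2 * h' (x \<bullet> x)) *\<^sub>R blinfun_inner_right d + (2 * (h'' (x \<bullet> x) * (2 * (x \<bullet> d)))) *\<^sub>R blinfun_inner_right x)) (at x)" for x
    by (rule has_derivative_scaleR[OF has_derivative_mult_right[OF 2] bounded_linear_imp_has_derivative[OF bl]])
  show ?thesis
    unfolding C2w_def
  proof (intro conjI ballI)
    fix x :: 'a
    show "((\<lambda>x. h (x \<bullet> x)) has_derivative blinfun_apply ((2 * h' (x \<bullet> x)) *\<^sub>R blinfun_inner_right x)) (at x)"
      using 1[of x] by (simp add: scaleR_blinfun.rep_eq mult.assoc mult.left_commute)
    show "((\<lambda>x. (2 * h' (x \<bullet> x)) *\<^sub>R blinfun_inner_right x) has_derivative blinfun_apply
        ((4 * h'' (x \<bullet> x)) *\<^sub>R (blinfun_scaleR_left (blinfun_inner_right x) o\<^sub>L blinfun_inner_right x)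
        + (2 * h' (x \<bullet> x)) *\<^sub>R Blinfun blinfun_inner_right)) (at x)"
      using 3[of x] by (simp add: scaleR_blinfun.rep_eq plus_blinfun.rep_eq bounded_linear_Blinfun_apply[OF bl] add.commute mult.assoc)
  next
    show "continuous_on UNIV (\<lambda>x::'a. (4 * h'' (x \<bullet> x)) *\<^sub>R (blinfun_scaleR_left (blinfun_inner_right x) o\<^sub>L blinfun_inner_right x)
        + (2 * h' (x \<bullet> x)) *\<^sub>R Blinfun blinfun_inner_right)"
      by (intro continuous_intros continuous_on_compose2[OF c] continuous_on_compose2[OF ch'] ci
         bounded_linear.continuous_on[OF bounded_linear_blinfun_scaleR_left]) auto
  qed
qed

lemma C2w_radial_apply:
  "blinfun_apply (blinfun_apply ((4 * c) *\<^sub>R (blinfun_scaleR_left (blinfun_inner_right x) o\<^sub>L blinfun_inner_right x)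
        + (2 * d) *\<^sub>R Blinfun blinfun_inner_right) h) k = 4 * c * (x \<bullet> h) * (x \<bullet> k) + 2 * d * ((h::'a::euclidean_space) \<bullet> k)"
  by (simp add: scaleR_blinfun.rep_eq plus_blinfun.rep_eq bounded_linear_Blinfun_apply[OF bounded_linear_blinfun_inner_right])

lemma C2w_along_line:
  assumes C: "C2w U q D D2" and x: "x + t *\<^sub>R h \<in> U"
  shows "((\<lambda>t. q (x + t *\<^sub>R h)) has_real_derivative D (x + t *\<^sub>R h) h) (at t)"
    and "((\<lambda>t. D (x + t *\<^sub>R h) k) has_real_derivative D2 (x + t *\<^sub>R h) h k) (at t)"
proof -
  have a: "((\<lambda>t. x + t *\<^sub>R h) has_derivative (\<lambda>s. s *\<^sub>R h)) (at t)"
    by (auto intro!: derivative_eq_intros)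
  have "(q has_derivative blinfun_apply (D (x + t *\<^sub>R h))) (at (x + t *\<^sub>R h))"
    using C x by (auto simp: C2w_def)
  from diff_chain_at[OF a this]
  show "((\<lambda>t. q (x + t *\<^sub>R h)) has_real_derivative D (x + t *\<^sub>R h) h) (at t)"
    by (simp add: has_field_derivative_def o_def blinfun.scaleR_right mult_commute_abs)
  have "(D has_derivative blinfun_apply (D2 (x + t *\<^sub>R h))) (at (x + t *\<^sub>R h))"
    using C x by (auto simp: C2w_def)
  from diff_chain_at[OF a this]
  have "((\<lambda>t. D (x + t *\<^sub>R h)) has_derivative (\<lambda>s. D2 (x + t *\<^sub>R h) (s *\<^sub>R h))) (at t)" by (simp add: o_def)
  from bounded_linear.has_derivative[OF blinfun.bounded_linear_left[of k] this]
  show "((\<lambda>t. D (x + t *\<^sub>R h) k) has_real_derivative D2 (x + t *\<^sub>R h) h k) (at t)"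
    by (simp add: has_field_derivative_def blinfun.scaleR_right blinfun.scaleR_left mult_commute_abs)
qed

lemma C2w_local_min:
  assumes C: "C2w U q D D2" and U: "open U" "x \<in> U" and mn: "\<forall>\<^sub>F y in nhds x. q x \<le> q y"
  shows "D2 x h h \<ge> 0"
proof (rule ccontr)
  assume "\<not> ?thesis"
  then have neg: "D2 x h h < 0" by simp
  define g where "g = (\<lambda>t. q (x + t *\<^sub>R h))"
  define g' where "g' = (\<lambda>t. D (x + t *\<^sub>R h) h)"
  have lim: "((\<lambda>t. x + t *\<^sub>R h) \<longlongrightarrow> x) (nhds 0)"
  proof -
    have "isCont (\<lambda>t. x + t *\<^sub>R h) 0" by (intro continuous_intros)
    then have "((\<lambda>t. x + t *\<^sub>R h) \<longlongrightarrow> x + 0 *\<^sub>R h) (nhds 0)"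
      unfolding isCont_def by (rule tendsto_at_iff_tendsto_nhds[THEN iffD1])
    then show ?thesis by simp
  qed
  have "\<forall>\<^sub>F y in nhds x. q x \<le> q y \<and> y \<in> U" using mn U by (simp add: eventually_conj eventually_nhds_in_open)
  from eventually_compose_filterlim[OF this lim]
  have "\<forall>\<^sub>F t in nhds 0. q x \<le> g t \<and> x + t *\<^sub>R h \<in> U" by (simp add: g_def)
  then obtain d where d: "d > 0" "\<And>t. \<bar>t\<bar> < d \<Longrightarrow> g 0 \<le> g t" "\<And>t. \<bar>t\<bar> < d \<Longrightarrow> x + t *\<^sub>R h \<in> U"
    unfolding eventually_nhds_metric by (auto simp: dist_real_def g_def)
  have g: "(g has_real_derivative g' t) (at t)" if "\<bar>t\<bar> < d" for t
    unfolding g_def g'_def using C2w_along_line(1)[OF C d(3)[OF that]] .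
  have g0: "g' 0 = 0"
    by (rule DERIV_local_min[OF g[of 0] d(1)]) (use d in auto)
  have "(g' has_real_derivative D2 x h h) (at 0)"
    using C2w_along_line(2)[OF C, of x 0 h h] d(3)[of 0] d(1) by (simp add: g'_def)
  from DERIV_neg_dec_right[OF this neg]
  obtain e where e: "e > 0" "\<And>t. t > 0 \<Longrightarrow> t < e \<Longrightarrow> g' t < 0" using g0 by auto
  define t where "t = min d e / 2"
  have t: "0 < t" "t < d" "t < e" using d e by (auto simp: t_def)
  obtain s where s: "0 < s" "s < t" "g t - g 0 = (t - 0) * g' s"
    using MVT2[of 0 t g g'] g t by auto
  have "g t - g 0 < 0" using s e(2)[of s] t by (simp add: mult_pos_neg)
  then show False using d(2)[of t] t by simp
qed

lemma C2w_mono_touch: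
  assumes C: "C2w U q D D2" "C2w U p E E2" and U: "open U" "x \<in> U"
    and eq: "q x = p x" and le: "\<forall>\<^sub>F y in nhds x. q y \<le> p y"
  shows "D2 x h h \<le> E2 x h h"
proof -
  have "C2w U (\<lambda>z. p z + (-1) * q z) (\<lambda>z. E z + (-1) *\<^sub>R D z) (\<lambda>z. E2 z + (-1) *\<^sub>R D2 z)"
    by (intro C2w_add C2w_scale C)
  from C2w_local_min[OF this U, of h] eq le
  show ?thesis by (simp add: plus_blinfun.rep_eq uminus_blinfun.rep_eq minus_blinfun.rep_eq)
qed

text \<open>
  The left-hand side is symmetric in \<open>a\<close> and \<open>b\<close>, while the mean value theorem, applied first along \<open>a\<close>
  and then along \<open>b\<close>, evaluates it by a second derivative in a fixed order. This gives the symmetry of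
  second derivatives in the next lemma.
\<close>

lemma C2w_mixed_difference:
  assumes C: "C2w U q D D2" and s: "s > 0"
    and U: "\<And>\<sigma> \<tau>. 0 \<le> \<sigma> \<Longrightarrow> \<sigma> \<le> s \<Longrightarrow> 0 \<le> \<tau> \<Longrightarrow> \<tau> \<le> s \<Longrightarrow> x + \<sigma> *\<^sub>R a + \<tau> *\<^sub>R b \<in> U"
  obtains \<sigma> \<tau> where "0 \<le> \<sigma>" "\<sigma> \<le> s" "0 \<le> \<tau>" "\<tau> \<le> s"
    "q (x + s *\<^sub>R a + s *\<^sub>R b) - q (x + s *\<^sub>R a) - q (x + s *\<^sub>R b) + q x = s * s * D2 (x + \<sigma> *\<^sub>R a + \<tau> *\<^sub>R b) b a"
proof -
  define \<phi> where "\<phi> = (\<lambda>\<sigma>. q (x + s *\<^sub>R b + \<sigma> *\<^sub>R a) - q (x + \<sigma> *\<^sub>R a))"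
  have "(\<phi> has_real_derivative D (x + s *\<^sub>R b + \<sigma> *\<^sub>R a) a - D (x + \<sigma> *\<^sub>R a) a) (at \<sigma>)"
    if "0 \<le> \<sigma>" "\<sigma> \<le> s" for \<sigma>
    unfolding \<phi>_def
    by (intro DERIV_diff C2w_along_line(1)[OF C])
       (use that U[of \<sigma> s] U[of \<sigma> 0] s in \<open>auto simp: add.assoc add.commute[of "s *\<^sub>R b"]\<close>)
  then obtain \<sigma> where \<sigma>: "0 < \<sigma>" "\<sigma> < s"
    "\<phi> s - \<phi> 0 = s * (D (x + s *\<^sub>R b + \<sigma> *\<^sub>R a) a - D (x + \<sigma> *\<^sub>R a) a)"
    using MVT2[of 0 s \<phi> "\<lambda>\<sigma>. D (x + s *\<^sub>R b + \<sigma> *\<^sub>R a) a - D (x + \<sigma> *\<^sub>R a) a"] s by auto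
  define g where "g = (\<lambda>\<tau>. D (x + \<sigma> *\<^sub>R a + \<tau> *\<^sub>R b) a)"
  have "(g has_real_derivative D2 (x + \<sigma> *\<^sub>R a + \<tau> *\<^sub>R b) b a) (at \<tau>)" if "0 \<le> \<tau>" "\<tau> \<le> s" for \<tau>
    unfolding g_def by (intro C2w_along_line(2)[OF C] U) (use that \<sigma> in auto)
  then obtain \<tau> where \<tau>: "0 < \<tau>" "\<tau> < s" "g s - g 0 = s * D2 (x + \<sigma> *\<^sub>R a + \<tau> *\<^sub>R b) b a"
    using MVT2[of 0 s g "\<lambda>\<tau>. D2 (x + \<sigma> *\<^sub>R a + \<tau> *\<^sub>R b) b a"] s by auto
  have e: "x + s *\<^sub>R b + \<sigma> *\<^sub>R a = x + \<sigma> *\<^sub>R a + s *\<^sub>R b" "x + s *\<^sub>R b + s *\<^sub>R a = x + s *\<^sub>R a + s *\<^sub>R b" by simp_all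
  have "q (x + s *\<^sub>R a + s *\<^sub>R b) - q (x + s *\<^sub>R a) - (q (x + s *\<^sub>R b) - q x) =
     s * (D (x + \<sigma> *\<^sub>R a + s *\<^sub>R b) a - D (x + \<sigma> *\<^sub>R a) a)"
    using \<sigma>(3) unfolding \<phi>_def e by simp
  also have "D (x + \<sigma> *\<^sub>R a + s *\<^sub>R b) a - D (x + \<sigma> *\<^sub>R a) a = s * D2 (x + \<sigma> *\<^sub>R a + \<tau> *\<^sub>R b) b a"
    using \<tau>(3) unfolding g_def by simp
  finally have "q (x + s *\<^sub>R a + s *\<^sub>R b) - q (x + s *\<^sub>R a) - q (x + s *\<^sub>R b) + q x = s * s * D2 (x + \<sigma> *\<^sub>R a + \<tau> *\<^sub>R b) b a"
    by simp
  then show ?thesis using that[of \<sigma> \<tau>] \<sigma> \<tau> by simp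
qed

lemma C2w_symmetric:
  assumes C: "C2w U q D D2" and U: "open U" "x \<in> U"
  shows "D2 x a b = D2 x b a"
proof (rule ccontr)
  assume ne: "D2 x a b \<noteq> D2 x b a"
  define e where "e = \<bar>D2 x a b - D2 x b a\<bar> / 2"
  have e: "e > 0" using ne by (simp add: e_def)
  have cont: "isCont D2 x" using C U by (simp add: C2w_def continuous_on_eq_continuous_at)
  have c: "isCont (\<lambda>y. D2 y h k) x" for h k
    by (intro continuous_intros cont)
  have ev: "\<forall>\<^sub>F y in nhds x. dist (D2 y h k) (D2 x h k) < e" for h k
    by (rule tendstoD[OF tendsto_at_iff_tendsto_nhds[THEN iffD1, OF c[of h k, unfolded isCont_def]] e])
  have "\<forall>\<^sub>F y in nhds x. y \<in> U \<and> dist (D2 y a b) (D2 x a b) < e \<and> dist (D2 y b a) (D2 x b a) < e"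
    using U by (intro eventually_conj eventually_nhds_in_open ev) auto
  then obtain d where d: "d > 0" "\<And>y. dist y x < d \<Longrightarrow> y \<in> U \<and> dist (D2 y a b) (D2 x a b) < e \<and> dist (D2 y b a) (D2 x b a) < e"
    unfolding eventually_nhds_metric by blast
  define N where "N = norm a + norm b + 1"
  have n0: "N > 0" by (simp add: N_def add_nonneg_pos)
  define s where "s = d / (2 * N)"
  have s: "s > 0" using d n0 by (simp add: s_def)
  have near: "dist (x + \<sigma> *\<^sub>R a + \<tau> *\<^sub>R b) x < d" if "0 \<le> \<sigma>" "\<sigma> \<le> s" "0 \<le> \<tau>" "\<tau> \<le> s" for \<sigma> \<tau>
  proof -
    have "dist (x + \<sigma> *\<^sub>R a + \<tau> *\<^sub>R b) x \<le> \<sigma> * norm a + \<tau> * norm b"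
      using that norm_triangle_ineq[of "\<sigma> *\<^sub>R a" "\<tau> *\<^sub>R b"] by (simp add: dist_norm)
    also have "\<dots> \<le> s * norm a + s * norm b" using that by (intro add_mono mult_right_mono) auto
    also have "\<dots> \<le> s * N" using s by (simp add: N_def algebra_simps)
    also have "\<dots> < s * N * 2" using s n0 by simp
    also have "\<dots> = d" using n0 by (simp add: s_def)
    finally show ?thesis .
  qed
  obtain \<sigma> \<tau> where 1: "0 \<le> \<sigma>" "\<sigma> \<le> s" "0 \<le> \<tau>" "\<tau> \<le> s"
    "q (x + s *\<^sub>R a + s *\<^sub>R b) - q (x + s *\<^sub>R a) - q (x + s *\<^sub>R b) + q x = s * s * D2 (x + \<sigma> *\<^sub>R a + \<tau> *\<^sub>R b) b a"
    using C2w_mixed_difference[OF C s, of x a b] d(2) near by metis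
  have near2: "dist (x + \<sigma> *\<^sub>R b + \<tau> *\<^sub>R a) x < d" if "0 \<le> \<sigma>" "\<sigma> \<le> s" "0 \<le> \<tau>" "\<tau> \<le> s" for \<sigma> \<tau>
    using near[of \<tau> \<sigma>] that by (simp add: algebra_simps)
  obtain \<sigma>' \<tau>' where 2: "0 \<le> \<sigma>'" "\<sigma>' \<le> s" "0 \<le> \<tau>'" "\<tau>' \<le> s"
    "q (x + s *\<^sub>R b + s *\<^sub>R a) - q (x + s *\<^sub>R b) - q (x + s *\<^sub>R a) + q x = s * s * D2 (x + \<sigma>' *\<^sub>R b + \<tau>' *\<^sub>R a) a b"
    using C2w_mixed_difference[OF C s, of x b a] d(2) near2 by metis
  have e2: "x + s *\<^sub>R b + s *\<^sub>R a = x + s *\<^sub>R a + s *\<^sub>R b" by simp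
  have "s * s * D2 (x + \<sigma> *\<^sub>R a + \<tau> *\<^sub>R b) b a = s * s * D2 (x + \<sigma>' *\<^sub>R b + \<tau>' *\<^sub>R a) a b"
    using 1(5) 2(5)[unfolded e2] by linarith
  then have "D2 (x + \<sigma> *\<^sub>R a + \<tau> *\<^sub>R b) b a = D2 (x + \<sigma>' *\<^sub>R b + \<tau>' *\<^sub>R a) a b" using s by simp
  moreover have "dist (D2 (x + \<sigma> *\<^sub>R a + \<tau> *\<^sub>R b) b a) (D2 x b a) < e" using d(2) near 1 by blast
  moreover have "dist (D2 (x + \<sigma>' *\<^sub>R b + \<tau>' *\<^sub>R a) a b) (D2 x a b) < e" using d(2) near2 2 by blast
  ultimately show False unfolding e_def dist_real_def by argo
qed

definition cnjv :: "complex ^ 'n \<Rightarrow> complex ^ 'n" where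
  "cnjv x = (\<chi> k. cnj (x $ k))"

lemma complex_hessian_eq:
  fixes q :: "complex ^ 'n \<Rightarrow> real"
  assumes C: "C2w U q D D2" and U: "open U" "z \<in> U"
  shows "complex_hessian q z $ \<alpha> $ \<beta> =
    Complex ((D2 z (axis \<alpha> 1) (axis \<beta> 1) + D2 z (axis \<alpha> \<i>) (axis \<beta> \<i>)) / 4)
            ((D2 z (axis \<alpha> 1) (axis \<beta> \<i>) - D2 z (axis \<alpha> \<i>) (axis \<beta> 1)) / 4)"
proof -
  have pd: "partial_deriv e (\<lambda>w. complex_of_real (q w)) w = complex_of_real (D w e)" if "w \<in> U" for w e
    unfolding partial_deriv_def
    by (rule vector_derivative_at)
       (use C2w_along_line(1)[OF C, of w 0 e] that in \<open>auto intro!: has_vector_derivative_of_real simp: has_real_derivative_iff_has_vector_derivative\<close>)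
  define G where "G = (\<lambda>w. (complex_of_real (D w (axis \<beta> 1)) + \<i> * complex_of_real (D w (axis \<beta> \<i>))) / 2)"
  have G: "deriv_zbar \<beta> (\<lambda>w. complex_of_real (q w)) w = G w" if "w \<in> U" for w
    using that by (simp add: deriv_zbar_def pd G_def)
  have pd2: "partial_deriv e (deriv_zbar \<beta> (\<lambda>w. complex_of_real (q w))) z =
      (complex_of_real (D2 z e (axis \<beta> 1)) + \<i> * complex_of_real (D2 z e (axis \<beta> \<i>))) / 2" for e
    unfolding partial_deriv_def
  proof (rule vector_derivative_at)
    have d: "((\<lambda>t. complex_of_real (D (z + t *\<^sub>R e) k)) has_vector_derivative complex_of_real (D2 z e k)) (at 0)" for k
      using C2w_along_line(2)[OF C, of z 0 e k] U
      by (auto intro!: has_vector_derivative_of_real simp: has_real_derivative_iff_has_vector_derivative)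
    have "((\<lambda>t. G (z + t *\<^sub>R e)) has_vector_derivative
       (complex_of_real (D2 z e (axis \<beta> 1)) + \<i> * complex_of_real (D2 z e (axis \<beta> \<i>))) / 2) (at 0)"
      unfolding G_def
      by (intro has_vector_derivative_divide has_vector_derivative_add has_vector_derivative_mult_right d)
    moreover have "open ((\<lambda>t. z + t *\<^sub>R e) -` U)" by (intro open_vimage U continuous_intros)
    ultimately show "((\<lambda>t. deriv_zbar \<beta> (\<lambda>w. complex_of_real (q w)) (z + t *\<^sub>R e)) has_vector_derivative
       (complex_of_real (D2 z e (axis \<beta> 1)) + \<i> * complex_of_real (D2 z e (axis \<beta> \<i>))) / 2) (at 0)"
      by (rule has_vector_derivative_transform_within_open) (use U G in auto)
  qed
  show ?thesis
    by (simp add: complex_hessian_def deriv_z_def pd2 complex_eq_iff field_simps)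
qed

lemma complex_hessian_hermitian:
  assumes C: "C2w U q D D2" and U: "open U" "z \<in> U"
  shows "complex_hessian q z \<in> hermitian_matrices"
  unfolding hermitian_matrices_def
  by (auto simp: complex_hessian_eq[OF assms] complex_eq_iff C2w_symmetric[OF assms] field_simps)

lemma complex_vec_expand:
  fixes y :: "complex ^ 'n"
  shows "y = (\<Sum>\<alpha>\<in>UNIV. Re (y $ \<alpha>) *\<^sub>R axis \<alpha> 1 + Im (y $ \<alpha>) *\<^sub>R axis \<alpha> \<i>)"
  by (simp add: vec_eq_iff axis_def complex_eq_iff if_distrib if_distribR sum.delta sum.distrib cong: if_cong)

text \<open>
  The Levi form of \<open>q\<close> in terms of the real second derivative. The vector is conjugated because the rows of
  the Hessian belong to \<open>z\<close> and the columns to the conjugate variables.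
\<close>

lemma complex_hessian_form:
  fixes q :: "complex ^ 'n \<Rightarrow> real"
  assumes C: "C2w U q D D2" and U: "open U" "z \<in> U"
  shows "Re (\<Sum>\<alpha>\<in>UNIV. cnj (x $ \<alpha>) * (\<Sum>\<beta>\<in>UNIV. complex_hessian q z $ \<alpha> $ \<beta> * x $ \<beta>)) =
     (D2 z (cnjv x) (cnjv x) + D2 z (\<i> *s cnjv x) (\<i> *s cnjv x)) / 4"
proof -
  define a where "a = (\<lambda>\<alpha>::'n. axis \<alpha> (1::complex))"
  define b where "b = (\<lambda>\<alpha>::'n. axis \<alpha> \<i>)"
  define p where "p = (\<lambda>\<alpha>. Re (cnjv x $ \<alpha>))"
  define s where "s = (\<lambda>\<alpha>. Im (cnjv x $ \<alpha>))"
  have y: "cnjv x = (\<Sum>\<alpha>\<in>UNIV. p \<alpha> *\<^sub>R a \<alpha> + s \<alpha> *\<^sub>R b \<alpha>)"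
    using complex_vec_expand[of "cnjv x"] by (simp add: p_def s_def a_def b_def)
  have iy: "\<i> *s cnjv x = (\<Sum>\<alpha>\<in>UNIV. (- s \<alpha>) *\<^sub>R a \<alpha> + p \<alpha> *\<^sub>R b \<alpha>)"
    using complex_vec_expand[of "\<i> *s cnjv x"] by (simp add: p_def s_def a_def b_def)
  have xk: "x $ \<alpha> = Complex (p \<alpha>) (- s \<alpha>)" for \<alpha>
    by (simp add: p_def s_def cnjv_def complex_eq_iff)
  have ab: "axis \<alpha> 1 = a \<alpha>" "axis \<alpha> \<i> = b \<alpha>" for \<alpha> by (simp_all add: a_def b_def)
  define Y where "Y = cnjv x"
  define Z where "Z = \<i> *s Y"
  have DD: "D2 z (\<Sum>\<alpha>\<in>UNIV. v \<alpha>) (\<Sum>\<beta>\<in>UNIV. w \<beta>) = (\<Sum>\<alpha>\<in>UNIV. \<Sum>\<beta>\<in>UNIV. D2 z (v \<alpha>) (w \<beta>))" for v w :: "'n \<Rightarrow> _"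
    by (simp only: blinfun.sum_left blinfun.sum_right) (rule sum.swap)
  have 1: "D2 z Y Y = (\<Sum>\<alpha>\<in>UNIV. \<Sum>\<beta>\<in>UNIV. D2 z (p \<alpha> *\<^sub>R a \<alpha> + s \<alpha> *\<^sub>R b \<alpha>) (p \<beta> *\<^sub>R a \<beta> + s \<beta> *\<^sub>R b \<beta>))"
    unfolding DD[symmetric] y[symmetric] Y_def ..
  have 2: "D2 z Z Z = (\<Sum>\<alpha>\<in>UNIV. \<Sum>\<beta>\<in>UNIV. D2 z ((- s \<alpha>) *\<^sub>R a \<alpha> + p \<alpha> *\<^sub>R b \<alpha>) ((- s \<beta>) *\<^sub>R a \<beta> + p \<beta> *\<^sub>R b \<beta>))"
    unfolding DD[symmetric] iy[symmetric] Y_def Z_def ..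
  have "Re (\<Sum>\<alpha>\<in>UNIV. cnj (x $ \<alpha>) * (\<Sum>\<beta>\<in>UNIV. complex_hessian q z $ \<alpha> $ \<beta> * x $ \<beta>)) = (D2 z Y Y + D2 z Z Z) / 4"
    unfolding 1 2 sum.distrib[symmetric] sum_divide_distrib Re_sum sum_distrib_left
    by (intro sum.cong refl)
       (simp add: complex_hessian_eq[OF assms] xk ab blinfun.add_left blinfun.add_right blinfun.scaleR_left
       blinfun.scaleR_right blinfun.minus_left blinfun.minus_right blinfun.diff_left blinfun.diff_right algebra_simps add_divide_distrib diff_divide_distrib)
  then show ?thesis unfolding Y_def Z_def .
qed

section \<open>Convolution and the heat kernel\<close>

text \<open>
  Integration over a box is enough, since \<open>v\<close> vanishes outside one in all applications; it makes
  differentiation under the integral available for operator-valued kernels.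
\<close>

definition convolve :: "'a::euclidean_space \<Rightarrow> 'a \<Rightarrow> ('a \<Rightarrow> 'b::real_normed_vector) \<Rightarrow> ('a \<Rightarrow> real) \<Rightarrow> 'a \<Rightarrow> 'b" where
  "convolve a b k v x = integral (cbox a b) (\<lambda>y. v y *\<^sub>R k (x - y))"

lemma convolve_has_derivative:
  fixes k :: "'a::euclidean_space \<Rightarrow> 'b::banach"
  assumes k: "\<And>x. (k has_derivative blinfun_apply (k' x)) (at x)" and k': "continuous_on UNIV k'"
    and v: "continuous_on UNIV v"
  shows "(convolve a b k v has_derivative blinfun_apply (convolve a b k' v x)) (at x)"
  unfolding convolve_def
proof (rule leibniz_rule[where U = UNIV])
  have ck: "continuous_on UNIV k" using k by (meson continuous_at_imp_continuous_on has_derivative_continuous)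
  fix x t :: 'a
  have "((\<lambda>x. x - t) has_derivative (\<lambda>h. h)) (at x)" by (auto intro!: derivative_eq_intros)
  from has_derivative_compose[OF this k[of "x - t"]] have "((\<lambda>x. k (x - t)) has_derivative blinfun_apply (k' (x - t))) (at x)" by (simp add: o_def)
  then show "((\<lambda>x. v t *\<^sub>R k (x - t)) has_derivative blinfun_apply (v t *\<^sub>R k' (x - t))) (at x)"
    by (auto simp: scaleR_blinfun.rep_eq intro: has_derivative_scaleR_right)
  show "(\<lambda>t. v t *\<^sub>R k (x - t)) integrable_on cbox a b"
    by (intro integrable_continuous continuous_intros continuous_on_compose2[OF ck] continuous_on_subset[OF v]) auto
next
  show "continuous_on (UNIV \<times> cbox a b) (\<lambda>(x, t). v t *\<^sub>R k' (x - t))"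
    unfolding split_beta
    by (intro continuous_intros continuous_on_compose2[OF k'] continuous_on_compose2[OF v]) auto
qed auto

lemma convolve_C2w:
  fixes k :: "'a::euclidean_space \<Rightarrow> real"
  assumes k: "C2w UNIV k Dk D2k" and v: "continuous_on UNIV v"
  shows "C2w UNIV (convolve a b k v) (convolve a b Dk v) (convolve a b D2k v)"
proof -
  have c2: "continuous_on UNIV D2k" using k by (simp add: C2w_def)
  have c1: "continuous_on UNIV Dk"
    using k unfolding C2w_def by (meson UNIV_I continuous_at_imp_continuous_on has_derivative_continuous)
  have "continuous_on (UNIV \<times> cbox a b) (\<lambda>(x, t). v t *\<^sub>R D2k (x - t))"
    unfolding split_beta
    by (intro continuous_intros continuous_on_compose2[OF c2] continuous_on_compose2[OF v]) auto
  from integral_continuous_on_param[OF this]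
  have "continuous_on UNIV (convolve a b D2k v)" unfolding convolve_def .
  then show ?thesis
    using convolve_has_derivative[OF _ c1 v] convolve_has_derivative[OF _ c2 v] k
    unfolding C2w_def by auto
qed

lemma convolve_apply2:
  fixes k :: "'a::euclidean_space \<Rightarrow> 'a \<Rightarrow>\<^sub>L 'a \<Rightarrow>\<^sub>L real"
  assumes k: "continuous_on UNIV k" and v: "continuous_on UNIV v"
  shows "blinfun_apply (blinfun_apply (convolve a b k v x) h) l =
    integral (cbox a b) (\<lambda>y. v y * blinfun_apply (blinfun_apply (k (x - y)) h) l)"
proof -
  have c: "continuous_on UNIV (\<lambda>y. v y *\<^sub>R k (x - y))"
    by (intro continuous_intros continuous_on_compose2[OF k] v) auto
  have 1: "(\<lambda>y. v y *\<^sub>R k (x - y)) integrable_on cbox a b"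
    by (intro integrable_continuous continuous_on_subset[OF c]) auto
  have 2: "(\<lambda>y. blinfun_apply (v y *\<^sub>R k (x - y)) h) integrable_on cbox a b"
    by (intro integrable_continuous continuous_intros continuous_on_subset[OF c]) auto
  show ?thesis unfolding convolve_def blinfun_apply_integral[OF 1] blinfun_apply_integral[OF 2]
    by (simp add: scaleR_blinfun.rep_eq)
qed

lemma integral_compact_support:
  fixes g :: "'a::euclidean_space \<Rightarrow> real"
  assumes g: "continuous_on UNIV g" and z: "\<And>x. x \<notin> cbox a b \<Longrightarrow> g x = 0"
  shows "integrable lborel g" and "integral (cbox a b) g = (LINT x|lborel. g x)"
proof -
  have e: "(\<lambda>x. indicator (cbox a b) x *\<^sub>R g x) = g"
    using z by (auto simp: fun_eq_iff indicator_def)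
  show i: "integrable lborel g"
    using borel_integrable_compact[of "cbox a b" g] continuous_on_subset[OF g] unfolding e by auto
  have "integral UNIV g = integral (cbox a b) g"
  proof -
    have "(\<lambda>x. if x \<in> cbox a b then g x else 0) = g" using z by auto
    then show ?thesis using integral_restrict_UNIV[of "cbox a b" g] by (simp only:)
  qed
  then show "integral (cbox a b) g = (LINT x|lborel. g x)" using integral_lborel[OF i] by simp
qed

text \<open>
  This identity serves for the scaling of the Gaussian, and with \<open>c = 1\<close> and \<open>c = - 1\<close> for translations
  and reflections of mollifiers.
\<close>

lemma lborel_integral_affine:
  fixes g :: "'a::euclidean_space \<Rightarrow> real"
  assumes c: "c \<noteq> 0" and g: "g \<in> borel_measurable borel"
  shows "(LINT x|lborel. g x) = \<bar>c\<bar> ^ DIM('a) * (LINT x|lborel. g (t + c *\<^sub>R x))"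
proof -
  have "(LINT x|lborel. g x) = (LINT x|density (distr lborel borel (\<lambda>x::'a. t + c *\<^sub>R x)) (\<lambda>_. ennreal (\<bar>c\<bar> ^ DIM('a))). g x)"
    using lborel_affine[OF c, of t] by (simp add: ennreal_power)
  also have "\<dots> = (LINT x|lborel. \<bar>c\<bar> ^ DIM('a) * g (t + c *\<^sub>R x))"
    using g by (subst integral_density) (auto simp: integral_distr)
  finally show ?thesis by simp
qed

definition gauss :: "'a::euclidean_space \<Rightarrow> real" where
  "gauss x = exp (- (x \<bullet> x) / 4) / sqrt (4 * pi) ^ DIM('a)"

text \<open>
  The variance is chosen such that the kernel solves \<open>\<partial>\<^sub>t k = \<Delta> k\<close>; \<open>gauss\<close> is its value at time 1.
\<close>

definition heat_kernel :: "real \<Rightarrow> 'a::euclidean_space \<Rightarrow> real" where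
  "heat_kernel t x = exp (- (x \<bullet> x) / (4 * t)) / sqrt (4 * pi * t) ^ DIM('a)"

lemma gauss_eq_prod: "gauss (x::'a::euclidean_space) = (\<Prod>b\<in>Basis. normal_density 0 (sqrt 2) (x \<bullet> b))"
proof -
  have "(\<Prod>b\<in>Basis. normal_density 0 (sqrt 2) (x \<bullet> b)) = (\<Prod>b\<in>Basis. exp (- (x \<bullet> b)\<^sup>2 / 4) / sqrt (4 * pi))"
    by (simp add: normal_density_def mult.commute)
  also have "\<dots> = (\<Prod>b\<in>Basis. exp (- (x \<bullet> b)\<^sup>2 / 4)) / sqrt (4 * pi) ^ DIM('a)"
    by (simp add: prod_dividef)
  also have "(\<Prod>b\<in>Basis. exp (- (x \<bullet> b)\<^sup>2 / 4)) = exp (- (x \<bullet> x) / 4)"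
    by (subst (2) euclidean_inner) (simp add: exp_sum[symmetric] sum_negf sum_divide_distrib power2_eq_square)
  finally show ?thesis by (simp add: gauss_def)
qed

lemma gauss_nonneg: "gauss x \<ge> 0" by (simp add: gauss_def)

lemma gauss_measurable [measurable]: "gauss \<in> borel_measurable borel"
  unfolding gauss_def[abs_def] by measurable

lemma gauss_integrable: "integrable lborel (gauss :: 'a::euclidean_space \<Rightarrow> real)"
  and gauss_integral: "(LINT x|lborel. gauss (x::'a)) = 1"
proof -
  have "(\<integral>\<^sup>+ x. ennreal (gauss (x::'a)) \<partial>lborel) = (\<integral>\<^sup>+ x. (\<Prod>b\<in>Basis. ennreal (normal_density 0 (sqrt 2) ((x::'a) \<bullet> b))) \<partial>lborel)"
    by (simp add: gauss_eq_prod prod_ennreal)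
  also have "\<dots> = (\<Prod>b\<in>(Basis::'a set). (\<integral>\<^sup>+ x. ennreal (normal_density 0 (sqrt 2) x) \<partial>lborel))"
    by (rule nn_integral_lborel_prod) auto
  also have "(\<integral>\<^sup>+ x. ennreal (normal_density 0 (sqrt 2) x) \<partial>lborel) = ennreal 1"
    by (subst nn_integral_eq_integral) auto
  finally have *: "(\<integral>\<^sup>+ x. ennreal (gauss (x::'a)) \<partial>lborel) = ennreal 1" by simp
  show i: "integrable lborel (gauss :: 'a \<Rightarrow> real)"
    by (rule integrableI_nonneg) (auto simp: gauss_nonneg *)
  show "(LINT x|lborel. gauss (x::'a)) = 1"
    using * by (subst integral_eq_nn_integral) (auto simp: gauss_nonneg)
qed

lemma radial_laplacian:
  fixes x :: "'a::euclidean_space"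
  shows "(\<Sum>e\<in>Basis. 4 * c * (x \<bullet> e) * (x \<bullet> e) + 2 * d * (e \<bullet> e)) = 4 * c * (x \<bullet> x) + 2 * d * real DIM('a)"
  unfolding sum.distrib by (simp add: euclidean_inner[of x x] sum_distrib_left mult.assoc)

lemma heat_kernel_C2w:
  assumes t: "t > 0"
  obtains D :: "'a::euclidean_space \<Rightarrow> 'a \<Rightarrow>\<^sub>L real" and D2 :: "'a::euclidean_space \<Rightarrow> 'a \<Rightarrow>\<^sub>L 'a \<Rightarrow>\<^sub>L real"
  where "C2w UNIV (heat_kernel t :: 'a::euclidean_space \<Rightarrow> real) D D2"
    "\<And>x::'a. (\<Sum>e\<in>Basis. D2 x e e) = heat_kernel t x * (x \<bullet> x / (4 * t^2) - real DIM('a) / (2 * t))"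
proof -
  define h where "h = (\<lambda>s. exp (- s / (4 * t)) / sqrt (4 * pi * t) ^ DIM('a))"
  have h1: "(h has_real_derivative (- 1 / (4 * t)) * h s) (at s)" for s
    unfolding h_def using t by (auto intro!: derivative_eq_intros)
  have h2: "((\<lambda>s. (- 1 / (4 * t)) * h s) has_real_derivative (- 1 / (4 * t)) * ((- 1 / (4 * t)) * h s)) (at s)" for s
    by (intro DERIV_cmult h1)
  have c: "continuous_on UNIV (\<lambda>s. (- 1 / (4 * t)) * ((- 1 / (4 * t)) * h s))"
    using h1 by (intro continuous_intros) (meson DERIV_isCont continuous_at_imp_continuous_on)
  have hk: "heat_kernel t x = h (x \<bullet> x)" for x :: 'a by (simp add: heat_kernel_def h_def)
  have k: "(\<lambda>x::'a. h (x \<bullet> x)) = heat_kernel t" by (simp add: hk fun_eq_iff)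
  note C = C2w_radial[OF h1 h2 c, where 'a = 'a, unfolded k]
  show ?thesis
  proof (rule that[OF C])
    fix x :: 'a
    show "(\<Sum>e\<in>Basis. blinfun_apply (blinfun_apply ((4 * (- 1 / (4 * t) * (- 1 / (4 * t) * h (x \<bullet> x)))) *\<^sub>R
        (blinfun_scaleR_left (blinfun_inner_right x) o\<^sub>L blinfun_inner_right x) +
        (2 * (- 1 / (4 * t) * h (x \<bullet> x))) *\<^sub>R Blinfun blinfun_inner_right) e) e) =
        heat_kernel t x * (x \<bullet> x / (4 * t\<^sup>2) - real DIM('a) / (2 * t))"
      unfolding C2w_radial_apply radial_laplacian using t by (simp add: hk power2_eq_square field_simps)
  qed
qed

lemma heat_kernel_time_derivative:
  fixes x :: "'a::euclidean_space"
  assumes t: "t > 0"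
  shows "((\<lambda>t. heat_kernel t x) has_real_derivative
     heat_kernel t x * (x \<bullet> x / (4 * t^2) - real DIM('a) / (2 * t))) (at t)"
proof -
  define N where "N = DIM('a)"
  have N: "N > 0" by (simp add: N_def)
  define r where "r = sqrt (4 * pi * t)"
  have r: "r > 0" "r * r = 4 * pi * t" using t by (auto simp: r_def)
  have d: "((\<lambda>t. sqrt (4 * pi * t)) has_real_derivative r / (2 * t)) (at t)"
  proof -
    have "((\<lambda>t. sqrt (4 * pi * t)) has_real_derivative (inverse (sqrt (4 * pi * t)) / 2) * (4 * pi)) (at t)"
      by (rule DERIV_chain2[OF DERIV_real_sqrt]) (use t in \<open>auto intro!: derivative_eq_intros\<close>)
    moreover have "(inverse r / 2) * (4 * pi) = r / (2 * t)" using r t by (simp add: field_simps)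
    ultimately show ?thesis by (simp add: r_def)
  qed
  have rr: "sqrt (pi * (t * 4)) = r" by (simp add: r_def ac_simps)
  have d1: "((\<lambda>t. sqrt (4 * pi * t) ^ N) has_real_derivative real N * r ^ N / (2 * t)) (at t)"
    by (rule DERIV_cong[OF DERIV_power[OF d]], unfold r_def[symmetric]) (cases N; simp)
  have d2: "((\<lambda>t. exp (- (x \<bullet> x) / (4 * t))) has_real_derivative exp (- (x \<bullet> x) / (4 * t)) * (x \<bullet> x / (4 * t^2))) (at t)"
    using t by (auto intro!: derivative_eq_intros simp: field_simps power2_eq_square)
  have rn: "r ^ N \<noteq> 0" using r by simp
  show ?thesis
    unfolding heat_kernel_def N_def[symmetric]
    by (rule DERIV_cong[OF DERIV_divide[OF d2 d1]])
       (use rn r(1) t in \<open>simp_all add: r_def[symmetric] field_simps rr\<close>)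
qed

definition heat_flow :: "'a::euclidean_space \<Rightarrow> 'a \<Rightarrow> ('a \<Rightarrow> real) \<Rightarrow> real \<Rightarrow> 'a \<Rightarrow> real" where
  "heat_flow a b v t = convolve a b (heat_kernel t) v"

lemma heat_flow_C2w:
  fixes v :: "'a::euclidean_space \<Rightarrow> real"
  assumes v: "continuous_on UNIV v" and t: "t > 0"
  obtains D D2 where "C2w UNIV (heat_flow a b v t) D D2"
    "\<And>x. ((\<lambda>t. heat_flow a b v t x) has_real_derivative (\<Sum>e\<in>Basis. D2 x e e)) (at t)"
proof -
  obtain D D2 where C: "C2w UNIV (heat_kernel t :: 'a \<Rightarrow> real) D D2"
    and L: "\<And>x::'a. (\<Sum>e\<in>Basis. D2 x e e) = heat_kernel t x * (x \<bullet> x / (4 * t^2) - real DIM('a) / (2 * t))"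
    by (rule heat_kernel_C2w[OF t, where 'a = 'a]) (use that in blast)
  have cD2: "continuous_on UNIV D2" using C by (simp add: C2w_def)
  show ?thesis
  proof (rule that[OF convolve_C2w[OF C v, of a b, folded heat_flow_def]])
    fix x
    have i: "(\<lambda>y. v y * D2 (x - y) e e) integrable_on cbox a b" for e
      by (intro integrable_continuous continuous_intros continuous_on_compose2[OF cD2] continuous_on_subset[OF v]) auto
    have "(\<Sum>e\<in>Basis. convolve a b D2 v x e e) = integral (cbox a b) (\<lambda>y. \<Sum>e\<in>Basis. v y * D2 (x - y) e e)"
      by (simp add: convolve_apply2[OF cD2 v] integral_sum[OF finite_Basis i])
    also have "\<dots> = integral (cbox a b) (\<lambda>y. v y *\<^sub>R (heat_kernel t (x - y) * ((x - y) \<bullet> (x - y) / (4 * t^2) - real DIM('a) / (2 * t))))"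
      by (simp add: sum_distrib_left[symmetric] L)
    finally have e: "(\<Sum>e\<in>Basis. convolve a b D2 v x e e) = \<dots>" .
    have "((\<lambda>t. integral (cbox a b) (\<lambda>y. v y *\<^sub>R heat_kernel t (x - y))) has_real_derivative
       integral (cbox a b) (\<lambda>y. v y *\<^sub>R (heat_kernel t (x - y) * ((x - y) \<bullet> (x - y) / (4 * t^2) - real DIM('a) / (2 * t))))) (at t within {0<..})"
    proof (rule leibniz_rule_field_derivative[where U = "{0<..}"])
      fix t :: real and y assume t: "t \<in> {0<..}"
      show "((\<lambda>t. v y *\<^sub>R heat_kernel t (x - y)) has_field_derivative
        v y *\<^sub>R (heat_kernel t (x - y) * ((x - y) \<bullet> (x - y) / (4 * t\<^sup>2) - real DIM('a) / (2 * t)))) (at t within {0<..})"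
        using heat_kernel_time_derivative[of t "x - y"] t
        by (auto intro!: DERIV_cmult intro: has_field_derivative_at_within)
    next
      fix t :: real assume t: "t \<in> {0<..}"
      have "continuous_on UNIV (\<lambda>y. heat_kernel t (x - y))"
        unfolding heat_kernel_def using t by (intro continuous_intros) auto
      then show "(\<lambda>y. v y *\<^sub>R heat_kernel t (x - y)) integrable_on cbox a b"
        by (intro integrable_continuous continuous_intros continuous_on_subset[OF v]) (auto intro: continuous_on_subset)
    next
      show "continuous_on ({0<..} \<times> cbox a b) (\<lambda>(t, y). v y *\<^sub>R (heat_kernel t (x - y) * ((x - y) \<bullet> (x - y) / (4 * t\<^sup>2) - real DIM('a) / (2 * t))))"
        unfolding split_beta heat_kernel_def
        by (intro continuous_intros continuous_on_compose2[OF v]) auto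
    qed (use t in auto)
    then show "((\<lambda>t. heat_flow a b v t x) has_real_derivative (\<Sum>e\<in>Basis. convolve a b D2 v x e e)) (at t)"
      unfolding e unfolding heat_flow_def convolve_def
      using t by (subst (asm) at_within_open) auto
  qed
qed

text \<open>
  The heat flow written as an average over a fixed Gaussian. Unlike the convolution with \<open>heat_kernel t\<close>, this
  form makes sense and is continuous down to \<open>t = 0\<close>.
\<close>

definition gauss_mean :: "('a::euclidean_space \<Rightarrow> real) \<Rightarrow> real \<Rightarrow> 'a \<Rightarrow> real" where
  "gauss_mean v t x = (LINT y|lborel. gauss y * v (x + sqrt t *\<^sub>R y))"

lemma gauss_mult_bound: "\<bar>c\<bar> \<le> M \<Longrightarrow> \<bar>gauss y * c\<bar> \<le> M * gauss y"
  using mult_left_mono[OF _ gauss_nonneg, of "\<bar>c\<bar>" M y] gauss_nonneg[of y] by (simp add: abs_mult mult.commute)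

lemma gauss_mean_integrable:
  assumes v: "continuous_on UNIV v" and M: "\<And>x. \<bar>v x\<bar> \<le> M"
  shows "integrable lborel (\<lambda>y. gauss y * v (x + sqrt t *\<^sub>R y))"
proof (rule Bochner_Integration.integrable_bound[OF integrable_mult_right[OF gauss_integrable, of M]])
  have [measurable]: "v \<in> borel_measurable borel" using v by (rule borel_measurable_continuous_onI)
  show "(\<lambda>y. gauss y * v (x + sqrt t *\<^sub>R y)) \<in> borel_measurable lborel" by measurable
  show "AE y in lborel. norm (gauss y * v (x + sqrt t *\<^sub>R y)) \<le> norm (M * gauss y)"
    unfolding real_norm_def by (intro AE_I2 order.trans[OF gauss_mult_bound[OF M] abs_ge_self])
qed

lemma gauss_mean_bound:
  fixes v :: "'a::euclidean_space \<Rightarrow> real"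
  assumes v: "continuous_on UNIV v" and M: "\<And>x. \<bar>v x\<bar> \<le> M"
  shows "\<bar>gauss_mean v t x\<bar> \<le> M"
proof -
  have "\<bar>gauss_mean v t x\<bar> \<le> (LINT y|lborel. M * gauss (y::'a))"
    unfolding gauss_mean_def
    by (rule Bochner_Integration.integral_abs_bound_integral)
       (intro gauss_mean_integrable[OF v M] integrable_mult_right gauss_integrable gauss_mult_bound[OF M])+
  then show ?thesis by (simp add: gauss_integral)
qed

lemma gauss_mean_0: "gauss_mean v 0 x = v x"
  by (simp add: gauss_mean_def gauss_integral)

lemma gauss_mean_continuous:
  assumes v: "continuous_on UNIV v" and M: "\<And>x. \<bar>v x\<bar> \<le> M"
  shows "continuous_on UNIV (\<lambda>(t, x). gauss_mean v t x)"
  unfolding continuous_on_sequentially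
proof (intro allI ballI impI)
  fix p :: "real \<times> 'a" and X :: "nat \<Rightarrow> real \<times> 'a" assume "(\<forall>n. X n \<in> UNIV) \<and> X \<longlonglongrightarrow> p"
  then have 1: "(\<lambda>n. fst (X n)) \<longlonglongrightarrow> fst p" and 2: "(\<lambda>n. snd (X n)) \<longlonglongrightarrow> snd p"
    by (auto intro: tendsto_fst tendsto_snd)
  have [measurable]: "v \<in> borel_measurable borel" using v by (rule borel_measurable_continuous_onI)
  have "(\<lambda>n. gauss_mean v (fst (X n)) (snd (X n))) \<longlonglongrightarrow> gauss_mean v (fst p) (snd p)"
    unfolding gauss_mean_def
  proof (rule integral_dominated_convergence[where w = "\<lambda>y. M * gauss y"])
    show "integrable lborel (\<lambda>y::'a. M * gauss y)" by (intro integrable_mult_right gauss_integrable)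
    show "AE y in lborel. (\<lambda>n. gauss y * v (snd (X n) + sqrt (fst (X n)) *\<^sub>R y)) \<longlonglongrightarrow> gauss y * v (snd p + sqrt (fst p) *\<^sub>R y)"
    proof (intro AE_I2 tendsto_mult tendsto_const)
      fix y :: 'a
      have "isCont v (snd p + sqrt (fst p) *\<^sub>R y)" using v by (simp add: continuous_on_eq_continuous_at)
      moreover have "(\<lambda>n. snd (X n) + sqrt (fst (X n)) *\<^sub>R y) \<longlonglongrightarrow> snd p + sqrt (fst p) *\<^sub>R y"
        by (intro tendsto_intros 1 2)
      ultimately show "(\<lambda>n. v (snd (X n) + sqrt (fst (X n)) *\<^sub>R y)) \<longlonglongrightarrow> v (snd p + sqrt (fst p) *\<^sub>R y)"
        by (rule isCont_tendsto_compose)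
    qed
    show "AE y in lborel. norm (gauss y * v (snd (X n) + sqrt (fst (X n)) *\<^sub>R y)) \<le> M * gauss y" for n
      unfolding real_norm_def by (intro AE_I2 gauss_mult_bound[OF M])
  qed measurable
  then show "((\<lambda>(t, x). gauss_mean v t x) \<circ> X) \<longlonglongrightarrow> (case p of (t, x) \<Rightarrow> gauss_mean v t x)"
    by (simp add: o_def split_beta)
qed

lemma heat_flow_eq_gauss_mean:
  fixes v :: "'a::euclidean_space \<Rightarrow> real"
  assumes v: "continuous_on UNIV v" and z: "\<And>x. x \<notin> cbox a b \<Longrightarrow> v x = 0" and t: "t > 0"
  shows "heat_flow a b v t x = gauss_mean v t x"
proof -
  define c where "c = sqrt t"
  have c: "c > 0" "c * c = t" using t by (auto simp: c_def)
  define g where "g = (\<lambda>y. v y * heat_kernel t (x - y))"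
  have g: "continuous_on UNIV g"
    unfolding g_def heat_kernel_def using t by (intro continuous_intros v) auto
  have eq: "c ^ DIM('a) * g (x + c *\<^sub>R y) = gauss y * v (x + c *\<^sub>R y)" for y
  proof -
    have "c ^ DIM('a) * heat_kernel t (- (c *\<^sub>R y)) = gauss y"
      using c by (simp add: heat_kernel_def gauss_def real_sqrt_mult power_mult_distrib c_def[symmetric] c(2)[symmetric])
    then show ?thesis by (simp add: g_def)
  qed
  have "heat_flow a b v t x = (LINT y|lborel. g y)"
    using integral_compact_support(2)[OF g, of a b] z by (simp add: heat_flow_def convolve_def g_def)
  also have "\<dots> = \<bar>c\<bar> ^ DIM('a) * (LINT y|lborel. g (x + c *\<^sub>R y))"
    using c by (intro lborel_integral_affine borel_measurable_continuous_onI g) auto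
  also have "\<dots> = (LINT y|lborel. c ^ DIM('a) * g (x + c *\<^sub>R y))" using c by simp
  also have "\<dots> = (LINT y|lborel. gauss y * v (x + c *\<^sub>R y))" by (simp only: eq)
  finally show ?thesis by (simp add: gauss_mean_def c_def)
qed

section \<open>Linear viscosity subsolutions\<close>

text \<open>
  The inequality \<open>\<Delta>v \<ge> b\<close> in the viscosity sense at all points of \<open>U\<close>.
\<close>

definition laplacian_ge :: "'a::euclidean_space set \<Rightarrow> ('a \<Rightarrow> real) \<Rightarrow> real \<Rightarrow> bool" where
  "laplacian_ge U v b \<longleftrightarrow>
     (\<forall>x\<in>U. \<forall>V q D D2. open V \<longrightarrow> x \<in> V \<longrightarrow> C2w V q D D2 \<longrightarrow> q x = v x \<longrightarrow>
        (\<forall>\<^sub>F y in nhds x. v y \<le> q y) \<longrightarrow> b \<le> (\<Sum>e\<in>Basis. blinfun_apply (blinfun_apply (D2 x) e) e))"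

lemma laplacian_geD:
  assumes "laplacian_ge U v b" "x \<in> U" "open V" "x \<in> V" "C2w V q D D2" "q x = v x"
    "\<forall>\<^sub>F y in nhds x. v y \<le> q y"
  shows "b \<le> (\<Sum>e\<in>Basis. blinfun_apply (blinfun_apply (D2 x) e) e)"
  using assms unfolding laplacian_ge_def by blast

lemma exp_radial_C2w:
  fixes A \<alpha> :: real
  obtains D :: "'a::euclidean_space \<Rightarrow> 'a \<Rightarrow>\<^sub>L real" and D2 :: "'a::euclidean_space \<Rightarrow> 'a \<Rightarrow>\<^sub>L 'a \<Rightarrow>\<^sub>L real"
  where "C2w UNIV (\<lambda>x::'a. A * exp (\<alpha> * (x \<bullet> x))) D D2"
    "\<And>x::'a. (\<Sum>e\<in>Basis. D2 x e e) = A * exp (\<alpha> * (x \<bullet> x)) * (4 * \<alpha>^2 * (x \<bullet> x) + 2 * \<alpha> * real DIM('a))"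
proof -
  define h where "h = (\<lambda>s. A * exp (\<alpha> * s))"
  have h1: "(h has_real_derivative \<alpha> * h s) (at s)" for s
    unfolding h_def by (auto intro!: derivative_eq_intros)
  have h2: "((\<lambda>s. \<alpha> * h s) has_real_derivative \<alpha> * (\<alpha> * h s)) (at s)" for s
    by (intro DERIV_cmult h1)
  have c: "continuous_on UNIV (\<lambda>s. \<alpha> * (\<alpha> * h s))"
    unfolding h_def by (intro continuous_intros)
  note C = C2w_radial[OF h1 h2 c, where 'a = 'a]
  show ?thesis
  proof (rule that[OF C[unfolded h_def]])
    fix x :: 'a
    show "(\<Sum>e\<in>Basis. blinfun_apply (blinfun_apply ((4 * (\<alpha> * (\<alpha> * (A * exp (\<alpha> * (x \<bullet> x)))))) *\<^sub>R
        (blinfun_scaleR_left (blinfun_inner_right x) o\<^sub>L blinfun_inner_right x) +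
        (2 * (\<alpha> * (A * exp (\<alpha> * (x \<bullet> x))))) *\<^sub>R Blinfun blinfun_inner_right) e) e) =
        A * exp (\<alpha> * (x \<bullet> x)) * (4 * \<alpha>^2 * (x \<bullet> x) + 2 * \<alpha> * real DIM('a))"
      unfolding C2w_radial_apply radial_laplacian by (simp add: power2_eq_square algebra_simps)
  qed
qed

text \<open>
  The function \<open>v\<close>, constant in time, is compared with its heat flow by the parabolic maximum principle on
  the ball. At an interior maximum of the difference the heat flow plus barrier is an admissible test function
  for \<open>v\<close> at that time. On the lateral boundary nothing is known about \<open>v\<close> beyond its bound, which is why
  the radial barrier \<open>\<beta>\<close> has to dominate there; \<open>\<mu>\<close> is chosen such that \<open>\<beta>\<close> is a supersolution of the
  heat equation, and \<open>\<kappa>\<close> makes the inequality strict.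
\<close>

lemma heat_barrier_comparison:
  fixes v :: "'a::euclidean_space \<Rightarrow> real"
  assumes v: "continuous_on UNIV v" and z: "\<And>x. x \<notin> cbox a c \<Longrightarrow> v x = 0"
    and M: "\<And>x. \<bar>v x\<bar> \<le> M" and vis: "laplacian_ge (ball 0 \<rho>) v b" and \<rho>: "\<rho> > 0"
    and s: "0 < s" "s \<le> 1" and \<alpha>: "\<alpha> > 0" and \<kappa>: "\<kappa> > 0"
    and \<mu>: "\<mu> = 4 * \<alpha>^2 * \<rho>^2 + 2 * \<alpha> * real DIM('a)"
  shows "v 0 \<le> heat_flow a c v s 0 - s * b + (2 * M + \<bar>b\<bar>) * exp (- \<alpha> * \<rho>^2 + \<mu> * s) + \<kappa> * s"
proof -
  define C where "C = 2 * M + \<bar>b\<bar>"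
  have M0: "M \<ge> 0" using M[of 0] by linarith
  have C0: "C \<ge> 0" using M0 by (simp add: C_def)
  have \<mu>0: "\<mu> \<ge> 0" using \<alpha> by (simp add: \<mu>)
  define \<beta> where "\<beta> = (\<lambda>t (x::'a). C * exp (\<mu> * t - \<alpha> * \<rho>^2) * exp (\<alpha> * (x \<bullet> x)))"
  have \<beta>0: "\<beta> t x \<ge> 0" for t x using C0 by (simp add: \<beta>_def)
  \<comment> \<open>The Gaussian mean is used in place of the heat flow to reach the initial time 0.\<close>
  define \<Phi> where "\<Phi> = (\<lambda>(t, x). v x - gauss_mean v t x + t * b - \<beta> t x - \<kappa> * t)"
  have "continuous_on UNIV \<Phi>"
  proof -
    have "continuous_on UNIV (\<lambda>p::real \<times> 'a. v (snd p))"
      by (rule continuous_on_compose2[OF v]) (auto intro!: continuous_intros)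
    moreover have "continuous_on UNIV (\<lambda>p. gauss_mean v (fst p) (snd p))"
      using gauss_mean_continuous[OF v M] by (simp add: split_beta)
    ultimately show ?thesis unfolding \<Phi>_def \<beta>_def split_beta by (intro continuous_intros)
  qed
  then have "continuous_on ({0..s} \<times> cball 0 \<rho>) \<Phi>" by (rule continuous_on_subset) simp
  moreover have "compact ({0..s} \<times> cball (0::'a) \<rho>)" by (intro compact_Times) auto
  ultimately obtain p where p: "p \<in> {0..s} \<times> cball 0 \<rho>" "\<And>p'. p' \<in> {0..s} \<times> cball 0 \<rho> \<Longrightarrow> \<Phi> p' \<le> \<Phi> p"
    using continuous_attains_sup[of "{0..s} \<times> cball (0::'a) \<rho>" \<Phi>] s \<rho> by fastforce
  obtain t0 x0 where p_eq: "p = (t0, x0)" by (cases p)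
  have t0: "0 \<le> t0" "t0 \<le> s" and x0: "norm x0 \<le> \<rho>" using p(1) by (auto simp: p_eq)
  have mx: "\<Phi> (t, x) \<le> \<Phi> (t0, x0)" if "0 \<le> t" "t \<le> s" "norm x \<le> \<rho>" for t x
    using p(2)[of "(t, x)"] that by (simp add: p_eq)
  have "\<Phi> (t0, x0) \<le> 0"
  proof (cases "t0 = 0 \<or> norm x0 = \<rho>")
    case True
    then show ?thesis
    proof
      assume "t0 = 0"
      then show ?thesis using \<beta>0[of 0 x0] by (simp add: \<Phi>_def gauss_mean_0)
    next
      assume "norm x0 = \<rho>"
      then have "x0 \<bullet> x0 = \<rho>^2" by (simp add: power2_norm_eq_inner[symmetric])
      then have "\<beta> t0 x0 = C * exp (\<mu> * t0)" by (simp add: \<beta>_def mult_exp_exp)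
      moreover have "exp (\<mu> * t0) \<ge> 1" using \<mu>0 t0 by simp
      ultimately have "\<beta> t0 x0 \<ge> C" using C0 by (simp add: mult_le_cancel_left1)
      moreover have "v x0 - gauss_mean v t0 x0 \<le> 2 * M"
        using M[of x0] gauss_mean_bound[OF v M, of t0 x0] by linarith
      moreover have "t0 * b \<le> \<bar>b\<bar>"
        using t0 s mult_mono[of t0 1 "\<bar>b\<bar>" "\<bar>b\<bar>"] mult_left_mono[OF abs_ge_self[of b] t0(1)] by linarith
      moreover have "\<kappa> * t0 \<ge> 0" using \<kappa> t0 by simp
      ultimately show ?thesis unfolding \<Phi>_def C_def by (simp add: split_beta)
    qed
  next
    case False
    then have t0': "t0 > 0" and x0': "norm x0 < \<rho>" using t0 x0 by auto
    have hf: "gauss_mean v t = heat_flow a c v t" if "t > 0" for t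
      using heat_flow_eq_gauss_mean[where a = a and b = c, OF v z that] by (auto simp: fun_eq_iff)
    obtain DW D2W where CW: "C2w UNIV (heat_flow a c v t0) DW D2W"
      and dW: "\<And>x. ((\<lambda>t. heat_flow a c v t x) has_real_derivative (\<Sum>e\<in>Basis. blinfun_apply (blinfun_apply (D2W x) e) e)) (at t0)"
      by (rule heat_flow_C2w[OF v t0', of a c]) (use that in blast)
    obtain DB D2B where CB: "C2w UNIV (\<lambda>x::'a. C * exp (\<mu> * t0 - \<alpha> * \<rho>^2) * exp (\<alpha> * (x \<bullet> x))) DB D2B"
      and LB: "\<And>x::'a. (\<Sum>e\<in>Basis. blinfun_apply (blinfun_apply (D2B x) e) e) = C * exp (\<mu> * t0 - \<alpha> * \<rho>^2) * exp (\<alpha> * (x \<bullet> x)) * (4 * \<alpha>^2 * (x \<bullet> x) + 2 * \<alpha> * real DIM('a))"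
      by (rule exp_radial_C2w[where 'a = 'a, of "C * exp (\<mu> * t0 - \<alpha> * \<rho>^2)" \<alpha>]) (use that in blast)
    define k where "k = \<Phi> (t0, x0) - t0 * b + \<kappa> * t0"
    define q where "q = (\<lambda>x. (heat_flow a c v t0 x + C * exp (\<mu> * t0 - \<alpha> * \<rho>^2) * exp (\<alpha> * (x \<bullet> x))) + k)"
    have Cq: "C2w UNIV q (\<lambda>z. (DW z + DB z) + 0) (\<lambda>z. (D2W z + D2B z) + 0)"
      unfolding q_def by (intro C2w_add CW CB C2w_const)
    have q_eq: "q x = gauss_mean v t0 x + \<beta> t0 x + k" for x by (simp add: q_def \<beta>_def hf[OF t0'])
    have "\<forall>\<^sub>F y in nhds x0. y \<in> ball 0 \<rho>" using x0' by (intro eventually_nhds_in_open) auto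
    then have "\<forall>\<^sub>F y in nhds x0. v y \<le> q y"
    proof (rule eventually_mono)
      fix y :: 'a assume "y \<in> ball 0 \<rho>"
      then have "\<Phi> (t0, y) \<le> \<Phi> (t0, x0)" using mx[of t0 y] t0 by simp
      then show "v y \<le> q y" unfolding q_eq k_def by (simp add: \<Phi>_def)
    qed
    moreover have "q x0 = v x0" unfolding q_eq k_def by (simp add: \<Phi>_def)
    ultimately have "b \<le> (\<Sum>e\<in>Basis. blinfun_apply (blinfun_apply ((D2W x0 + D2B x0) + 0) e) e)"
      using laplacian_geD[OF vis, of x0 UNIV q, OF _ open_UNIV UNIV_I Cq] x0' by simp
    then have 1: "b \<le> (\<Sum>e\<in>Basis. blinfun_apply (blinfun_apply (D2W x0) e) e) + \<beta> t0 x0 * (4 * \<alpha>^2 * (x0 \<bullet> x0) + 2 * \<alpha> * real DIM('a))"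
      by (simp add: plus_blinfun.rep_eq sum.distrib LB \<beta>_def)
    have "\<beta> t0 x0 * (4 * \<alpha>^2 * (x0 \<bullet> x0) + 2 * \<alpha> * real DIM('a)) \<le> \<beta> t0 x0 * \<mu>"
    proof (rule mult_left_mono[OF _ \<beta>0])
      have "x0 \<bullet> x0 \<le> \<rho>^2" using x0 by (simp add: power2_norm_eq_inner[symmetric] power_mono)
      then show "4 * \<alpha>\<^sup>2 * (x0 \<bullet> x0) + 2 * \<alpha> * real DIM('a) \<le> \<mu>" unfolding \<mu> by (intro add_right_mono mult_left_mono) auto
    qed
    with 1 have 2: "b \<le> (\<Sum>e\<in>Basis. blinfun_apply (blinfun_apply (D2W x0) e) e) + \<mu> * \<beta> t0 x0" by (simp add: mult.commute)
    define g where "g = (\<lambda>t. v x0 - heat_flow a c v t x0 + t * b - \<beta> t x0 - \<kappa> * t)"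
    \<comment> \<open>Up to the final time only the backward difference quotients are available.\<close>
    have gd: "(g has_real_derivative (0 - (\<Sum>e\<in>Basis. blinfun_apply (blinfun_apply (D2W x0) e) e) + b - \<mu> * \<beta> t0 x0 - \<kappa>)) (at t0)"
      unfolding g_def \<beta>_def by (rule dW derivative_eq_intros refl)+ (simp add: algebra_simps)
    have "0 - (\<Sum>e\<in>Basis. blinfun_apply (blinfun_apply (D2W x0) e) e) + b - \<mu> * \<beta> t0 x0 - \<kappa> < 0" using 2 \<kappa> by simp
    from DERIV_neg_dec_left[OF gd this]
    obtain d where d: "d > 0" "\<And>h. h > 0 \<Longrightarrow> h < d \<Longrightarrow> g t0 < g (t0 - h)" by blast
    define h where "h = min d t0 / 2"
    have h: "h > 0" "h < d" "h < t0" using d t0' by (auto simp: h_def)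
    have gP: "g t = \<Phi> (t, x0)" if "t > 0" for t by (simp add: g_def \<Phi>_def hf[OF that])
    have "g (t0 - h) \<le> g t0" using mx[of "t0 - h" x0] h t0 x0 gP[of t0] gP[of "t0 - h"] t0' by simp
    then show ?thesis using d(2)[OF h(1,2)] by simp
  qed
  then have "\<Phi> (s, 0) \<le> 0" using mx[of s 0] s \<rho> by simp
  moreover have "\<beta> s 0 = C * exp (- \<alpha> * \<rho>^2 + \<mu> * s)" by (simp add: \<beta>_def algebra_simps)
  ultimately show ?thesis
    using heat_flow_eq_gauss_mean[where a = a and b = c and x = 0, OF v z s(1)] by (simp add: \<Phi>_def C_def)
qed

lemma exp_minus_le_quartic:
  assumes "x > (0::real)" shows "exp (- x) \<le> 256 / x ^ 4"
proof -
  have "x / 4 \<le> exp (x / 4)" using exp_ge_add_one_self[of "x / 4"] by linarith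
  then have "(x / 4) ^ 4 \<le> exp (x / 4) ^ 4" using assms by (intro power_mono) auto
  also have "\<dots> = exp x" using exp_of_nat_mult[of 4 "x / 4"] by simp
  finally have "x ^ 4 / 256 \<le> exp x" by (simp add: power_divide)
  then show ?thesis using assms by (simp add: exp_minus field_simps)
qed

text \<open>
  With \<open>\<alpha> = 1 / sqrt s\<close> the barrier at the centre is of size \<open>exp (- \<rho>\<^sup>2 / sqrt s)\<close>, hence smaller than any
  power of \<open>s\<close>. An error of order \<open>s\<^sup>2\<close> is enough: it is negligible against the term \<open>s * b\<close> as \<open>s\<close> tends
  to 0.
\<close>

theorem heat_flow_submean:
  fixes v :: "'a::euclidean_space \<Rightarrow> real"
  assumes v: "continuous_on UNIV v" and z: "\<And>x. x \<notin> cbox a c \<Longrightarrow> v x = 0"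
    and M: "\<And>x. \<bar>v x\<bar> \<le> M" and vis: "laplacian_ge (ball 0 \<rho>) v b" and \<rho>: "\<rho> > 0"
    and s: "0 < s" "s \<le> 1"
  shows "v 0 \<le> heat_flow a c v s 0 - s * b +
     (2 * M + \<bar>b\<bar>) * (exp (4 * \<rho>^2 + 2 * real DIM('a)) * (256 / \<rho> ^ 8)) * s^2"
proof -
  define \<alpha> where "\<alpha> = 1 / sqrt s"
  define \<mu> where "\<mu> = 4 * \<alpha>^2 * \<rho>^2 + 2 * \<alpha> * real DIM('a)"
  have rs: "sqrt s > 0" "sqrt s \<le> 1" "sqrt s * sqrt s = s" using s by auto
  have \<alpha>: "\<alpha> > 0" using s by (simp add: \<alpha>_def)
  have C0: "2 * M + \<bar>b\<bar> \<ge> 0" using M[of 0] by linarith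
  have "v 0 \<le> heat_flow a c v s 0 - s * b + (2 * M + \<bar>b\<bar>) * exp (- \<alpha> * \<rho>^2 + \<mu> * s)"
  proof (rule field_le_epsilon)
    fix \<kappa> :: real assume \<kappa>: "\<kappa> > 0"
    have "\<kappa> * s \<le> \<kappa>" using \<kappa> s by (simp add: mult_le_cancel_left1)
    then show "v 0 \<le> heat_flow a c v s 0 - s * b + (2 * M + \<bar>b\<bar>) * exp (- \<alpha> * \<rho>^2 + \<mu> * s) + \<kappa>"
      using heat_barrier_comparison[where a = a and c = c, OF v z M vis \<rho> s \<alpha> \<kappa> \<mu>_def] by linarith
  qed
  moreover have "exp (- \<alpha> * \<rho>^2 + \<mu> * s) \<le> exp (4 * \<rho>^2 + 2 * real DIM('a)) * (256 / \<rho> ^ 8) * s^2"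
  proof -
    have "\<mu> * s = 4 * \<rho>^2 + 2 * real DIM('a) * sqrt s"
      unfolding \<mu>_def \<alpha>_def using rs by (simp add: field_simps power2_eq_square)
    also have "\<dots> \<le> 4 * \<rho>^2 + 2 * real DIM('a)" using rs by simp
    finally have 1: "exp (\<mu> * s) \<le> exp (4 * \<rho>^2 + 2 * real DIM('a))" by simp
    have "exp (- (\<alpha> * \<rho>^2)) \<le> 256 / (\<alpha> * \<rho>^2) ^ 4" using \<alpha> \<rho> by (intro exp_minus_le_quartic) simp
    also have "(\<alpha> * \<rho>^2) ^ 4 = \<rho> ^ 8 / s^2"
    proof -
      have "sqrt s ^ 4 = s^2" using rs by (simp add: power4_eq_xxxx power2_eq_square mult.assoc)
      then show ?thesis by (simp add: \<alpha>_def power_mult_distrib power_divide flip: power_mult)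
    qed
    finally have "exp (- (\<alpha> * \<rho>^2)) \<le> 256 / \<rho> ^ 8 * s^2" by simp
    with 1 have "exp (\<mu> * s) * exp (- (\<alpha> * \<rho>^2)) \<le> exp (4 * \<rho>^2 + 2 * real DIM('a)) * (256 / \<rho> ^ 8 * s^2)"
      by (intro mult_mono) auto
    then show ?thesis by (simp add: mult_exp_exp mult.assoc)
  qed
  ultimately show ?thesis using mult_left_mono[OF _ C0] by (smt (verit) mult.assoc)
qed

text \<open>
  The columns of \<open>T\<close> encode the coefficients of the linear operator \<open>\<Sum> D\<^sup>2 q (T e) (T e)\<close>, so that composing
  with \<open>T\<close> turns it into the Laplacian, whereas the mollifier \<open>\<phi>\<close> does not depend on it. Averaging the mean
  value inequality for the translates of \<open>u\<close> with weight \<open>\<phi>\<close> gives the mean value inequality for the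
  mollification \<open>J\<close>. If the claim failed, \<open>- J\<close> would satisfy the opposite strict inequality near the point
  and thus an opposite mean value inequality; the two contradict each other for small \<open>s\<close>.
\<close>

theorem mollified_linear_subsolution:
  fixes u \<phi> :: "'a::euclidean_space \<Rightarrow> real" and T S :: "'a \<Rightarrow>\<^sub>L 'a"
  assumes ST: "\<And>x. S (T x) = x" "\<And>x. T (S x) = x"
    and u: "continuous_on UNIV u" and u0: "\<And>x. norm x > R \<Longrightarrow> u x = 0"
    and C\<phi>: "C2w UNIV \<phi> D\<phi> D2\<phi>" and \<phi>0: "\<And>x. \<phi> x \<ge> 0" and \<phi>s: "\<And>x. norm x > r \<Longrightarrow> \<phi> x = 0"
    and \<phi>1: "(LINT x|lborel. \<phi> x) = 1" and ac: "cball 0 R \<subseteq> cbox a c" and r: "r < r'"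
    and tst: "\<And>x V q D D2. x \<in> ball x1 r' \<Longrightarrow> open V \<Longrightarrow> x \<in> V \<Longrightarrow> C2w V q D D2 \<Longrightarrow> q x = u x \<Longrightarrow>
        (\<forall>\<^sub>F y in nhds x. u y \<le> q y) \<Longrightarrow> b \<le> (\<Sum>e\<in>Basis. blinfun_apply (blinfun_apply (D2 x) (T e)) (T e))"
  shows "b \<le> (\<Sum>e\<in>Basis. blinfun_apply (blinfun_apply (convolve a c D2\<phi> u x1) (T e)) (T e))"
proof (rule ccontr)
  define J where "J = convolve a c \<phi> u"
  have CJ: "C2w UNIV J (convolve a c D\<phi> u) (convolve a c D2\<phi> u)"
    unfolding J_def by (rule convolve_C2w[OF C\<phi> u])
  have cJ: "continuous_on UNIV J" by (rule C2w_continuous[OF CJ])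
  have c\<phi>: "continuous_on UNIV \<phi>" by (rule C2w_continuous[OF C\<phi>])
  \<comment> \<open>A radius outside of which all the translates z \<mapsto> u (y + T z) that occur, and J (x1 + T z), vanish.\<close>
  define R1 where "R1 = norm S * (\<bar>R\<bar> + \<bar>r\<bar> + norm x1)"
  have TS: "norm z \<le> norm S * norm (T z)" for z
    using norm_blinfun[of S "T z"] by (simp add: ST)
  have out: "norm (T z) > \<bar>R\<bar> + \<bar>r\<bar> + norm x1" if "norm z > R1" for z
  proof (rule ccontr)
    assume "\<not> ?thesis"
    then have "norm S * norm (T z) \<le> R1" unfolding R1_def by (intro mult_left_mono) auto
    then show False using TS[of z] that by linarith
  qed
  have J_int: "J x = (LINT y|lborel. \<phi> (x - y) * u y)" for x
    unfolding J_def convolve_def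
    using integral_compact_support(2)[of "\<lambda>y. u y *\<^sub>R \<phi> (x - y)" a c] u0 ac
    by (force simp: mult.commute intro!: continuous_intros u continuous_on_compose2[OF c\<phi>])
  have J0: "J x = 0" if "norm x > \<bar>R\<bar> + \<bar>r\<bar>" for x
  proof -
    have "\<phi> (x - y) * u y = 0" for y
    proof (cases "norm y > R")
      case False
      then have "norm (x - y) > r" using that norm_triangle_ineq2[of x y] by linarith
      then show ?thesis by (simp add: \<phi>s)
    qed (simp add: u0)
    then have "(\<lambda>y. \<phi> (x - y) * u y) = (\<lambda>_. 0)" by (simp only:)
    then show ?thesis by (simp add: J_int)
  qed
  obtain b1 :: 'a where b1: "cball 0 R1 \<subseteq> cbox (- b1) b1"
    using bounded_subset_cbox_symmetric[OF bounded_cball] by blast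
  obtain b2 :: 'a where b2: "cball x1 r \<subseteq> cbox (- b2) b2"
    using bounded_subset_cbox_symmetric[OF bounded_cball] by blast
  have \<phi>b2: "\<phi> (x1 - y) = 0" if "y \<notin> cbox (- b2) b2" for y
  proof -
    have "y \<notin> cball x1 r" using that b2 by blast
    then show ?thesis by (intro \<phi>s) (simp add: dist_norm not_le)
  qed
  have shift: "integral (cbox (- b2) b2) (\<lambda>y. \<phi> (x1 - y) * u (y + w)) = J (x1 + w)" for w
  proof -
    have cg: "continuous_on UNIV (\<lambda>y. \<phi> (x1 - y) * u (y + w))"
      by (intro continuous_intros continuous_on_compose2[OF c\<phi>] continuous_on_compose2[OF u]) auto
    have "integral (cbox (- b2) b2) (\<lambda>y. \<phi> (x1 - y) * u (y + w)) = (LINT y|lborel. \<phi> (x1 - y) * u (y + w))"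
      by (rule integral_compact_support(2)[OF cg]) (simp add: \<phi>b2)
    also have "\<dots> = (LINT y|lborel. \<phi> (x1 + w - y) * u y)"
      using lborel_integral_affine[of 1, OF _ borel_measurable_continuous_onI[OF cg], of "- w"]
      by (simp add: algebra_simps)
    finally show ?thesis by (simp add: J_int)
  qed
  have \<phi>int: "integral (cbox (- b2) b2) (\<lambda>y. \<phi> (x1 - y)) = 1"
  proof -
    have cg: "continuous_on UNIV (\<lambda>y. \<phi> (x1 - y))"
      by (intro continuous_intros continuous_on_compose2[OF c\<phi>]) auto
    have "integral (cbox (- b2) b2) (\<lambda>y. \<phi> (x1 - y)) = (LINT y|lborel. \<phi> (x1 - y))"
      by (rule integral_compact_support(2)[OF cg]) (simp add: \<phi>b2)
    also have "\<dots> = (LINT y|lborel. \<phi> y)"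
      using lborel_integral_affine[of "-1", OF _ borel_measurable_continuous_onI[OF c\<phi>], of x1] by simp
    finally show ?thesis by (simp add: \<phi>1)
  qed
  obtain M where M: "\<And>x. \<bar>u x\<bar> \<le> M" and MJ: "\<And>x. \<bar>J x\<bar> \<le> M"
  proof -
    have bd: "\<exists>B. \<forall>x. \<bar>g x\<bar> \<le> B" if g: "continuous_on UNIV g" "\<And>x. norm x > Q \<Longrightarrow> g x = 0" for g :: "'a \<Rightarrow> real" and Q
    proof -
      have "bounded (g ` cball 0 Q)"
        by (intro compact_imp_bounded compact_continuous_image continuous_on_subset[OF g(1)]) auto
      then obtain B where "\<forall>x\<in>cball 0 Q. \<bar>g x\<bar> \<le> B" by (auto simp: bounded_iff)
      then have B: "\<bar>g x\<bar> \<le> B" if "norm x \<le> Q" for x using that by simp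
      have "\<bar>g x\<bar> \<le> \<bar>B\<bar>" for x using B[of x] g(2)[of x] by (cases "norm x \<le> Q") auto
      then show ?thesis by blast
    qed
    obtain B1 where "\<forall>x. \<bar>u x\<bar> \<le> B1" using bd[OF u u0] by blast
    moreover obtain B2 where "\<forall>x. \<bar>J x\<bar> \<le> B2" using bd[OF cJ J0] by blast
    ultimately show ?thesis by (intro that[of "max B1 B2"]) (auto simp: max.coboundedI1 max.coboundedI2)
  qed
  \<comment> \<open>If y is within r of x1 and z within \<rho> of 0, then y + T z is within r' of x1.\<close>
  define \<rho> where "\<rho> = (r' - r) / (norm T + 1)"
  have nT: "norm T + 1 > 0" by (simp add: add_nonneg_pos)
  have \<rho>: "\<rho> > 0" using r nT by (simp add: \<rho>_def)
  have vis: "laplacian_ge (ball 0 \<rho>) (\<lambda>z. u (y + T z)) b" if y: "norm (x1 - y) \<le> r" for y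
    unfolding laplacian_ge_def
  proof (intro ballI allI impI)
    fix x V q D D2
    assume x: "x \<in> ball 0 \<rho>" and V: "open V" "x \<in> V" and Cq: "C2w V q D D2" and eq: "q x = u (y + T x)"
      and le: "\<forall>\<^sub>F z in nhds x. u (y + T z) \<le> q z"
    define V' where "V' = (\<lambda>x'. - S y + S x') -` V"
    define x' where "x' = y + T x"
    have Sx: "- S y + S x' = x" by (simp add: x'_def blinfun.add_right ST)
    then have Sx2: "S x' - S y = x" by simp
    have cS: "continuous_on UNIV (\<lambda>x'. - S y + S x')" by (intro continuous_intros)
    have V': "open V'" unfolding V'_def using V cS by (intro open_vimage)
    have x'V: "x' \<in> V'" using V Sx by (simp add: V'_def)
    have "norm (T x) \<le> norm T * norm x" by (rule norm_blinfun)
    also have "\<dots> \<le> (norm T + 1) * norm x" by (intro mult_right_mono) auto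
    also have "\<dots> < (norm T + 1) * \<rho>" using x nT by (intro mult_strict_left_mono) auto
    also have "\<dots> = r' - r" using nT by (simp add: \<rho>_def)
    finally have Tx: "norm (T x) < r' - r" .
    have "norm (x1 - x') \<le> norm (x1 - y) + norm (T x)"
      using norm_triangle_ineq4[of "x1 - y" "T x"] by (simp add: x'_def algebra_simps)
    then have "x' \<in> ball x1 r'" using Tx y by (simp add: dist_norm)
    moreover have "C2w V' (\<lambda>x'. q (- S y + S x')) (\<lambda>x'. D (- S y + S x') o\<^sub>L S) (\<lambda>x'. (precomp S o\<^sub>L D2 (- S y + S x')) o\<^sub>L S)"
      by (rule C2w_affine[OF Cq]) (simp add: V'_def)
    moreover have "\<forall>\<^sub>F z in nhds x'. u z \<le> q (- S y + S z)"
    proof -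
      have "isCont (\<lambda>x'. - S y + S x') x'" using cS by (simp add: continuous_on_eq_continuous_at)
      then have "filterlim (\<lambda>x'. - S y + S x') (nhds (- S y + S x')) (nhds x')"
        unfolding isCont_def by (rule tendsto_at_iff_tendsto_nhds[THEN iffD1])
      then have "filterlim (\<lambda>x'. - S y + S x') (nhds x) (nhds x')" unfolding Sx .
      from eventually_compose_filterlim[OF le this]
      show ?thesis by (simp add: blinfun.add_right blinfun.minus_right blinfun.diff_right ST)
    qed
    ultimately have "b \<le> (\<Sum>e\<in>Basis. blinfun_apply (blinfun_apply ((precomp S o\<^sub>L D2 (- S y + S x')) o\<^sub>L S) (T e)) (T e))"
      by (intro tst[OF _ V' x'V]) (use eq in \<open>auto simp: Sx2 x'_def[symmetric]\<close>)
    then show "b \<le> (\<Sum>e\<in>Basis. blinfun_apply (blinfun_apply (D2 x) e) e)"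
      unfolding C2w_affine_apply by (simp add: Sx2 ST)
  qed
  assume "\<not> ?thesis"
  then have lt: "(\<Sum>e\<in>Basis. blinfun_apply (blinfun_apply (convolve a c D2\<phi> u x1) (T e)) (T e)) < b" by simp
  define p where "p = (\<lambda>z. - 1 * J (x1 + T z))"
  define D2p where "D2p = (\<lambda>z. (-1) *\<^sub>R ((precomp T o\<^sub>L convolve a c D2\<phi> u (x1 + T z)) o\<^sub>L T))"
  have Cp: "C2w UNIV p (\<lambda>z. (-1) *\<^sub>R (convolve a c D\<phi> u (x1 + T z) o\<^sub>L T)) D2p"
    unfolding p_def D2p_def by (intro C2w_scale C2w_affine[OF CJ]) auto
  define \<Delta> where "\<Delta> = (\<lambda>z. \<Sum>e\<in>Basis. blinfun_apply (blinfun_apply (D2p z) e) e)"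
  have "continuous_on UNIV D2p" using Cp by (simp add: C2w_def)
  then have c\<Delta>: "continuous_on UNIV \<Delta>" unfolding \<Delta>_def by (intro continuous_intros)
  have \<Delta>0: "\<Delta> 0 = - (\<Sum>e\<in>Basis. blinfun_apply (blinfun_apply (convolve a c D2\<phi> u x1) (T e)) (T e))"
    by (simp add: \<Delta>_def D2p_def scaleR_blinfun.rep_eq uminus_blinfun.rep_eq precomp_apply sum_negf)
  obtain l where l: "- \<Delta> 0 < l" "l < b" using lt \<Delta>0 dense by force
  have "open (\<Delta> -` {- l<..})" using c\<Delta> by (intro open_vimage) auto
  moreover have "0 \<in> \<Delta> -` {- l<..}" using l by simp
  ultimately obtain \<rho>' where \<rho>': "\<rho>' > 0" "ball 0 \<rho>' \<subseteq> \<Delta> -` {- l<..}" using openE by blast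
  have visp: "laplacian_ge (ball 0 \<rho>') p (- l)"
    unfolding laplacian_ge_def
  proof (intro ballI allI impI)
    fix x V q D D2
    assume x: "x \<in> ball 0 \<rho>'" and V: "open V" "x \<in> V" and Cq: "C2w V q D D2" and eq: "q x = p x"
      and le: "\<forall>\<^sub>F z in nhds x. p z \<le> q z"
    have "- l < \<Delta> x" using x \<rho>' by auto
    also have "\<Delta> x \<le> (\<Sum>e\<in>Basis. blinfun_apply (blinfun_apply (D2 x) e) e)"
      unfolding \<Delta>_def
      by (intro sum_mono C2w_mono_touch[OF C2w_subset[OF Cp] Cq V] eq[symmetric] le) auto
    finally show "- l \<le> (\<Sum>e\<in>Basis. blinfun_apply (blinfun_apply (D2 x) e) e)" by simp
  qed
  define E where "E = (\<lambda>(\<rho>::real) (b::real). (2 * M + \<bar>b\<bar>) * (exp (4 * \<rho>^2 + 2 * real DIM('a)) * (256 / \<rho> ^ 8)))"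
  have M0: "M \<ge> 0" using M[of 0] by linarith
  have E0: "E \<rho> b \<ge> 0" if "\<rho> > 0" for \<rho> b unfolding E_def using M0 that by (intro mult_nonneg_nonneg) auto
  have main: "0 \<le> s * (l - b) + (E \<rho> b + E \<rho>' (- l)) * s^2" if s: "0 < s" "s \<le> 1" for s
  proof -
    define k where "k = (\<lambda>z::'a. heat_kernel s (0 - z))"
    have ck: "continuous_on UNIV k" unfolding k_def heat_kernel_def using s by (intro continuous_intros) auto
    define Q where "Q = - s * b + E \<rho> b * s^2"
    have cc: "continuous_on UNIV (\<lambda>(y, z). \<phi> (x1 - y) * (u (y + T z) * k z))"
      unfolding split_beta
      by (intro continuous_intros continuous_on_compose2[OF c\<phi>] continuous_on_compose2[OF u] continuous_on_compose2[OF ck]) auto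
    define W where "W = (\<lambda>y. integral (cbox (- b1) b1) (\<lambda>z. u (y + T z) * k z))"
    have "continuous_on (UNIV \<times> cbox (- b1) b1) (\<lambda>(y, z). u (y + T z) * k z)"
      unfolding split_beta
      by (intro continuous_intros continuous_on_compose2[OF u] continuous_on_compose2[OF ck]) auto
    from integral_continuous_on_param[OF this] have cW: "continuous_on UNIV W" unfolding W_def .
    have ptw: "\<phi> (x1 - y) * u (y + 0) \<le> \<phi> (x1 - y) * W y + Q * \<phi> (x1 - y)" for y
    proof (cases "norm (x1 - y) > r")
      case True then show ?thesis by (simp add: \<phi>s)
    next
      case False
      then have y: "norm (x1 - y) \<le> r" by simp
      have "u (y + T 0) \<le> heat_flow (- b1) b1 (\<lambda>z. u (y + T z)) s 0 - s * b +
        (2 * M + \<bar>b\<bar>) * (exp (4 * \<rho>^2 + 2 * real DIM('a)) * (256 / \<rho> ^ 8)) * s^2"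
      proof (rule heat_flow_submean[OF _ _ M vis[OF y] \<rho> s])
        show "continuous_on UNIV (\<lambda>z. u (y + T z))"
          by (intro continuous_intros continuous_on_compose2[OF u]) auto
        fix z assume "z \<notin> cbox (- b1) b1"
        then have "norm z > R1" using b1 by (auto simp: not_le[symmetric])
        then have "norm (T z) > \<bar>R\<bar> + \<bar>r\<bar> + norm x1" by (rule out)
        moreover have "norm y \<le> norm x1 + r" using y norm_triangle_ineq2[of y x1] by (simp add: norm_minus_commute)
        moreover have "norm (T z) \<le> norm (y + T z) + norm y" using norm_triangle_ineq4[of "y + T z" y] by simp
        ultimately have "norm (y + T z) > R" by linarith
        then show "u (y + T z) = 0" by (rule u0)
      qed
      then have "u (y + 0) \<le> W y + Q"
        by (simp add: heat_flow_def convolve_def W_def k_def Q_def E_def)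
      from mult_left_mono[OF this \<phi>0[of "x1 - y"]] show ?thesis by (simp add: algebra_simps)
    qed
    have c1: "continuous_on UNIV (\<lambda>y. \<phi> (x1 - y))"
      by (intro continuous_intros continuous_on_compose2[OF c\<phi>]) auto
    have i1: "(\<lambda>y. \<phi> (x1 - y) * W y) integrable_on cbox (- b2) b2" "(\<lambda>y. Q * \<phi> (x1 - y)) integrable_on cbox (- b2) b2"
      "(\<lambda>y. \<phi> (x1 - y) * u (y + 0)) integrable_on cbox (- b2) b2"
      by (intro integrable_continuous continuous_intros continuous_on_subset[OF c1] continuous_on_subset[OF cW] continuous_on_compose2[OF u]; simp)+
    have "J (x1 + 0) \<le> integral (cbox (- b2) b2) (\<lambda>y. \<phi> (x1 - y) * W y + Q * \<phi> (x1 - y))"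
      unfolding shift[symmetric] by (rule integral_le[OF i1(3) integrable_add[OF i1(1,2)] ptw])
    also have "\<dots> = integral (cbox (- b2) b2) (\<lambda>y. \<phi> (x1 - y) * W y) + Q"
      by (subst integral_add[OF i1(1,2)]) (simp add: \<phi>int)
    also have "integral (cbox (- b2) b2) (\<lambda>y. \<phi> (x1 - y) * W y) =
        integral (cbox (- b2) b2) (\<lambda>y. integral (cbox (- b1) b1) (\<lambda>z. \<phi> (x1 - y) * (u (y + T z) * k z)))"
      by (simp add: W_def)
    also have "\<dots> = integral (cbox (- b1) b1) (\<lambda>z. integral (cbox (- b2) b2) (\<lambda>y. \<phi> (x1 - y) * (u (y + T z) * k z)))"
      by (rule integral_swap_continuous) (rule continuous_on_subset[OF cc], simp)
    also have "\<dots> = integral (cbox (- b1) b1) (\<lambda>z. J (x1 + T z) * k z)"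
      by (simp add: mult.assoc[symmetric] shift)
    finally have 1: "J x1 \<le> integral (cbox (- b1) b1) (\<lambda>z. J (x1 + T z) * k z) + Q" by simp
    have "p 0 \<le> heat_flow (- b1) b1 p s 0 - s * (- l) +
        (2 * M + \<bar>- l\<bar>) * (exp (4 * \<rho>'^2 + 2 * real DIM('a)) * (256 / \<rho>' ^ 8)) * s^2"
    proof (rule heat_flow_submean[OF C2w_continuous[OF Cp] _ _ visp \<rho>'(1) s])
      show "\<bar>p x\<bar> \<le> M" for x using MJ by (simp add: p_def)
      fix z assume "z \<notin> cbox (- b1) b1"
      then have "norm z > R1" using b1 by (auto simp: not_le[symmetric])
      then have "norm (T z) > \<bar>R\<bar> + \<bar>r\<bar> + norm x1" by (rule out)
      moreover have "norm (T z) \<le> norm (x1 + T z) + norm x1" using norm_triangle_ineq4[of "x1 + T z" x1] by simp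
      ultimately show "p z = 0" by (simp add: p_def J0)
    qed
    moreover have "heat_flow (- b1) b1 p s 0 = - integral (cbox (- b1) b1) (\<lambda>z. J (x1 + T z) * k z)"
      by (simp add: heat_flow_def convolve_def p_def k_def)
    ultimately have "- J x1 \<le> - integral (cbox (- b1) b1) (\<lambda>z. J (x1 + T z) * k z) + s * l + E \<rho>' (- l) * s^2"
      by (simp add: p_def E_def)
    with 1 show ?thesis by (simp add: Q_def algebra_simps)
  qed
  define A where "A = E \<rho> b + E \<rho>' (- l) + 1"
  have A: "A > 0" unfolding A_def using E0[OF \<rho>, of b] E0[OF \<rho>'(1), of "- l"] by linarith
  \<comment> \<open>For this s the quadratic error is at most half of the linear gain s (b - l).\<close>
  define s where "s = min 1 ((b - l) / (2 * A))"
  have s: "0 < s" "s \<le> 1" using A l by (auto simp: s_def)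
  have "0 \<le> s * (l - b) + A * s^2" using main[OF s] s by (simp add: A_def algebra_simps) (smt (verit) zero_le_power2)
  then have "0 \<le> s * ((l - b) + A * s)" by (simp add: power2_eq_square algebra_simps)
  then have "b - l \<le> A * s" using s by (simp add: zero_le_mult_iff)
  also have "A * s \<le> A * ((b - l) / (2 * A))" using A by (intro mult_left_mono) (auto simp: s_def)
  also have "\<dots> = (b - l) / 2" using A by simp
  finally show False using l by simp
qed

section \<open>Mollifiers, semicontinuity and sup-convolution\<close>

lemma max_power_DERIV:
  "((\<lambda>s::real. max 0 s ^ Suc (Suc n)) has_real_derivative real (Suc (Suc n)) * max 0 s ^ Suc n) (at s)"
proof (cases "s = 0")
  case True
  have "((\<lambda>h. max 0 h ^ Suc n) \<longlongrightarrow> max 0 (0::real) ^ Suc n) (at 0)"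
    by (intro tendsto_intros)
  then have "((\<lambda>h::real. max 0 h ^ Suc n) \<longlongrightarrow> 0) (at 0)" by simp
  moreover have "\<forall>\<^sub>F h::real in at 0. max 0 h ^ Suc n = (max 0 (0 + h) ^ Suc (Suc n) - max 0 0 ^ Suc (Suc n)) / h"
    by (auto simp: eventually_at_filter max_def)
  ultimately have "((\<lambda>h::real. (max 0 (0 + h) ^ Suc (Suc n) - max 0 0 ^ Suc (Suc n)) / h) \<longlongrightarrow> 0) (at 0)"
    by (rule Lim_transform_eventually)
  then show ?thesis unfolding True DERIV_def by simp
next
  case False
  show ?thesis
  proof (cases "s > 0")
    case True
    have "((\<lambda>s::real. s ^ Suc (Suc n)) has_real_derivative real (Suc (Suc n)) * max 0 s ^ Suc n) (at s)"
      using DERIV_pow[of "Suc (Suc n)" s] True by (simp add: max_def)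
    then show ?thesis
      by (rule has_field_derivative_transform_within_open[where S = "{0<..}"]) (use True in \<open>auto simp: max_def\<close>)
  next
    case neg: False
    have "((\<lambda>s::real. 0) has_real_derivative real (Suc (Suc n)) * max 0 s ^ Suc n) (at s)"
      using neg False by (simp add: max_def)
    then show ?thesis
      by (rule has_field_derivative_transform_within_open[where S = "{..<0}"]) (use neg False in \<open>auto simp: max_def\<close>)
  qed
qed

text \<open>
  The kernel is a multiple of the cube of the positive part of \<open>r\<^sup>2 - |x|\<^sup>2\<close>. The cube is the lowest power for
  which it has two continuous derivatives.
\<close>

lemma bump_kernel:
  fixes r :: real
  assumes r: "r > 0"
  obtains \<phi> :: "'a::euclidean_space \<Rightarrow> real" and D :: "'a::euclidean_space \<Rightarrow> 'a \<Rightarrow>\<^sub>L real"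
    and D2 :: "'a::euclidean_space \<Rightarrow> 'a \<Rightarrow>\<^sub>L 'a \<Rightarrow>\<^sub>L real"
  where "C2w UNIV \<phi> D D2" "\<And>x. \<phi> x \<ge> 0" "\<And>x. norm x > r \<Longrightarrow> \<phi> x = 0" "(LINT x|lborel. \<phi> x) = 1"
proof -
  define h where "h = (\<lambda>s. max 0 (r^2 - s) ^ 3)"
  define h' where "h' = (\<lambda>s. - 3 * max 0 (r^2 - s) ^ 2)"
  define h'' where "h'' = (\<lambda>s. 6 * max 0 (r^2 - s))"
  have m: "((\<lambda>s. r^2 - s) has_real_derivative - 1) (at s)" for s
    by (auto intro!: derivative_eq_intros)
  have h1: "(h has_real_derivative h' s) (at s)" for s
    using DERIV_chain2[OF max_power_DERIV[of 1] m] by (simp add: h_def h'_def numeral_3_eq_3 numeral_2_eq_2)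
  have h2: "(h' has_real_derivative h'' s) (at s)" for s
    using DERIV_cmult[OF DERIV_chain2[OF max_power_DERIV[of 0] m], of "- 3"] by (simp add: h'_def h''_def numeral_2_eq_2)
  have c: "continuous_on UNIV h''" unfolding h''_def by (intro continuous_intros)
  define g where "g = (\<lambda>x::'a. h (x \<bullet> x))"
  have Cg: "\<exists>D D2. C2w UNIV g D D2" unfolding g_def using C2w_radial[OF h1 h2 c] by blast
  then have cg: "continuous_on UNIV g" using C2w_continuous by blast
  have g0: "g x \<ge> 0" for x by (simp add: g_def h_def)
  have gs: "g x = 0" if "norm x > r" for x
  proof -
    have "r^2 < norm x ^ 2" using that r by (intro power_strict_mono) auto
    then show ?thesis by (simp add: g_def h_def power2_norm_eq_inner)
  qed
  obtain a :: 'a where a: "cball 0 (r + 1) \<subseteq> cbox (- a) a"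
    using bounded_subset_cbox_symmetric[OF bounded_cball] by blast
  have ga: "g x = 0" if "x \<notin> cbox (- a) a" for x
  proof (rule gs)
    have "x \<notin> cball 0 (r + 1)" using that a by blast
    then show "norm x > r" by (simp add: not_le)
  qed
  define I where "I = (LINT x|lborel. g x)"
  have I: "integral (cbox (- a) a) g = I" unfolding I_def by (rule integral_compact_support(2)[OF cg ga])
  have gi: "g integrable_on cbox (- a) a" by (rule integrable_continuous) (rule continuous_on_subset[OF cg], simp)
  have "I \<ge> 0" unfolding I_def by (intro integral_nonneg_AE AE_I2 g0)
  moreover have "I \<noteq> 0"
  proof
    assume "I = 0"
    then have "(g has_integral 0) (cbox (- a) a)" using gi I by (metis integrable_integral)
    moreover have "0 \<in> interior (cbox (- a) a)"
    proof -
      have "ball 0 (r + 1) \<subseteq> cbox (- a) a" using a ball_subset_cball by blast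
      then have "ball 0 (r + 1) \<subseteq> interior (cbox (- a) a)" by (rule interior_maximal) (rule open_ball)
      moreover have "(0::'a) \<in> ball 0 (r + 1)" using r by simp
      ultimately show ?thesis by blast
    qed
    moreover have "continuous_on (cbox (- a) a) g" by (rule continuous_on_subset[OF cg]) simp
    ultimately have "g 0 = 0"
      using has_integral_0_cbox_imp_0[of "- a" a g 0] g0 interior_subset[of "cbox (- a) a"] interior_cbox[of "- a" a]
      by blast
    then show False using r by (simp add: g_def h_def)
  qed
  ultimately have Ip: "I > 0" by simp
  obtain D D2 where "C2w UNIV g D D2" using Cg by blast
  from C2w_scale[OF this, of "1 / I"]
  show ?thesis
    by (rule that) (use g0 gs Ip in \<open>auto simp: I_def[symmetric]\<close>)
qed

lemma convolve_eq_lborel: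
  fixes u \<phi> :: "'a::euclidean_space \<Rightarrow> real"
  assumes u: "continuous_on UNIV u" and u0: "\<And>x. norm x > R \<Longrightarrow> u x = 0" and ac: "cball 0 R \<subseteq> cbox a c"
    and c\<phi>: "continuous_on UNIV \<phi>"
  shows "convolve a c \<phi> u x = (LINT y|lborel. \<phi> (x - y) * u y)"
  unfolding convolve_def
  using integral_compact_support(2)[of "\<lambda>y. u y *\<^sub>R \<phi> (x - y)" a c] u0 ac
  by (force simp: mult.commute intro!: continuous_intros u continuous_on_compose2[OF c\<phi>])

lemma convolve_close:
  fixes u \<phi> :: "'a::euclidean_space \<Rightarrow> real"
  assumes u: "continuous_on UNIV u" and u0: "\<And>x. norm x > R \<Longrightarrow> u x = 0" and ac: "cball 0 R \<subseteq> cbox a c"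
    and c\<phi>: "continuous_on UNIV \<phi>" and \<phi>0: "\<And>x. \<phi> x \<ge> 0" and \<phi>s: "\<And>x. norm x > r \<Longrightarrow> \<phi> x = 0"
    and \<phi>1: "(LINT x|lborel. \<phi> x) = 1" and cl: "\<And>y. dist x y \<le> r \<Longrightarrow> \<bar>u y - u x\<bar> \<le> \<epsilon>"
  shows "\<bar>convolve a c \<phi> u x - u x\<bar> \<le> \<epsilon>"
proof -
  obtain b :: 'a where b: "cball x r \<subseteq> cbox (- b) b"
    using bounded_subset_cbox_symmetric[OF bounded_cball] by blast
  have z: "\<phi> (x - y) = 0" if "y \<notin> cbox (- b) b" for y
  proof -
    have "y \<notin> cball x r" using that b by blast
    then show ?thesis by (intro \<phi>s) (simp add: dist_norm not_le)
  qed
  have c1: "continuous_on UNIV (\<lambda>y. \<phi> (x - y))"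
    by (intro continuous_intros continuous_on_compose2[OF c\<phi>]) auto
  have i1: "integrable lborel (\<lambda>y. \<phi> (x - y))" by (rule integral_compact_support(1)[OF c1 z])
  have i2: "integrable lborel (\<lambda>y. \<phi> (x - y) * u y)"
    by (rule integral_compact_support(1)[where a = "- b" and b = b]) (auto intro!: continuous_intros c1 u simp: z)
  have one: "(LINT y|lborel. \<phi> (x - y)) = 1"
    using lborel_integral_affine[of "-1", OF _ borel_measurable_continuous_onI[OF c\<phi>], of x] \<phi>1 by simp
  have "convolve a c \<phi> u x - u x = (LINT y|lborel. \<phi> (x - y) * u y) - (LINT y|lborel. \<phi> (x - y) * u x)"
    using convolve_eq_lborel[OF u u0 ac c\<phi>] one by simp
  also have "\<dots> = (LINT y|lborel. \<phi> (x - y) * u y - \<phi> (x - y) * u x)"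
    by (intro Bochner_Integration.integral_diff[symmetric] i2 integrable_mult_left i1)
  finally have e: "convolve a c \<phi> u x - u x = (LINT y|lborel. \<phi> (x - y) * u y - \<phi> (x - y) * u x)" .
  have "\<bar>convolve a c \<phi> u x - u x\<bar> \<le> (LINT y|lborel. \<phi> (x - y) * \<epsilon>)"
    unfolding e
  proof (rule Bochner_Integration.integral_abs_bound_integral)
    show "integrable lborel (\<lambda>y. \<phi> (x - y) * u y - \<phi> (x - y) * u x)"
      by (intro Bochner_Integration.integrable_diff i2 integrable_mult_left i1)
    show "integrable lborel (\<lambda>y. \<phi> (x - y) * \<epsilon>)" by (intro integrable_mult_left i1)
    fix y
    show "\<bar>\<phi> (x - y) * u y - \<phi> (x - y) * u x\<bar> \<le> \<phi> (x - y) * \<epsilon>"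
    proof (cases "dist x y \<le> r")
      case True
      have "\<bar>\<phi> (x - y) * u y - \<phi> (x - y) * u x\<bar> = \<phi> (x - y) * \<bar>u y - u x\<bar>"
        using \<phi>0[of "x - y"] by (simp add: abs_mult flip: right_diff_distrib)
      then show ?thesis using mult_left_mono[OF cl[OF True] \<phi>0[of "x - y"]] by simp
    qed (simp add: \<phi>s dist_norm)
  qed
  then show ?thesis using one by simp
qed

lemma usc_on_subset: "usc_on A w \<Longrightarrow> B \<subseteq> A \<Longrightarrow> usc_on B w"
  unfolding usc_on_def by (auto intro: filter_leD[OF at_le])

lemma lsc_on_subset: "lsc_on A w \<Longrightarrow> B \<subseteq> A \<Longrightarrow> lsc_on B w"
  unfolding lsc_on_def by (auto intro: filter_leD[OF at_le])

lemma usc_on_open_nhd: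
  assumes "usc_on A w" "z \<in> A" "w z < c"
  obtains G where "open G" "z \<in> G" "\<And>y. y \<in> G \<Longrightarrow> y \<in> A \<Longrightarrow> w y < c"
proof -
  have "\<forall>\<^sub>F y in at z within A. w y < c" using assms by (simp add: usc_on_def)
  then obtain G where "open G" "z \<in> G" "\<forall>y\<in>G. y \<noteq> z \<longrightarrow> y \<in> A \<longrightarrow> w y < c"
    unfolding eventually_at_topological by blast
  then show ?thesis using assms(3) by (intro that[of G]) auto
qed

lemma usc_attains_max:
  fixes w :: "'a::topological_space \<Rightarrow> 'b::linorder"
  assumes K: "compact K" "K \<noteq> {}" and w: "usc_on K w"
  obtains x where "x \<in> K" "\<And>y. y \<in> K \<Longrightarrow> w y \<le> w x"
proof (rule ccontr)
  note attained = that
  assume no: "\<not> thesis"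
  have "\<exists>y\<in>K. \<exists>G. open G \<and> x \<in> G \<and> (\<forall>z\<in>G \<inter> K. w z < w y)" if "x \<in> K" for x
  proof -
    obtain y where y: "y \<in> K" "w x < w y" using no attained[OF \<open>x \<in> K\<close>] by (meson not_le)
    obtain G where "open G" "x \<in> G" "\<And>z. z \<in> G \<Longrightarrow> z \<in> K \<Longrightarrow> w z < w y"
      using usc_on_open_nhd[OF w \<open>x \<in> K\<close> y(2)] by blast
    then show ?thesis using y by blast
  qed
  then obtain Y N where Y: "\<And>x. x \<in> K \<Longrightarrow> Y x \<in> K"
    and N: "\<And>x. x \<in> K \<Longrightarrow> open (N x) \<and> x \<in> N x \<and> (\<forall>z\<in>N x \<inter> K. w z < w (Y x))" by metis
  have "K \<subseteq> (\<Union>x\<in>K. N x)" using N by blast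
  then obtain C where C: "C \<subseteq> K" "finite C" "K \<subseteq> (\<Union>x\<in>C. N x)"
    using compactE_image[OF K(1), of K N] N by metis
  have "C \<noteq> {}" using C K by auto
  then have "Max ((\<lambda>x. w (Y x)) ` C) \<in> (\<lambda>x. w (Y x)) ` C" using C(2) by (intro Max_in) auto
  then obtain m where m: "m \<in> C" "w (Y m) = Max ((\<lambda>x. w (Y x)) ` C)" by auto
  have mx: "w (Y x) \<le> w (Y m)" if "x \<in> C" for x unfolding m(2) using that C(2) by (intro Max_ge) auto
  have "Y m \<in> K" using Y m C by blast
  then obtain x where x: "x \<in> C" "Y m \<in> N x" using C by blast
  then have "w (Y m) < w (Y x)" using N C \<open>Y m \<in> K\<close> by blast
  then show False using mx[OF x(1)] by simp
qed

definition sup_convolution :: "'a::metric_space set \<Rightarrow> ('a \<Rightarrow> real) \<Rightarrow> real \<Rightarrow> 'a \<Rightarrow> real" where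
  "sup_convolution A w k x = (SUP y\<in>A. w y - k * (dist x y)\<^sup>2)"

lemma
  assumes B: "\<And>y. y \<in> A \<Longrightarrow> \<bar>w y\<bar> \<le> B" and k: "k \<ge> 0"
  shows sup_convolution_ge: "y \<in> A \<Longrightarrow> w y - k * (dist x y)\<^sup>2 \<le> sup_convolution A w k x"
    and sup_convolution_le: "A \<noteq> {} \<Longrightarrow> (\<And>y. y \<in> A \<Longrightarrow> w y - k * (dist x y)\<^sup>2 \<le> m) \<Longrightarrow> sup_convolution A w k x \<le> m"
proof -
  have "bdd_above ((\<lambda>y. w y - k * (dist x y)\<^sup>2) ` A)"
  proof (rule bdd_aboveI2)
    fix y assume "y \<in> A"
    moreover have "0 \<le> k * (dist x y)\<^sup>2" using k by simp
    ultimately show "w y - k * (dist x y)\<^sup>2 \<le> B" using B[of y] by linarith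
  qed
  then show "y \<in> A \<Longrightarrow> w y - k * (dist x y)\<^sup>2 \<le> sup_convolution A w k x"
    unfolding sup_convolution_def by (rule cSUP_upper2) auto
  show "A \<noteq> {} \<Longrightarrow> (\<And>y. y \<in> A \<Longrightarrow> w y - k * (dist x y)\<^sup>2 \<le> m) \<Longrightarrow> sup_convolution A w k x \<le> m"
    unfolding sup_convolution_def by (rule cSUP_least)
qed

lemma sup_convolution_continuous:
  fixes w :: "'a::real_normed_vector \<Rightarrow> real"
  assumes B: "\<And>y. y \<in> A \<Longrightarrow> \<bar>w y\<bar> \<le> B" and k: "k \<ge> 0" and ne: "A \<noteq> {}"
    and D: "\<And>y. y \<in> A \<Longrightarrow> norm y \<le> D"
  shows "continuous_on UNIV (sup_convolution A w k)"
proof -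
  let ?s = "sup_convolution A w k"
  have one: "?s x \<le> ?s x' + k * dist x x' * (2 * (norm x + D) + dist x x')" for x x'
  proof (rule sup_convolution_le[where A = A and w = w and B = B, OF B k ne])
    fix y assume y: "y \<in> A"
    have d: "dist x' y \<le> dist x y + dist x x'" by (metis dist_commute dist_triangle add.commute)
    have dxy: "dist x y \<le> norm x + D" using D[OF y] by (metis add_left_mono dist_norm norm_triangle_ineq4 order.trans)
    have "(dist x' y)\<^sup>2 \<le> (dist x y + dist x x')\<^sup>2" using d by (intro power_mono) auto
    also have "\<dots> = (dist x y)\<^sup>2 + dist x x' * (2 * dist x y + dist x x')" by (simp add: power2_eq_square algebra_simps)
    also have "\<dots> \<le> (dist x y)\<^sup>2 + dist x x' * (2 * (norm x + D) + dist x x')"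
      using dxy by (intro add_left_mono mult_left_mono) auto
    finally have "k * (dist x' y)\<^sup>2 \<le> k * ((dist x y)\<^sup>2 + dist x x' * (2 * (norm x + D) + dist x x'))"
      by (rule mult_left_mono[OF _ k])
    also have "\<dots> = k * (dist x y)\<^sup>2 + k * dist x x' * (2 * (norm x + D) + dist x x')"
      by (simp only: distrib_left mult.assoc)
    finally have "k * (dist x' y)\<^sup>2 \<le> k * (dist x y)\<^sup>2 + k * dist x x' * (2 * (norm x + D) + dist x x')" .
    then show "w y - k * (dist x y)\<^sup>2 \<le> ?s x' + k * dist x x' * (2 * (norm x + D) + dist x x')"
      using sup_convolution_ge[where A = A and w = w and B = B and k = k and x = x' and y = y, OF B k y] by linarith
  qed
  have "isCont ?s x" for x
  proof -
    define g where "g = (\<lambda>x'. k * dist x x' * (2 * (norm x + D) + dist x x') + k * dist x' x * (2 * (norm x' + D) + dist x' x))"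
    have "(g \<longlongrightarrow> g x) (at x)" unfolding g_def by (intro tendsto_intros)
    then have g: "(g \<longlongrightarrow> 0) (at x)" by (simp add: g_def)
    obtain y0 where "y0 \<in> A" using ne by blast
    then have D0: "D \<ge> 0" using D[of y0] norm_ge_zero[of y0] by linarith
    have "\<bar>?s x' - ?s x\<bar> \<le> g x'" for x'
    proof -
      have "0 \<le> k * dist x x' * (2 * (norm x + D) + dist x x')" "0 \<le> k * dist x' x * (2 * (norm x' + D) + dist x' x)"
        using k D0 by (intro mult_nonneg_nonneg; simp)+
      then show ?thesis using one[of x x'] one[of x' x] unfolding g_def by linarith
    qed
    then have "((\<lambda>x'. ?s x' - ?s x) \<longlongrightarrow> 0) (at x)"
      by (intro Lim_null_comparison[OF _ g] always_eventually) simp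
    then show ?thesis unfolding isCont_def using LIM_zero_cancel by blast
  qed
  then show ?thesis by (simp add: continuous_at_imp_continuous_on)
qed

lemma usc_on_diff_continuous:
  fixes w g :: "'a::topological_space \<Rightarrow> real"
  assumes w: "usc_on A w" and g: "continuous_on A g"
  shows "usc_on A (\<lambda>x. w x - g x)"
  unfolding usc_on_def
proof (intro ballI allI impI)
  fix z c assume z: "z \<in> A" and c: "w z - g z < c"
  define e where "e = (c - (w z - g z)) / 2"
  have e: "e > 0" using c by (simp add: e_def)
  have "\<forall>\<^sub>F y in at z within A. w y < w z + e" using w z e by (simp add: usc_on_def)
  moreover have "(g \<longlongrightarrow> g z) (at z within A)" using g z by (simp add: continuous_on_def)
  then have "\<forall>\<^sub>F y in at z within A. dist (g y) (g z) < e" using e by (rule tendstoD)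
  ultimately show "\<forall>\<^sub>F y in at z within A. w y - g y < c"
  proof eventually_elim
    case (elim y)
    then have "w y < w z + e" "g z - g y < e" by (auto simp: dist_real_def)
    moreover have "2 * e = c - (w z - g z)" by (simp add: e_def)
    ultimately show ?case by linarith
  qed
qed

text \<open>
  A point farther than \<open>d\<close> from \<open>x\<close> is penalized by more than the oscillation of \<open>w\<close>.
\<close>

lemma sup_convolution_attained:
  fixes w :: "'a::euclidean_space \<Rightarrow> real"
  assumes B: "\<And>y. y \<in> A \<Longrightarrow> \<bar>w y\<bar> \<le> B" and k: "k \<ge> 0" and w: "usc_on A w"
    and d: "cball x d \<subseteq> A" "d > 0" "2 * B < k * d\<^sup>2"
  obtains y where "y \<in> cball x d" "sup_convolution A w k x = w y - k * (dist x y)\<^sup>2"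
proof -
  have ne: "cball x d \<noteq> {}" using d(2) by auto
  have usc: "usc_on (cball x d) (\<lambda>y. w y - k * (dist x y)\<^sup>2)"
    by (rule usc_on_diff_continuous[OF usc_on_subset[OF w d(1)]]) (intro continuous_intros)
  obtain y where y: "y \<in> cball x d" "\<And>y'. y' \<in> cball x d \<Longrightarrow> w y' - k * (dist x y')\<^sup>2 \<le> w y - k * (dist x y)\<^sup>2"
    by (rule usc_attains_max[OF compact_cball ne usc]) (use that in blast)
  have x: "x \<in> A" "x \<in> cball x d" using d by auto
  have "sup_convolution A w k x \<le> w y - k * (dist x y)\<^sup>2"
  proof (rule sup_convolution_le[where A = A and w = w and B = B, OF B k])
    fix y' assume y': "y' \<in> A"
    show "w y' - k * (dist x y')\<^sup>2 \<le> w y - k * (dist x y)\<^sup>2"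
    proof (cases "y' \<in> cball x d")
      case False
      then have "k * d\<^sup>2 \<le> k * (dist x y')\<^sup>2" using d k by (intro mult_left_mono power_mono) auto
      moreover have "w x \<le> w y - k * (dist x y)\<^sup>2" using y(2)[OF x(2)] by simp
      ultimately show ?thesis using B[OF y'] B[OF x(1)] d(3) by linarith
    qed (rule y(2))
  qed (use x in auto)
  moreover have "w y - k * (dist x y)\<^sup>2 \<le> sup_convolution A w k x"
    by (rule sup_convolution_ge[where A = A and w = w and B = B, OF B k]) (use y d in auto)
  ultimately show ?thesis using that[OF y(1)] by simp
qed

section \<open>Mollified subsolutions of the concave equation\<close>

lemma hform_hessian:
  fixes q :: "complex ^ 'n \<Rightarrow> real"
  assumes "C2w U q D D2" "open U" "z \<in> U"
  shows "hform (complex_hessian q z) x =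
     (D2 z (cnjv x) (cnjv x) + D2 z (\<i> *s cnjv x) (\<i> *s cnjv x)) / 4"
  using complex_hessian_form[OF assms, of x] by (simp add: hform_def herm_def matrix_vector_mult_def)

lemma hform_hessian_add:
  fixes q p :: "complex ^ 'n \<Rightarrow> real"
  assumes q: "C2w U q D D2" and p: "C2w U p E E2" and U: "open U" "z \<in> U"
  shows "hform (complex_hessian (\<lambda>z. q z + p z) z) x = hform (complex_hessian q z) x + hform (complex_hessian p z) x"
  unfolding hform_hessian[OF q U] hform_hessian[OF p U] hform_hessian[OF C2w_add[OF q p] U]
  by (simp add: plus_blinfun.rep_eq field_simps)

lemma hform_hessian_scale:
  fixes q :: "complex ^ 'n \<Rightarrow> real"
  assumes q: "C2w U q D D2" and U: "open U" "z \<in> U"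
  shows "hform (complex_hessian (\<lambda>z. c * q z) z) x = c * hform (complex_hessian q z) x"
  unfolding hform_hessian[OF q U] hform_hessian[OF C2w_scale[OF q] U]
  by (simp add: scaleR_blinfun.rep_eq field_simps)

lemma hessian_translate:
  fixes q :: "complex ^ 'n \<Rightarrow> real"
  assumes q: "C2w U q D D2" and U: "open U" "w + y \<in> U"
  shows "complex_hessian (\<lambda>z. q (w + z) + k) y = complex_hessian q (w + y)"
proof -
  define V where "V = (\<lambda>z. w + z) -` U"
  have V: "open V" unfolding V_def by (intro open_vimage U continuous_intros)
  have yV: "y \<in> V" using U by (simp add: V_def)
  have "C2w V (\<lambda>x. q (w + id_blinfun x)) (\<lambda>x. D (w + id_blinfun x) o\<^sub>L id_blinfun)
      (\<lambda>x. (precomp id_blinfun o\<^sub>L D2 (w + id_blinfun x)) o\<^sub>L id_blinfun)"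
    by (rule C2w_affine[OF q]) (simp add: V_def)
  from complex_hessian_eq[OF C2w_add[OF this C2w_const[of _ k]] V yV]
  show ?thesis
    unfolding vec_eq_iff complex_hessian_eq[OF q U]
    by (simp add: plus_blinfun.rep_eq precomp_apply)
qed

lemma norm_cnjv: "inner (cnjv x) (cnjv x) = inner x x"
  by (simp add: cnjv_def inner_vec_def inner_complex_def)

lemma inner_i_smult: "inner (\<i> *s x) (\<i> *s x) = inner x (x :: complex ^ 'n)"
  by (simp add: inner_vec_def inner_complex_def add.commute)

lemma paraboloid_C2w:
  fixes R k :: real
  obtains D :: "'a::euclidean_space \<Rightarrow> 'a \<Rightarrow>\<^sub>L real" and D2 :: "'a::euclidean_space \<Rightarrow> 'a \<Rightarrow>\<^sub>L 'a \<Rightarrow>\<^sub>L real"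
  where "C2w UNIV (\<lambda>x::'a. R * (x \<bullet> x) + k) D D2" "\<And>x h l. D2 x h l = 2 * R * (h \<bullet> l)"
proof -
  have h1: "((\<lambda>s. R * s + k) has_real_derivative R) (at s)" for s
    by (auto intro!: derivative_eq_intros)
  have h2: "((\<lambda>s. R) has_real_derivative 0) (at s)" for s by simp
  note C = C2w_radial[OF h1 h2 continuous_on_const, where 'a = 'a]
  show ?thesis
    by (rule that[OF C], unfold C2w_radial_apply) simp
qed

lemma hessian_paraboloid:
  fixes x z :: "complex ^ 'n"
  shows "hform (complex_hessian (\<lambda>z. R * (z \<bullet> z) + k) z) x = R * (x \<bullet> x)"
proof -
  obtain D :: "complex ^ 'n \<Rightarrow> (complex ^ 'n) \<Rightarrow>\<^sub>L real" and D2 where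
    C: "C2w UNIV (\<lambda>x::complex ^ 'n. R * (x \<bullet> x) + k) D D2" and e: "\<And>x h l. D2 x h l = 2 * R * (h \<bullet> l)"
    by (rule paraboloid_C2w[where 'a = "complex ^ 'n", of R k]) (use that in blast)
  show ?thesis
    unfolding hform_hessian[OF C open_UNIV UNIV_I] e by (simp add: norm_cnjv inner_i_smult)
qed

lemma shifted_paraboloid_C2w:
  fixes z0 :: "complex ^ 'n"
  obtains D D2 where "C2w UNIV (\<lambda>z. \<kappa> * ((z - z0) \<bullet> (z - z0))) D D2"
    "\<And>z x. hform (complex_hessian (\<lambda>z. \<kappa> * ((z - z0) \<bullet> (z - z0))) z) x = \<kappa> * (x \<bullet> x)"
proof -
  obtain D :: "complex ^ 'n \<Rightarrow> (complex ^ 'n) \<Rightarrow>\<^sub>L real" and D2 where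
    C: "C2w UNIV (\<lambda>x::complex ^ 'n. \<kappa> * (x \<bullet> x) + 0) D D2" and e: "\<And>x h l. D2 x h l = 2 * \<kappa> * (h \<bullet> l)"
    by (rule paraboloid_C2w[where 'a = "complex ^ 'n", of \<kappa> 0]) (use that in blast)
  from C2w_affine[OF C, of UNIV "- z0" id_blinfun]
  have C': "C2w UNIV (\<lambda>z. \<kappa> * ((z - z0) \<bullet> (z - z0))) (\<lambda>x. D (- z0 + id_blinfun x) o\<^sub>L id_blinfun)
      (\<lambda>x. (precomp id_blinfun o\<^sub>L D2 (- z0 + id_blinfun x)) o\<^sub>L id_blinfun)"
    by simp
  have "hform (complex_hessian (\<lambda>z. \<kappa> * ((z - z0) \<bullet> (z - z0))) z) x = \<kappa> * (x \<bullet> x)" for z x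
    using hessian_translate[where w = "- z0" and y = z and k = 0, OF C open_UNIV UNIV_I] hessian_paraboloid[of \<kappa> 0 "- z0 + z" x]
    by simp
  with C' show ?thesis by (rule that)
qed

lemma hessian_mono_touch:
  fixes q p :: "complex ^ 'n \<Rightarrow> real"
  assumes q: "C2w U q D D2" and p: "C2w U p E E2" and U: "open U" "z \<in> U"
    and eq: "q z = p z" and le: "\<forall>\<^sub>F y in nhds z. q y \<le> p y"
  shows "hform (complex_hessian q z) x \<le> hform (complex_hessian p z) x"
  unfolding hform_hessian[OF q U] hform_hessian[OF p U]
  using C2w_mono_touch[OF q p U eq le] by (simp add: add_mono)

lemma hessian_continuous:
  fixes q :: "complex ^ 'n \<Rightarrow> real"
  assumes q: "C2w U q D D2" and U: "open U"
  shows "continuous_on U (\<lambda>z. diag_in V (complex_hessian q z))"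
proof -
  have c: "continuous_on U D2" using q by (simp add: C2w_def)
  have "continuous_on U (\<lambda>z. hform (complex_hessian q z) x)" for x
  proof (rule continuous_on_eq)
    show "continuous_on U (\<lambda>z. (D2 z (cnjv x) (cnjv x) + D2 z (\<i> *s cnjv x) (\<i> *s cnjv x)) / 4)"
      by (intro continuous_intros c) auto
  qed (simp add: hform_hessian[OF q U])
  then show ?thesis unfolding diag_in_def by (intro continuous_on_vec_lambda)
qed

lemma sum_Basis_complex_vec:
  fixes g :: "complex ^ 'n \<Rightarrow> 'b::comm_monoid_add"
  shows "(\<Sum>e\<in>Basis. g e) = (\<Sum>i\<in>UNIV. g (axis i 1) + g (axis i \<i>))"
proof -
  have B: "(Basis :: (complex ^ 'n) set) = (\<lambda>(i, u). axis i u) ` (UNIV \<times> {1, \<i>})"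
    by (auto simp: Basis_vec_def Basis_complex_def)
  have "inj_on (\<lambda>(i, u). axis i u :: complex ^ 'n) (UNIV \<times> {1, \<i>})"
    by (auto simp: inj_on_def axis_eq_axis)
  then have "(\<Sum>e\<in>Basis. g e) = (\<Sum>(i, u)\<in>UNIV \<times> {1, \<i>}. g (axis i u))"
    unfolding B by (subst sum.reindex) (auto simp: o_def split_beta)
  also have "\<dots> = (\<Sum>i\<in>UNIV. \<Sum>u\<in>{1, \<i>}. g (axis i u))" by (rule sum.cartesian_product[symmetric])
  finally show ?thesis by simp
qed

lemma matrix_vector_mult_bounded_linear:
  fixes A :: "complex ^ 'n ^ 'm"
  shows "bounded_linear (\<lambda>x. A *v x)"
  unfolding linear_conv_bounded_linear[symmetric]
proof (rule linearI)
  show "A *v (x + y) = A *v x + A *v y" for x y by (rule matrix_vector_right_distrib)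
  show "A *v (t *\<^sub>R x) = t *\<^sub>R (A *v x)" for t x
    by (simp add: vec_eq_iff matrix_vector_mult_def scaleR_sum_right)
qed

text \<open>
  The square roots of the weights are split evenly over the two real directions of each complex coordinate; the
  factor \<open>1 / 2\<close> accounts for the \<open>1 / 4\<close> in the formula for the complex Hessian.
\<close>

lemma unitary_frame_map:
  fixes U :: "complex ^ 'n ^ 'n" and a :: "real ^ 'n"
  assumes U: "unitary_matrix U" and a: "\<And>i. a $ i > 0"
  obtains T S :: "(complex ^ 'n) \<Rightarrow>\<^sub>L (complex ^ 'n)" where
    "\<And>x. S (T x) = x" "\<And>x. T (S x) = x"
    "\<And>i. T (axis i 1) = (sqrt (a $ i) / 2) *\<^sub>R cnjv (column i U)"
    "\<And>i. T (axis i \<i>) = (sqrt (a $ i) / 2) *\<^sub>R (\<i> *s cnjv (column i U))"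
proof -
  define c where "c = (\<lambda>i. complex_of_real (sqrt (a $ i) / 2))"
  have c: "c i \<noteq> 0" for i using a[of i] by (simp add: c_def)
  define A :: "complex ^ 'n ^ 'n" where "A = (\<chi> k i. c i * cnj (U $ k $ i))"
  define B :: "complex ^ 'n ^ 'n" where "B = (\<chi> i k. U $ k $ i / c i)"
  have "(B ** A) $ i $ j = mat 1 $ i $ j" for i j
  proof -
    have "(B ** A) $ i $ j = (c j / c i) * herm (column j U) (column i U)"
      by (simp add: matrix_matrix_mult_def A_def B_def herm_def column_def sum_distrib_left mult_ac)
    then show ?thesis using U c by (simp add: unitary_matrix_def mat_def)
  qed
  then have BA: "B ** A = mat 1" by (simp add: vec_eq_iff)
  then have AB: "A ** B = mat 1" by (rule matrix_left_right_inverse1)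
  define T where "T = Blinfun (\<lambda>x. A *v x)"
  define S where "S = Blinfun (\<lambda>x. B *v x)"
  have T: "T x = A *v x" and S: "S x = B *v x" for x
    unfolding T_def S_def by (simp_all add: bounded_linear_Blinfun_apply matrix_vector_mult_bounded_linear)
  have ax: "(A *v axis i u) $ k = u * (c i * cnj (U $ k $ i))" for i u k
    by (simp add: matrix_vector_mult_def A_def axis_def if_distrib if_distribR cong: if_cong)
  show ?thesis
  proof (rule that[of S T])
    show "S (T x) = x" "T (S x) = x" for x by (simp_all add: T S matrix_vector_mul_assoc BA AB)
    show "T (axis i 1) = (sqrt (a $ i) / 2) *\<^sub>R cnjv (column i U)" for i
      by (simp add: T vec_eq_iff ax cnjv_def column_def c_def scaleR_conv_of_real[where 'a = complex])
    show "T (axis i \<i>) = (sqrt (a $ i) / 2) *\<^sub>R (\<i> *s cnjv (column i U))" for i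
      by (simp add: T vec_eq_iff ax cnjv_def column_def c_def scaleR_conv_of_real[where 'a = complex])
  qed
qed

text \<open>
  Membership of the diagonal in \<open>level c\<close> is tested on half-spaces with positive normal \<open>w\<close>. For fixed \<open>U\<close> and
  \<open>w\<close> the test is a linear inequality with constant coefficients, and the same mollification serves all of
  them.
\<close>

theorem (in admissible) mollified_subsolution:
  fixes u \<phi> :: "complex ^ 'n \<Rightarrow> real"
  assumes u: "continuous_on UNIV u" and u0: "\<And>x. norm x > R \<Longrightarrow> u x = 0"
    and C\<phi>: "C2w UNIV \<phi> D\<phi> D2\<phi>" and \<phi>0: "\<And>x. \<phi> x \<ge> 0" and \<phi>s: "\<And>x. norm x > r \<Longrightarrow> \<phi> x = 0"
    and \<phi>1: "(LINT x|lborel. \<phi> x) = 1" and box: "cball 0 R \<subseteq> cbox a b" and r: "r < r'"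
    and ne: "level c \<noteq> {}"
    and tst: "\<And>x V q D D2. x \<in> ball z0 r' \<Longrightarrow> open V \<Longrightarrow> x \<in> V \<Longrightarrow> C2w V q D D2 \<Longrightarrow> q x = u x \<Longrightarrow>
        (\<forall>\<^sub>F y in nhds x. u y \<le> q y) \<Longrightarrow> spectral_in (level c) (complex_hessian q x)"
  shows "spectral_in (level c) (complex_hessian (convolve a b \<phi> u) z0)"
  unfolding spectral_in_def
proof (intro conjI allI impI)
  note CJ = convolve_C2w[OF C\<phi> u, of a b]
  show "complex_hessian (convolve a b \<phi> u) z0 \<in> hermitian_matrices"
    by (rule complex_hessian_hermitian[OF CJ open_UNIV UNIV_I])
  fix U :: "complex ^ 'n ^ 'n" assume U: "unitary_matrix U"
  show "diag_in U (complex_hessian (convolve a b \<phi> u) z0) \<in> level c"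
  proof (rule level_halfspaces[OF ne])
    fix w :: "real ^ 'n" and m
    assume w: "\<And>i. w $ i > 0" and m: "\<And>y. y \<in> level c \<Longrightarrow> m \<le> inner w y"
    obtain T S :: "(complex ^ 'n) \<Rightarrow>\<^sub>L (complex ^ 'n)" where ST: "\<And>x. S (T x) = x" "\<And>x. T (S x) = x"
      and T1: "\<And>i. T (axis i 1) = (sqrt (w $ i) / 2) *\<^sub>R cnjv (column i U)"
      and T2: "\<And>i. T (axis i \<i>) = (sqrt (w $ i) / 2) *\<^sub>R (\<i> *s cnjv (column i U))"
      by (rule unitary_frame_map[OF U w]) (use that in blast)
    have tr: "(\<Sum>e\<in>Basis. blinfun_apply (blinfun_apply (D2 x) (T e)) (T e)) = inner w (diag_in U (complex_hessian q x))"
      if C: "C2w V q D D2" and V: "open V" "x \<in> V" for V q D D2 x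
    proof -
      have sq: "sqrt (w $ i) / 2 * (sqrt (w $ i) / 2 * t) = w $ i * t / 4" for i t
        using w[of i] by (simp add: mult.assoc[symmetric])
      show ?thesis
        unfolding sum_Basis_complex_vec T1 T2
        by (simp only: blinfun.scaleR_left blinfun.scaleR_right real_scaleR_def sq)
           (simp add: inner_vec_def diag_in_def hform_hessian[OF C V] add_divide_distrib[symmetric] distrib_left)
    qed
    have "m \<le> (\<Sum>e\<in>Basis. blinfun_apply (blinfun_apply (convolve a b D2\<phi> u z0) (T e)) (T e))"
    proof (rule mollified_linear_subsolution[OF ST u u0 C\<phi> \<phi>0 \<phi>s \<phi>1 box r])
      fix x V q D D2
      assume *: "x \<in> ball z0 r'" "open V" "x \<in> V" "C2w V q D D2" "q x = u x" "\<forall>\<^sub>F y in nhds x. u y \<le> q y"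
      from tst[OF *] have "diag_in U (complex_hessian q x) \<in> level c" using U by (simp add: spectral_in_def)
      then show "m \<le> (\<Sum>e\<in>Basis. blinfun_apply (blinfun_apply (D2 x) (T e)) (T e))"
        unfolding tr[OF *(4,2,3)] by (rule m)
    qed
    then show "m \<le> inner w (diag_in U (complex_hessian (convolve a b \<phi> u) z0))"
      unfolding tr[OF CJ open_UNIV UNIV_I] .
  qed
qed

section \<open>Semicontinuous regularizations\<close>

lemma usc_reg_less:
  assumes "usc_reg A u z < c"
  obtains r where "r > 0" "(SUP y\<in>ball z r \<inter> A. u y) < c"
  using assms unfolding usc_reg_def INF_less_iff by auto

lemma usc_reg_le:
  assumes "r > 0" "\<And>y. y \<in> ball z r \<Longrightarrow> y \<in> A \<Longrightarrow> u y \<le> c"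
  shows "usc_reg A u z \<le> c"
  unfolding usc_reg_def
  by (rule INF_lower2[of r]) (use assms in \<open>auto intro!: SUP_least\<close>)

lemma usc_reg_ge: "z \<in> A \<Longrightarrow> u z \<le> usc_reg A u z"
  unfolding usc_reg_def by (intro INF_greatest SUP_upper) auto

lemma usc_reg_approx:
  assumes "c < usc_reg A u z" "r > 0"
  obtains y where "y \<in> ball z r" "y \<in> A" "c < u y"
proof -
  have "usc_reg A u z \<le> (SUP y\<in>ball z r \<inter> A. u y)"
    unfolding usc_reg_def by (rule INF_lower) (use assms in auto)
  then have "c < (SUP y\<in>ball z r \<inter> A. u y)" using assms(1) by simp
  then show ?thesis unfolding less_SUP_iff using that by auto
qed

lemma usc_on_usc_reg: "usc_on A (usc_reg A u)"
  unfolding usc_on_def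
proof (intro ballI allI impI)
  fix z c assume "z \<in> A" and c: "usc_reg A u z < c"
  obtain r where r: "r > 0" "(SUP y\<in>ball z r \<inter> A. u y) < c" by (rule usc_reg_less[OF c])
  have "usc_reg A u y < c" if y: "dist y z < r / 2" for y
  proof -
    have "usc_reg A u y \<le> (SUP y\<in>ball z r \<inter> A. u y)"
    proof (rule usc_reg_le)
      fix x assume x: "x \<in> ball y (r / 2)" "x \<in> A"
      have "dist z x \<le> dist y z + dist y x" by (metis dist_commute dist_triangle)
      then have "x \<in> ball z r" using x(1) y by simp
      then show "u x \<le> (SUP y\<in>ball z r \<inter> A. u y)" using x by (intro SUP_upper) auto
    qed (use r in simp)
    then show ?thesis using r(2) by simp
  qed
  then show "\<forall>\<^sub>F y in at z within A. usc_reg A u y < c"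
    unfolding eventually_at using r(1) by (intro exI[of _ "r / 2"]) auto
qed

lemma lsc_reg_greater:
  assumes "c < lsc_reg A u z"
  obtains r where "r > 0" "c < (INF y\<in>ball z r \<inter> A. u y)"
  using assms unfolding lsc_reg_def less_SUP_iff by auto

lemma lsc_reg_ge:
  assumes "r > 0" "\<And>y. y \<in> ball z r \<Longrightarrow> y \<in> A \<Longrightarrow> c \<le> u y"
  shows "c \<le> lsc_reg A u z"
  unfolding lsc_reg_def
  by (rule SUP_upper2[of r]) (use assms in \<open>auto intro!: INF_greatest\<close>)

lemma lsc_reg_le: "z \<in> A \<Longrightarrow> lsc_reg A u z \<le> u z"
  unfolding lsc_reg_def by (intro SUP_least INF_lower) auto

lemma lsc_on_lsc_reg: "lsc_on A (lsc_reg A u)"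
  unfolding lsc_on_def
proof (intro ballI allI impI)
  fix z c assume "z \<in> A" and c: "c < lsc_reg A u z"
  obtain r where r: "r > 0" "c < (INF y\<in>ball z r \<inter> A. u y)" by (rule lsc_reg_greater[OF c])
  have "c < lsc_reg A u y" if y: "dist y z < r / 2" for y
  proof -
    have "(INF y\<in>ball z r \<inter> A. u y) \<le> lsc_reg A u y"
    proof (rule lsc_reg_ge)
      fix x assume x: "x \<in> ball y (r / 2)" "x \<in> A"
      have "dist z x \<le> dist y z + dist y x" by (metis dist_commute dist_triangle)
      then have "x \<in> ball z r" using x(1) y by simp
      then show "(INF y\<in>ball z r \<inter> A. u y) \<le> u x" using x by (intro INF_lower) auto
    qed (use r in simp)
    then show ?thesis using r(2) by simp
  qed
  then show "\<forall>\<^sub>F y in at z within A. c < lsc_reg A u y"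
    unfolding eventually_at using r(1) by (intro exI[of _ "r / 2"]) auto
qed

lemma usc_on_ereal_diff_continuous:
  fixes w :: "'a::topological_space \<Rightarrow> ereal" and g :: "'a \<Rightarrow> real"
  assumes w: "usc_on A w" and g: "continuous_on A g"
  shows "usc_on A (\<lambda>x. w x - ereal (g x))"
  unfolding usc_on_def
proof (intro ballI allI impI)
  fix z c assume z: "z \<in> A" and c: "w z - ereal (g z) < c"
  obtain b where b: "w z - ereal (g z) < ereal b" "ereal b < c" using ereal_dense2[OF c] by blast
  obtain a where a: "w z - ereal (g z) < ereal a" "ereal a < ereal b" using ereal_dense2[OF b(1)] by blast
  have "w z < ereal (a + g z)" using a(1) by (cases "w z") auto
  then have "\<forall>\<^sub>F y in at z within A. w y < ereal (a + g z)" using w z by (simp add: usc_on_def)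
  moreover have "(g \<longlongrightarrow> g z) (at z within A)" using g z by (simp add: continuous_on_def)
  then have "\<forall>\<^sub>F y in at z within A. dist (g y) (g z) < b - a" by (rule tendstoD) (use a(2) in simp)
  ultimately show "\<forall>\<^sub>F y in at z within A. w y - ereal (g y) < c"
  proof eventually_elim
    case (elim y)
    have "w y - ereal (g y) < ereal b"
      using elim by (cases "w y") (auto simp: dist_real_def)
    then show ?case using b(2) by (rule less_trans)
  qed
qed

section \<open>The Perron problem\<close>

context admissible
begin

lemma level_antimono: "c' \<le> c \<Longrightarrow> level c \<subseteq> level c'"
  by (auto simp: level_def)

lemma spectral_in_level_antimono: "spectral_in (level c) H \<Longrightarrow> c' \<le> c \<Longrightarrow> spectral_in (level c') H"
  using level_antimono unfolding spectral_in_def by blast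

lemma spectral_in_touch:
  fixes q p :: "complex ^ 'n \<Rightarrow> real"
  assumes p: "C2w V p E E2" "open V" "z \<in> V" and q: "C2w U q D D2" "open U" "z \<in> U"
    and eq: "p z = q z" and le: "\<forall>\<^sub>F y in nhds z. p y \<le> q y"
    and s: "spectral_in (level c) (complex_hessian p z)"
  shows "spectral_in (level c) (complex_hessian q z)"
proof (rule spectral_in_level_mono[OF s])
  have o: "open (U \<inter> V)" "z \<in> U \<inter> V" using p q by auto
  show "hform (complex_hessian p z) x \<le> hform (complex_hessian q z) x" for x
    by (rule hessian_mono_touch[OF C2w_subset[OF p(1)] C2w_subset[OF q(1)] o eq le]) auto
  show "complex_hessian q z \<in> hermitian_matrices" by (rule complex_hessian_hermitian[OF q])
qed

end

locale perron = admissible \<Gamma> f for \<Gamma> :: "(real ^ 'n) set" and f :: "real ^ 'n \<Rightarrow> real" +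
  fixes \<Omega> :: "(complex ^ 'n) set" and \<psi> :: "complex ^ 'n \<Rightarrow> real \<Rightarrow> real"
    and v :: "complex ^ 'n \<Rightarrow> real" and L :: ereal
  assumes \<Omega>: "open \<Omega>" "\<Omega> \<noteq> {}" "bounded \<Omega>"
    and \<psi>_continuous: "continuous_on (closure \<Omega> \<times> UNIV) (\<lambda>(z, t). \<psi> z t)"
    and \<psi>_nonneg: "\<And>z t. z \<in> closure \<Omega> \<Longrightarrow> \<psi> z t \<ge> 0"
    and \<psi>_mono: "\<And>z. z \<in> closure \<Omega> \<Longrightarrow> mono (\<psi> z)"
    and v_bounded: "bounded (v ` closure \<Omega>)" and v_lsc: "lsc_on (closure \<Omega>) v"
    and v_super: "viscosity_supersolution \<Omega> (F_op \<Gamma> f) \<psi> (\<lambda>z. ereal (v z))"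
    and v_boundary: "\<And>\<zeta>. \<zeta> \<in> frontier \<Omega> \<Longrightarrow> (v \<longlongrightarrow> v \<zeta>) (at \<zeta> within \<Omega>)"
    and f_limit: "((\<lambda>R. ereal (f (\<chi> i. R))) \<longlongrightarrow> L) at_top"
    and f_large: "L > (SUP z\<in>\<Omega>. ereal (\<psi> z (v z)))"
begin

abbreviation subsolution :: "(complex ^ 'n \<Rightarrow> ereal) \<Rightarrow> bool" where
  "subsolution w \<equiv> viscosity_subsolution \<Omega> (F_op \<Gamma> f) \<psi> w"

lemma \<Omega>_closure: "z \<in> \<Omega> \<Longrightarrow> z \<in> closure \<Omega>"
  using closure_subset by blast

lemma \<psi>_monoD: "z \<in> \<Omega> \<Longrightarrow> s \<le> t \<Longrightarrow> \<psi> z s \<le> \<psi> z t"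
  using \<psi>_mono[OF \<Omega>_closure] by (auto dest: monoD)

lemma subsolution_test:
  assumes w: "subsolution w" and z: "z \<in> \<Omega>" and q: "C2w V q D D2" "open V" "z \<in> V"
    and eq: "w z = ereal (q z)" and le: "\<forall>\<^sub>F y in nhds z. w y \<le> ereal (q y)"
  shows "spectral_in (level (\<psi> z (q z))) (complex_hessian q z)"
proof -
  have "upper_test w z q" unfolding upper_test_def C2_on_iff using q eq le by blast
  then have "ereal (\<psi> z (real_of_ereal (w z))) \<le> F_op \<Gamma> f (complex_hessian q z)"
    using w z by (auto simp: viscosity_subsolution_def)
  then show ?thesis by (simp add: eq F_op_ge_iff)
qed

lemma subsolutionI:
  assumes usc: "usc_on \<Omega> w" and fin: "\<And>z. z \<in> \<Omega> \<Longrightarrow> w z < \<infinity>"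
    and tst: "\<And>z V q D D2. z \<in> \<Omega> \<Longrightarrow> C2w V q D D2 \<Longrightarrow> open V \<Longrightarrow> z \<in> V \<Longrightarrow> w z = ereal (q z) \<Longrightarrow>
       (\<forall>\<^sub>F y in nhds z. w y \<le> ereal (q y)) \<Longrightarrow> spectral_in (level (\<psi> z (q z))) (complex_hessian q z)"
  shows "subsolution w"
  unfolding viscosity_subsolution_def
proof (intro conjI ballI allI impI)
  fix z q assume z: "z \<in> \<Omega>" and u: "upper_test w z q"
  then obtain V D D2 where "C2w V q D D2" "open V" "z \<in> V" by (auto simp: upper_test_def C2_on_iff)
  with tst[OF z this] u show "ereal (\<psi> z (real_of_ereal (w z))) \<le> F_op \<Gamma> f (complex_hessian q z)"
    by (auto simp: F_op_ge_iff upper_test_def)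
qed (use usc fin in auto)

lemma \<psi>_near:
  assumes z: "z0 \<in> closure \<Omega>" and e: "e > 0"
  obtains d where "d > 0" "\<And>y t. y \<in> closure \<Omega> \<Longrightarrow> dist y z0 < d \<Longrightarrow> \<bar>t - t0\<bar> < d \<Longrightarrow> \<bar>\<psi> y t - \<psi> z0 t0\<bar> < e"
proof -
  obtain d where d: "d > 0" "\<And>p. p \<in> closure \<Omega> \<times> UNIV \<Longrightarrow> dist p (z0, t0) < d \<Longrightarrow>
      dist (case p of (z, t) \<Rightarrow> \<psi> z t) (case (z0, t0) of (z, t) \<Rightarrow> \<psi> z t) < e"
    using \<psi>_continuous z e unfolding continuous_on_iff by (metis UNIV_I mem_Sigma_iff)
  show ?thesis
  proof (rule that[of "d / 2"])
    fix y t assume *: "y \<in> closure \<Omega>" "dist y z0 < d / 2" "\<bar>t - t0\<bar> < d / 2"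
    have "dist (y, t) (z0, t0) \<le> dist y z0 + dist t t0"
      unfolding dist_Pair_Pair by (rule sqrt_sum_squares_le_sum) auto
    then show "\<bar>\<psi> y t - \<psi> z0 t0\<bar> < e" using d(2)[of "(y, t)"] * by (simp add: dist_real_def)
  qed (use d in simp)
qed

lemma \<psi>_above:
  assumes z: "z0 \<in> \<Omega>" and c: "c < \<psi> z0 t0"
  obtains d where "d > 0" "\<And>y t. y \<in> \<Omega> \<Longrightarrow> dist y z0 < d \<Longrightarrow> t0 - d < t \<Longrightarrow> c < \<psi> y t"
proof -
  obtain d where d: "d > 0" "\<And>y t. y \<in> closure \<Omega> \<Longrightarrow> dist y z0 < d \<Longrightarrow> \<bar>t - t0\<bar> < d \<Longrightarrow> \<bar>\<psi> y t - \<psi> z0 t0\<bar> < \<psi> z0 t0 - c"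
    by (rule \<psi>_near[OF \<Omega>_closure[OF z], of "\<psi> z0 t0 - c" t0]) (use c that in auto)
  show ?thesis
  proof (rule that[OF d(1)])
    fix y t assume y: "y \<in> \<Omega>" "dist y z0 < d" and t: "t0 - d < t"
    have "\<bar>\<psi> y (min t t0) - \<psi> z0 t0\<bar> < \<psi> z0 t0 - c"
      by (rule d(2)[OF \<Omega>_closure[OF y(1)] y(2)]) (use t d(1) in \<open>auto simp: min_def\<close>)
    moreover have "\<psi> y (min t t0) \<le> \<psi> y t" by (rule \<psi>_monoD[OF y(1)]) simp
    ultimately show "c < \<psi> y t" by linarith
  qed
qed

lemma \<psi>_below:
  assumes z: "z0 \<in> \<Omega>" and c: "\<psi> z0 t0 < c"
  obtains d where "d > 0" "\<And>y t. y \<in> \<Omega> \<Longrightarrow> dist y z0 < d \<Longrightarrow> t < t0 + d \<Longrightarrow> \<psi> y t < c"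
proof -
  obtain d where d: "d > 0" "\<And>y t. y \<in> closure \<Omega> \<Longrightarrow> dist y z0 < d \<Longrightarrow> \<bar>t - t0\<bar> < d \<Longrightarrow> \<bar>\<psi> y t - \<psi> z0 t0\<bar> < c - \<psi> z0 t0"
    by (rule \<psi>_near[OF \<Omega>_closure[OF z], of "c - \<psi> z0 t0" t0]) (use c that in auto)
  show ?thesis
  proof (rule that[OF d(1)])
    fix y t assume y: "y \<in> \<Omega>" "dist y z0 < d" and t: "t < t0 + d"
    have "\<bar>\<psi> y (max t t0) - \<psi> z0 t0\<bar> < c - \<psi> z0 t0"
      by (rule d(2)[OF \<Omega>_closure[OF y(1)] y(2)]) (use t d(1) in \<open>auto simp: max_def\<close>)
    moreover have "\<psi> y t \<le> \<psi> y (max t t0)" by (rule \<psi>_monoD[OF y(1)]) simp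
    ultimately show "\<psi> y t < c" by linarith
  qed
qed

text \<open>
  The only use of the growth condition on \<open>f\<close>: a paraboloid with constant Hessian \<open>R\<close> is a strict subsolution
  wherever it lies below \<open>v\<close>.
\<close>

lemma strict_paraboloid:
  obtains R C1 C2 where "R > 0" "C1 < C2" "\<And>z. z \<in> \<Omega> \<Longrightarrow> \<psi> z (v z) \<le> C1" "(\<chi> i. R) \<in> level C2"
proof -
  obtain C1 where C1: "(SUP z\<in>\<Omega>. ereal (\<psi> z (v z))) < ereal C1" "ereal C1 < L" using ereal_dense2[OF f_large] by blast
  obtain C2 where C2: "ereal C1 < ereal C2" "ereal C2 < L" using ereal_dense2[OF C1(2)] by blast
  have "\<forall>\<^sub>F R in at_top. ereal C2 < ereal (f (\<chi> i. R)) \<and> R > 0"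
    using order_tendstoD(1)[OF f_limit C2(2)] eventually_gt_at_top[of "0::real"] by (rule eventually_conj)
  then obtain R where R: "ereal C2 < ereal (f (\<chi> i. R))" "R > 0" unfolding eventually_at_top_linorder by blast
  have "(\<chi> i. R) \<in> closure \<Gamma>" using R by (intro nonneg_in_closure) simp
  then have "(\<chi> i. R) \<in> level C2" using R by (simp add: level_def)
  moreover have "\<psi> z (v z) \<le> C1" if "z \<in> \<Omega>" for z
  proof -
    have "ereal (\<psi> z (v z)) \<le> (SUP z\<in>\<Omega>. ereal (\<psi> z (v z)))" using that by (rule SUP_upper)
    then have "ereal (\<psi> z (v z)) \<le> ereal C1" using C1(1) by (meson le_less_trans less_imp_le)
    then show ?thesis by simp
  qed
  ultimately show ?thesis using that R C2 by auto
qed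

lemma spectral_in_paraboloid:
  assumes "(\<chi> i. R) \<in> level c" shows "spectral_in (level c) (complex_hessian (\<lambda>z. R * (z \<bullet> z) + k) z)"
proof -
  obtain D :: "complex ^ 'n \<Rightarrow> (complex ^ 'n) \<Rightarrow>\<^sub>L real" and D2 where
    C: "C2w UNIV (\<lambda>x::complex ^ 'n. R * (x \<bullet> x) + k) D D2"
    by (rule paraboloid_C2w[where 'a = "complex ^ 'n", of R k]) (use that in blast)
  show ?thesis
    unfolding spectral_in_def
  proof (intro conjI allI impI complex_hessian_hermitian[OF C open_UNIV UNIV_I])
    fix U :: "complex ^ 'n ^ 'n" assume "unitary_matrix U"
    then have "diag_in U (complex_hessian (\<lambda>z. R * (z \<bullet> z) + k) z) = (\<chi> i. R)"
      by (simp add: diag_in_def hessian_paraboloid inner_column_unitary)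
    then show "diag_in U (complex_hessian (\<lambda>z. R * (z \<bullet> z) + k) z) \<in> level c" using assms by simp
  qed
qed

text \<open>
  Adding \<open>\<kappa> |z - z\<^sub>0|\<^sup>2\<close> to the test function makes the contact strict, so that a member of the family which
  almost attains the supremum touches the perturbed function, up to a constant, at a point near \<open>z\<^sub>0\<close>. Its
  value there is close to that of the regularized supremum, which is all that is needed for \<open>\<psi>\<close>, as \<open>\<psi>\<close> is
  nondecreasing. Closedness of \<open>level c\<close> removes \<open>\<kappa>\<close> and the gap between \<open>c\<close> and \<open>c0\<close>.
\<close>

lemma sup_of_subsolutions:
  assumes S: "\<And>w. w \<in> W \<Longrightarrow> subsolution w" and bd: "\<And>z w. z \<in> \<Omega> \<Longrightarrow> w \<in> W \<Longrightarrow> w z \<le> ereal M"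
  defines "u \<equiv> \<lambda>z. SUP w\<in>W. w z"
  shows "subsolution (usc_reg \<Omega> u)"
proof (rule subsolutionI)
  show "usc_on \<Omega> (usc_reg \<Omega> u)" by (rule usc_on_usc_reg)
  show "usc_reg \<Omega> u z < \<infinity>" if "z \<in> \<Omega>" for z
  proof -
    have "usc_reg \<Omega> u z \<le> ereal M"
      by (rule usc_reg_le[of 1]) (auto simp: u_def intro!: SUP_least bd)
    then show ?thesis by (rule le_less_trans) simp
  qed
  fix z0 V q D D2
  assume z0: "z0 \<in> \<Omega>" and Cq: "C2w V q D D2" and V: "open V" "z0 \<in> V" and eq: "usc_reg \<Omega> u z0 = ereal (q z0)"
    and le: "\<forall>\<^sub>F y in nhds z0. usc_reg \<Omega> u y \<le> ereal (q y)"
  define c0 where "c0 = \<psi> z0 (q z0)"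
  show "spectral_in (level (\<psi> z0 (q z0))) (complex_hessian q z0)"
    unfolding spectral_in_def c0_def[symmetric]
  proof (intro conjI allI impI complex_hessian_hermitian[OF Cq V])
    fix U :: "complex ^ 'n ^ 'n" assume U: "unitary_matrix U"
    define x where "x = diag_in U (complex_hessian q z0)"
    have key: "x + \<kappa> *\<^sub>R (\<chi> i. 1) \<in> level c" if c: "c < c0" and \<kappa>: "\<kappa> > 0" for c \<kappa>
    proof (rule ccontr)
      assume not: "x + \<kappa> *\<^sub>R (\<chi> i. 1) \<notin> level c"
      define g where "g = (\<lambda>z. \<kappa> * ((z - z0) \<bullet> (z - z0)))"
      obtain Dg D2g where Cg: "C2w UNIV g Dg D2g"
        and hg: "\<And>z x. hform (complex_hessian g z) x = \<kappa> * (x \<bullet> x)"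
        unfolding g_def by (rule shifted_paraboloid_C2w[of \<kappa> z0]) (use that in blast)
      define q' where "q' = (\<lambda>z. q z + g z)"
      have Cq': "C2w V q' (\<lambda>z. D z + Dg z) (\<lambda>z. D2 z + D2g z)"
        unfolding q'_def by (rule C2w_add[OF Cq C2w_subset[OF Cg]]) simp
      have "diag_in U (complex_hessian q' z0) = x + \<kappa> *\<^sub>R (\<chi> i. 1)"
        unfolding q'_def x_def diag_in_def vec_eq_iff
        using hform_hessian_add[OF Cq C2w_subset[OF Cg, of V] V] by (simp add: hg inner_column_unitary[OF U])
      moreover define G where "G = V \<inter> (\<lambda>z. diag_in U (complex_hessian q' z)) -` (- level c)"
      ultimately have z0G: "z0 \<in> G" using V not by simp
      have oG: "open G" unfolding G_def
        by (rule continuous_open_preimage[OF hessian_continuous[OF Cq' V(1)] V(1)]) (use closed_level in auto)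
      obtain d1 where d1: "d1 > 0" "\<And>y t. y \<in> \<Omega> \<Longrightarrow> dist y z0 < d1 \<Longrightarrow> q z0 - d1 < t \<Longrightarrow> c < \<psi> y t"
        using \<psi>_above[OF z0, of c "q z0"] c unfolding c0_def by blast
      have tq: "(q \<longlongrightarrow> q z0) (nhds z0)" by (rule C2w_tendsto[OF Cq V])
      have "\<forall>\<^sub>F y in nhds z0. dist (q y) (q z0) < d1 / 4" by (rule tendstoD[OF tq]) (use d1 in simp)
      moreover have "\<forall>\<^sub>F y in nhds z0. y \<in> G \<inter> \<Omega> \<inter> ball z0 d1"
        using z0G z0 d1 oG \<Omega>(1) by (intro eventually_nhds_in_open) auto
      ultimately have "\<forall>\<^sub>F y in nhds z0. dist (q y) (q z0) < d1 / 4 \<and> y \<in> G \<inter> \<Omega> \<inter> ball z0 d1 \<and> usc_reg \<Omega> u y \<le> ereal (q y)"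
        using le by (intro eventually_conj)
      then obtain \<delta>' where \<delta>': "\<delta>' > 0" "\<And>y. dist y z0 < \<delta>' \<Longrightarrow> dist (q y) (q z0) < d1 / 4 \<and> y \<in> G \<inter> \<Omega> \<inter> ball z0 d1 \<and> usc_reg \<Omega> u y \<le> ereal (q y)"
        unfolding eventually_nhds_metric by blast
      define \<delta> where "\<delta> = \<delta>' / 2"
      have \<delta>: "\<delta> > 0" using \<delta>' by (simp add: \<delta>_def)
      have K: "dist (q y) (q z0) < d1 / 4" "y \<in> G" "y \<in> \<Omega>" "dist y z0 < d1" "usc_reg \<Omega> u y \<le> ereal (q y)"
        if "y \<in> cball z0 \<delta>" for y
        using \<delta>'(2)[of y] that \<delta>' by (auto simp: \<delta>_def dist_commute)
      define \<epsilon> where "\<epsilon> = min (\<kappa> * \<delta>\<^sup>2 / 4) (d1 / 4)"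
      have \<epsilon>: "\<epsilon> > 0" "4 * \<epsilon> \<le> \<kappa> * \<delta>\<^sup>2" "4 * \<epsilon> \<le> d1" using \<kappa> \<delta> d1 by (auto simp: \<epsilon>_def)
      have tg: "(g \<longlongrightarrow> g z0) (nhds z0)" by (rule C2w_tendsto[OF Cg open_UNIV UNIV_I])
      have "\<forall>\<^sub>F y in nhds z0. dist (q y) (q z0) < \<epsilon> \<and> dist (g y) (g z0) < \<epsilon>"
        by (intro eventually_conj tendstoD[OF tq] tendstoD[OF tg] \<epsilon>)
      then obtain r' where r': "r' > 0" "\<And>y. dist y z0 < r' \<Longrightarrow> dist (q y) (q z0) < \<epsilon> \<and> dist (g y) (g z0) < \<epsilon>"
        unfolding eventually_nhds_metric by blast
      define r where "r = min r' \<delta>"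
      have r: "r > 0" using r' \<delta> by (simp add: r_def)
      \<comment> \<open>A member w of the family almost attains the regularized supremum close to z0, hence w - q' exceeds
        - 3\<epsilon> there, but is at most - 4\<epsilon> on the sphere of radius \<delta>.\<close>
      have "ereal (q z0 - \<epsilon>) < usc_reg \<Omega> u z0" using eq \<epsilon> by simp
      then obtain z1 where z1: "z1 \<in> ball z0 r" "z1 \<in> \<Omega>" "ereal (q z0 - \<epsilon>) < u z1"
        by (rule usc_reg_approx[OF _ r]) (use that in blast)
      then obtain w where w: "w \<in> W" "ereal (q z0 - \<epsilon>) < w z1" unfolding u_def less_SUP_iff by blast
      have z1': "z1 \<in> cball z0 \<delta>" "q z1 < q z0 + \<epsilon>" "g z1 < \<epsilon>"
        using z1(1) r'(2)[of z1] by (auto simp: r_def dist_commute dist_real_def g_def)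
      have wu: "w y \<le> ereal (q y)" if "y \<in> cball z0 \<delta>" for y
      proof -
        have "w y \<le> u y" unfolding u_def using w(1) by (rule SUP_upper)
        also have "\<dots> \<le> usc_reg \<Omega> u y" by (rule usc_reg_ge) (use K that in blast)
        also have "\<dots> \<le> ereal (q y)" using K(5) that by blast
        finally show ?thesis .
      qed
      have sw: "subsolution w" using S w by blast
      have "usc_on (cball z0 \<delta>) w"
        by (rule usc_on_subset[of \<Omega>]) (use sw K(3) in \<open>auto simp: viscosity_subsolution_def\<close>)
      moreover have "continuous_on (cball z0 \<delta>) q'"
        using C2w_continuous[OF Cq'] by (rule continuous_on_subset) (use K(2) in \<open>auto simp: G_def\<close>)
      ultimately have usc: "usc_on (cball z0 \<delta>) (\<lambda>y. w y - ereal (q' y))" by (rule usc_on_ereal_diff_continuous)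
      obtain y where y: "y \<in> cball z0 \<delta>" "\<And>y'. y' \<in> cball z0 \<delta> \<Longrightarrow> w y' - ereal (q' y') \<le> w y - ereal (q' y)"
        by (rule usc_attains_max[OF compact_cball _ usc]) (use \<delta> that in auto)
      have "ereal (- 3 * \<epsilon>) < w z1 - ereal (q' z1)"
        using w(2) z1'(2,3) by (cases "w z1") (auto simp: q'_def)
      also have "\<dots> \<le> w y - ereal (q' y)" by (rule y(2)[OF z1'(1)])
      finally have low: "ereal (- 3 * \<epsilon>) < w y - ereal (q' y)" .
      then obtain wy where wy: "w y = ereal wy"
        using wu[OF y(1)] by (cases "w y") auto
      define m where "m = wy - q' y"
      have m: "m > - 3 * \<epsilon>" using low by (simp add: wy m_def)
      have "dist y z0 \<noteq> \<delta>"
      proof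
        assume "dist y z0 = \<delta>"
        then have "g y = \<kappa> * \<delta>\<^sup>2" by (simp add: g_def power2_norm_eq_inner[symmetric] dist_norm)
        moreover have "wy \<le> q y" using wu[OF y(1)] by (simp add: wy)
        ultimately have "m \<le> - (\<kappa> * \<delta>\<^sup>2)" by (simp add: m_def q'_def)
        then show False using m \<epsilon> by linarith
      qed
      then have yb: "y \<in> ball z0 \<delta>" using y(1) by (simp add: dist_commute)
      have "\<forall>\<^sub>F z in nhds y. z \<in> ball z0 \<delta>" by (rule eventually_nhds_in_open) (use yb in auto)
      then have ev: "\<forall>\<^sub>F z in nhds y. w z \<le> ereal (q' z + m)"
      proof (rule eventually_mono)
        fix z assume "z \<in> ball z0 \<delta>"
        then have "w z - ereal (q' z) \<le> w y - ereal (q' y)" by (intro y(2)) auto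
        then show "w z \<le> ereal (q' z + m)" by (cases "w z") (auto simp: wy m_def)
      qed
      have yV: "y \<in> V" using K(2)[OF y(1)] by (simp add: G_def)
      have "spectral_in (level (\<psi> y (q' y + m))) (complex_hessian (\<lambda>z. q' z + m) y)"
        by (rule subsolution_test[OF sw K(3)[OF y(1)] C2w_add[OF Cq' C2w_const] V(1) yV _ ev]) (simp add: wy m_def)
      moreover have "complex_hessian (\<lambda>z. q' z + m) y = complex_hessian q' y"
        using hessian_translate[where w = 0 and y = y and k = m, OF Cq' V(1)] yV by simp
      ultimately have "diag_in U (complex_hessian q' y) \<in> level (\<psi> y (q' y + m))"
        using U by (simp add: spectral_in_def)
      moreover have "c < \<psi> y (q' y + m)"
      proof (rule d1(2)[OF K(3)[OF y(1)] K(4)[OF y(1)]])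
        have "g y \<ge> 0" using \<kappa> by (simp add: g_def)
        then show "q z0 - d1 < q' y + m"
          using K(1)[OF y(1)] m \<epsilon>(3) unfolding q'_def dist_real_def by linarith
      qed
      ultimately have "diag_in U (complex_hessian q' y) \<in> level c" using subsetD[OF level_antimono[OF less_imp_le]] by blast
      then show False using K(2)[OF y(1)] by (simp add: G_def)
    qed
    have "x \<in> level c" if "c < c0" for c
    proof -
      have "(\<lambda>\<kappa>. x + \<kappa> *\<^sub>R (\<chi> i. 1)) ` closure {0<..} \<subseteq> level c"
        by (rule image_closure_subset) (use key[OF that] closed_level in \<open>auto intro!: continuous_intros\<close>)
      then have "x + 0 *\<^sub>R (\<chi> i. 1) \<in> level c" by (rule subsetD) (rule image_eqI[of _ _ 0], simp_all)
      then show ?thesis by simp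
    qed
    then have "x \<in> closure \<Gamma>" "c \<le> f x" if "c < c0" for c using that by (auto simp: level_def)
    then have "x \<in> closure \<Gamma>" "c0 \<le> f x" using lt_ex[of c0] dense_le[of c0 "f x"] by auto
    then show "diag_in U (complex_hessian q z0) \<in> level c0" by (simp add: level_def x_def)
  qed
qed

end

section \<open>The comparison principle\<close>

context perron
begin

lemma v_bound: obtains B where "\<And>z. z \<in> closure \<Omega> \<Longrightarrow> \<bar>v z\<bar> \<le> B" "B \<ge> 0"
proof -
  obtain B where "\<forall>x\<in>v ` closure \<Omega>. norm x \<le> B" using v_bounded by (auto simp: bounded_iff)
  then have "\<bar>v z\<bar> \<le> \<bar>B\<bar>" if "z \<in> closure \<Omega>" for z using that by force
  then show ?thesis using that[of "\<bar>B\<bar>"] by simp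
qed

lemma \<Omega>_bound: obtains D where "\<And>z. z \<in> \<Omega> \<Longrightarrow> norm z \<le> D" "D \<ge> 0"
proof -
  obtain D where D: "\<forall>x\<in>\<Omega>. norm x \<le> D" using \<Omega>(3) by (auto simp: bounded_iff)
  then show ?thesis using that[of "\<bar>D\<bar>"] by force
qed

lemma supersolution_test:
  assumes z: "z \<in> \<Omega>" and q: "C2w V q D D2" "open V" "z \<in> V"
    and eq: "v z = q z" and le: "\<forall>\<^sub>F y in nhds z. q y \<le> v y"
    and s: "spectral_in (level c) (complex_hessian q z)"
  shows "c \<le> \<psi> z (v z)"
proof -
  have "lower_test (\<lambda>z. ereal (v z)) z q" unfolding lower_test_def C2_on_iff using q eq le by auto
  then have "F_op \<Gamma> f (complex_hessian q z) \<le> ereal (\<psi> z (v z))"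
    using v_super z by (auto simp: viscosity_supersolution_def)
  moreover have "ereal c \<le> F_op \<Gamma> f (complex_hessian q z)" using s by (simp add: F_op_ge_iff)
  ultimately have "ereal c \<le> ereal (\<psi> z (v z))" by (rule order.trans[rotated])
  then show ?thesis by simp
qed

lemma ball_in_\<Omega>:
  assumes z: "z \<in> \<Omega>" and d: "\<And>\<zeta>. \<zeta> \<in> frontier \<Omega> \<Longrightarrow> d \<le> dist z \<zeta>"
  shows "ball z d \<subseteq> \<Omega>"
proof (rule ccontr)
  assume "\<not> ?thesis"
  then have ne: "ball z d - \<Omega> \<noteq> {}" by blast
  then have "d > 0" by (metis Diff_empty ball_empty empty_Diff not_le)
  then have "ball z d \<inter> \<Omega> \<noteq> {}" using z by force
  then have "ball z d \<inter> frontier \<Omega> \<noteq> {}" using connected_Int_frontier[OF connected_ball _ ne] by blast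
  then show False using d by fastforce
qed

text \<open>
  Both \<open>w\<close> and \<open>v\<close> are controlled by the value of \<open>v\<close> at a common boundary point, so the estimate holds for
  two different nearby points. This is more than the boundary ordering of \<open>w\<close> and \<open>v\<close> and is needed since the
  sup-convolution moves points.
\<close>

lemma uniform_boundary_gap:
  fixes w :: "complex ^ 'n \<Rightarrow> real"
  assumes bdry: "\<And>\<zeta> e. \<zeta> \<in> frontier \<Omega> \<Longrightarrow> e > 0 \<Longrightarrow> \<exists>r>0. \<forall>z\<in>\<Omega>. dist z \<zeta> < r \<longrightarrow> w z \<le> v \<zeta> + e"
    and e: "e > 0"
  obtains d where "d > 0" "\<And>z y \<zeta>. z \<in> \<Omega> \<Longrightarrow> y \<in> \<Omega> \<Longrightarrow> \<zeta> \<in> frontier \<Omega> \<Longrightarrow> dist z \<zeta> < d \<Longrightarrow> dist y z < d \<Longrightarrow> w y \<le> v z + e"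
proof -
  have "\<exists>r>0. \<forall>z\<in>\<Omega>. dist z \<zeta> < r \<longrightarrow> w z \<le> v \<zeta> + e / 2 \<and> v \<zeta> - e / 2 \<le> v z" if z: "\<zeta> \<in> frontier \<Omega>" for \<zeta>
  proof -
    obtain r1 where r1: "r1 > 0" "\<forall>z\<in>\<Omega>. dist z \<zeta> < r1 \<longrightarrow> w z \<le> v \<zeta> + e / 2" using bdry[OF z, of "e / 2"] e by auto
    have "\<forall>\<^sub>F z in at \<zeta> within \<Omega>. dist (v z) (v \<zeta>) < e / 2" by (rule tendstoD[OF v_boundary[OF z]]) (use e in simp)
    then obtain r2 where r2: "r2 > 0" "\<forall>z\<in>\<Omega>. z \<noteq> \<zeta> \<and> dist z \<zeta> < r2 \<longrightarrow> dist (v z) (v \<zeta>) < e / 2"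
      unfolding eventually_at by blast
    have "\<zeta> \<notin> \<Omega>" using z \<Omega>(1) by (simp add: frontier_def interior_open)
    then have "\<forall>z\<in>\<Omega>. dist z \<zeta> < r2 \<longrightarrow> v \<zeta> - e / 2 \<le> v z"
    proof (intro ballI impI)
      fix z assume z': "z \<in> \<Omega>" "dist z \<zeta> < r2"
      then have "z \<noteq> \<zeta>" using \<open>\<zeta> \<notin> \<Omega>\<close> by auto
      then have "dist (v z) (v \<zeta>) < e / 2" using r2(2) z' by simp
      then show "v \<zeta> - e / 2 \<le> v z" unfolding dist_real_def by linarith
    qed
    then show ?thesis using r1 r2(1) by (intro exI[of _ "min r1 r2"]) auto
  qed
  then obtain r where r: "\<And>\<zeta>. \<zeta> \<in> frontier \<Omega> \<Longrightarrow> r \<zeta> > 0"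
    "\<And>\<zeta> z. \<zeta> \<in> frontier \<Omega> \<Longrightarrow> z \<in> \<Omega> \<Longrightarrow> dist z \<zeta> < r \<zeta> \<Longrightarrow> w z \<le> v \<zeta> + e / 2 \<and> v \<zeta> - e / 2 \<le> v z" by metis
  have cf: "compact (frontier \<Omega>)" using \<Omega>(3) by (rule compact_frontier_bounded)
  have cov: "frontier \<Omega> \<subseteq> \<Union> ((\<lambda>\<zeta>. ball \<zeta> (r \<zeta>)) ` frontier \<Omega>)" using r(1) by force
  obtain s where s: "s > 0" "\<And>x. x \<in> frontier \<Omega> \<Longrightarrow> \<exists>G\<in>(\<lambda>\<zeta>. ball \<zeta> (r \<zeta>)) ` frontier \<Omega>. ball x s \<subseteq> G"
    by (rule Heine_Borel_lemma[OF cf cov]) (use that in auto)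
  show ?thesis
  proof (rule that[of "s / 2"])
    fix z y \<zeta> assume *: "z \<in> \<Omega>" "y \<in> \<Omega>" "\<zeta> \<in> frontier \<Omega>" "dist z \<zeta> < s / 2" "dist y z < s / 2"
    obtain \<xi> where \<xi>: "\<xi> \<in> frontier \<Omega>" "ball \<zeta> s \<subseteq> ball \<xi> (r \<xi>)" using s(2)[OF *(3)] by blast
    have "dist \<zeta> y \<le> dist y z + dist z \<zeta>" by (metis dist_commute dist_triangle)
    then have "y \<in> ball \<zeta> s" "z \<in> ball \<zeta> s" using * s(1) by (auto simp: dist_commute)
    then have "y \<in> ball \<xi> (r \<xi>)" "z \<in> ball \<xi> (r \<xi>)" using \<xi>(2) by blast+
    then have "w y \<le> v \<xi> + e / 2" "v \<xi> - e / 2 \<le> v z"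
      using r(2)[OF \<xi>(1) *(2)] r(2)[OF \<xi>(1) *(1)] by (auto simp: dist_commute)
    then show "w y \<le> v z + e" by linarith
  qed (use s in simp)
qed

lemma \<psi>_uniform:
  assumes e: "e > 0"
  obtains d where "d > 0" "\<And>z y t. z \<in> closure \<Omega> \<Longrightarrow> y \<in> closure \<Omega> \<Longrightarrow> \<bar>t\<bar> \<le> B \<Longrightarrow> dist y z < d \<Longrightarrow> \<bar>\<psi> y t - \<psi> z t\<bar> < e"
proof -
  have "compact (closure \<Omega> \<times> {- B..B})" using \<Omega>(3) by (intro compact_Times) (auto simp: compact_closure)
  moreover have "continuous_on (closure \<Omega> \<times> {- B..B}) (\<lambda>(z, t). \<psi> z t)"
    by (rule continuous_on_subset[OF \<psi>_continuous]) auto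
  ultimately have "uniformly_continuous_on (closure \<Omega> \<times> {- B..B}) (\<lambda>(z, t). \<psi> z t)"
    by (rule compact_uniformly_continuous[rotated])
  then obtain d where d: "d > 0" "\<And>p p'. p \<in> closure \<Omega> \<times> {- B..B} \<Longrightarrow> p' \<in> closure \<Omega> \<times> {- B..B} \<Longrightarrow> dist p' p < d \<Longrightarrow>
      dist (case p' of (z, t) \<Rightarrow> \<psi> z t) (case p of (z, t) \<Rightarrow> \<psi> z t) < e"
    using e unfolding uniformly_continuous_on_def by blast
  show ?thesis
  proof (rule that[OF d(1)])
    fix z y t assume "z \<in> closure \<Omega>" "y \<in> closure \<Omega>" "\<bar>t\<bar> \<le> B" "dist y z < d"
    then show "\<bar>\<psi> y t - \<psi> z t\<bar> < e" using d(2)[of "(z, t)" "(y, t)"] by (auto simp: dist_Pair_Pair dist_real_def abs_le_iff)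
  qed
qed

text \<open>
  A test function for the sup-convolution at \<open>x\<close>, translated by \<open>x - y\<close>, is a test function for \<open>w\<close> at the
  point \<open>y\<close> where the supremum is attained. The Hessian is unchanged, and \<open>w0 y\<close> is at least the value of the
  sup-convolution.
\<close>

lemma sup_convolution_subsolution:
  assumes w: "subsolution w" and wr: "\<And>z. z \<in> \<Omega> \<Longrightarrow> w z = ereal (w0 z)" and B: "\<And>z. z \<in> \<Omega> \<Longrightarrow> \<bar>w0 z\<bar> \<le> M"
    and k: "k \<ge> 0" and \<rho>: "cball x \<rho> \<subseteq> \<Omega>" "\<rho> > 0" "2 * M < k * \<rho>\<^sup>2"
    and q: "C2w V q D D2" "open V" "x \<in> V" and eq: "q x = sup_convolution \<Omega> w0 k x"
    and le: "\<forall>\<^sub>F z in nhds x. sup_convolution \<Omega> w0 k z \<le> q z"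
  obtains y where "y \<in> cball x \<rho>" "sup_convolution \<Omega> w0 k x \<le> w0 y"
    "spectral_in (level (\<psi> y (w0 y))) (complex_hessian q x)"
proof -
  have usc: "usc_on \<Omega> w0"
    unfolding usc_on_def
  proof (intro ballI allI impI)
    fix z c assume z: "z \<in> \<Omega>" and c: "w0 z < c"
    have "\<forall>\<^sub>F y in at z within \<Omega>. w y < ereal c" using w z c wr by (simp add: viscosity_subsolution_def usc_on_def)
    moreover have "\<forall>\<^sub>F y in at z within \<Omega>. y \<in> \<Omega>" by (simp add: eventually_at_filter)
    ultimately show "\<forall>\<^sub>F y in at z within \<Omega>. w0 y < c" by eventually_elim (simp add: wr)
  qed
  obtain y where y: "y \<in> cball x \<rho>" and max: "sup_convolution \<Omega> w0 k x = w0 y - k * (dist x y)\<^sup>2"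
    by (rule sup_convolution_attained[OF B k usc \<rho>]) (use that in blast)
  have y\<Omega>: "y \<in> \<Omega>" using y \<rho> by blast
  define q' where "q' = (\<lambda>z. q ((x - y) + z) + k * (dist x y)\<^sup>2)"
  define V' where "V' = (\<lambda>z. (x - y) + z) -` V"
  have V': "open V'" "y \<in> V'" unfolding V'_def using q by (auto intro!: open_vimage continuous_intros)
  have "C2w V' (\<lambda>z. q ((x - y) + id_blinfun z)) (\<lambda>z. D ((x - y) + id_blinfun z) o\<^sub>L id_blinfun)
      (\<lambda>z. (precomp id_blinfun o\<^sub>L D2 ((x - y) + id_blinfun z)) o\<^sub>L id_blinfun)"
    by (rule C2w_affine[OF q(1)]) (simp add: V'_def)
  from C2w_add[OF this C2w_const[of _ "k * (dist x y)\<^sup>2"]]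
  have Cq': "C2w V' q' (\<lambda>z. (D ((x - y) + id_blinfun z) o\<^sub>L id_blinfun) + 0)
      (\<lambda>z. ((precomp id_blinfun o\<^sub>L D2 ((x - y) + id_blinfun z)) o\<^sub>L id_blinfun) + 0)"
    by (simp add: q'_def)
  have q'y: "q' y = w0 y" by (simp add: q'_def eq max)
  have lim: "filterlim (\<lambda>z. (x - y) + z) (nhds x) (nhds y)"
  proof -
    have "isCont (\<lambda>z. (x - y) + z) y" by (intro continuous_intros)
    then have "filterlim (\<lambda>z. (x - y) + z) (nhds ((x - y) + y)) (nhds y)"
      unfolding isCont_def by (rule tendsto_at_iff_tendsto_nhds[THEN iffD1])
    then show ?thesis by simp
  qed
  have ev1: "\<forall>\<^sub>F z in nhds y. sup_convolution \<Omega> w0 k ((x - y) + z) \<le> q ((x - y) + z)"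
    by (rule eventually_compose_filterlim[OF le lim])
  have ev2: "\<forall>\<^sub>F z in nhds y. z \<in> \<Omega>" by (rule eventually_nhds_in_open[OF \<Omega>(1) y\<Omega>])
  from ev1 ev2 have ev: "\<forall>\<^sub>F z in nhds y. w z \<le> ereal (q' z)"
  proof eventually_elim
    case (elim z)
    have "w0 z - k * (dist ((x - y) + z) z)\<^sup>2 \<le> sup_convolution \<Omega> w0 k ((x - y) + z)"
      by (rule sup_convolution_ge[where A = \<Omega> and w = w0 and B = M, OF B k elim(2)])
    then show ?case using elim by (simp add: wr q'_def dist_norm)
  qed
  have "spectral_in (level (\<psi> y (q' y))) (complex_hessian q' y)"
    by (rule subsolution_test[OF w y\<Omega> Cq' V' _ ev]) (simp add: wr[OF y\<Omega>] q'y)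
  moreover have "complex_hessian q' y = complex_hessian q x"
    using hessian_translate[where w = "x - y" and y = y and k = "k * (dist x y)\<^sup>2", OF q(1,2)] q(3) by (simp add: q'_def)
  ultimately have "spectral_in (level (\<psi> y (w0 y))) (complex_hessian q x)" by (simp add: q'y)
  moreover have "sup_convolution \<Omega> w0 k x \<le> w0 y" using k by (simp add: max)
  ultimately show ?thesis using that[OF y] by blast
qed

text \<open>
  Suppose that \<open>\<sigma> = w0 z1 - v z1 > 0\<close>. Let \<open>J\<close> be the mollified sup-convolution of \<open>w\<close>, \<open>P\<close> a strict
  paraboloid below \<open>v\<close> and \<open>q = (1-\<theta>) J + \<theta> P\<close>. For small \<open>\<theta>\<close> the maximum of \<open>q - v\<close> remains at least
  \<open>\<sigma>/2\<close>, whereas \<open>q - v \<le> 3\<sigma>/8\<close> near the boundary; hence it is attained at an interior point \<open>z0\<close>, where \<open>q\<close>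
  plus a constant is a test function for \<open>v\<close>. On the other hand \<open>J\<close> exceeds \<open>v z0\<close> near \<open>z0\<close>, so monotonicity
  and uniform continuity of \<open>\<psi>\<close> give \<open>F \<ge> \<psi>(z0, v z0) - \<eta>\<close> for the Hessian of \<open>J\<close>, and the strictness of \<open>P\<close>
  outweighs \<open>\<eta>\<close>. The order of the choices is essential: \<open>\<theta>\<close>, then \<open>\<eta>\<close>, then the sup-convolution parameter
  \<open>k\<close>, then the radius \<open>r\<close> of the mollifier.
\<close>

theorem comparison:
  assumes w: "subsolution w" and wr: "\<And>z. z \<in> \<Omega> \<Longrightarrow> w z = ereal (w0 z)" and M: "\<And>z. z \<in> \<Omega> \<Longrightarrow> \<bar>w0 z\<bar> \<le> M"
    and bdry: "\<And>\<zeta> e. \<zeta> \<in> frontier \<Omega> \<Longrightarrow> e > 0 \<Longrightarrow> \<exists>r>0. \<forall>z\<in>\<Omega>. dist z \<zeta> < r \<longrightarrow> w0 z \<le> v \<zeta> + e"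
    and z1: "z1 \<in> \<Omega>"
  shows "w0 z1 \<le> v z1"
proof (rule ccontr)
  assume contra: "\<not> w0 z1 \<le> v z1"
  define \<sigma> where "\<sigma> = w0 z1 - v z1"
  have \<sigma>: "\<sigma> > 0" using contra by (simp add: \<sigma>_def)
  have M0: "M \<ge> 0" using M[OF z1] by linarith
  obtain B where B: "\<And>z. z \<in> closure \<Omega> \<Longrightarrow> \<bar>v z\<bar> \<le> B" "B \<ge> 0" by (rule v_bound) (use that in blast)
  obtain Q where Q: "\<And>z. z \<in> \<Omega> \<Longrightarrow> norm z \<le> Q" "Q \<ge> 0" by (rule \<Omega>_bound) (use that in blast)
  obtain R C1 C2 where R: "R > 0" "C1 < C2" "\<And>z. z \<in> \<Omega> \<Longrightarrow> \<psi> z (v z) \<le> C1" "(\<chi> i. R) \<in> level C2"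
    by (rule strict_paraboloid) (use that in blast)
  define P where "P = (\<lambda>z::complex ^ 'n. R * (z \<bullet> z) + (- R * Q\<^sup>2 - B))"
  have Pv: "P z \<le> v z" and vP: "v z - P z \<le> 2 * B + R * Q\<^sup>2" if z: "z \<in> \<Omega>" for z
  proof -
    have "z \<bullet> z \<le> Q\<^sup>2" using Q(1)[OF z] by (simp add: power2_norm_eq_inner[symmetric] power_mono)
    then have "R * (z \<bullet> z) \<le> R * Q\<^sup>2" using R by simp
    moreover have "0 \<le> R * (z \<bullet> z)" using R by simp
    ultimately show "P z \<le> v z" "v z - P z \<le> 2 * B + R * Q\<^sup>2"
      using B(1)[OF \<Omega>_closure[OF z]] unfolding P_def by linarith+
  qed
  define C where "C = 2 * B + R * Q\<^sup>2"
  have C: "C \<ge> 0" using B R by (simp add: C_def)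
  \<comment> \<open>C bounds v - P; the choice leaves the gap between 7\<sigma>/8 and \<sigma>/2 at the point z1.\<close>
  define \<theta> where "\<theta> = (3 * \<sigma> / 8) / (\<sigma> + C + 1)"
  have \<theta>: "\<theta> > 0" "\<theta> < 1" using \<sigma> C by (auto simp: \<theta>_def field_simps)
  have \<theta>C: "\<theta> * (7 * \<sigma> / 8 + C) \<le> 3 * \<sigma> / 8"
  proof -
    have "\<theta> * (7 * \<sigma> / 8 + C) \<le> \<theta> * (\<sigma> + C + 1)" using \<theta> \<sigma> by (intro mult_left_mono) auto
    also have "\<dots> = 3 * \<sigma> / 8"
    proof -
      have "\<sigma> + C + 1 \<noteq> 0" using \<sigma> C by linarith
      then show ?thesis unfolding \<theta>_def by (metis nonzero_eq_divide_eq)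
    qed
    finally show ?thesis .
  qed
  define \<eta> where "\<eta> = \<theta> * (C2 - C1) / 2"
  have \<eta>: "\<eta> > 0" using \<theta> R by (simp add: \<eta>_def)
  obtain d\<psi> where d\<psi>: "d\<psi> > 0" "\<And>z y t. z \<in> closure \<Omega> \<Longrightarrow> y \<in> closure \<Omega> \<Longrightarrow> \<bar>t\<bar> \<le> B \<Longrightarrow> dist y z < d\<psi> \<Longrightarrow> \<bar>\<psi> y t - \<psi> z t\<bar> < \<eta>"
    by (rule \<psi>_uniform[OF \<eta>, of B]) (use that in blast)
  obtain d where d: "d > 0" "\<And>z y \<zeta>. z \<in> \<Omega> \<Longrightarrow> y \<in> \<Omega> \<Longrightarrow> \<zeta> \<in> frontier \<Omega> \<Longrightarrow> dist z \<zeta> < d \<Longrightarrow> dist y z < d \<Longrightarrow> w0 y \<le> v z + \<sigma> / 4"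
    by (rule uniform_boundary_gap[of w0 "\<sigma> / 4"]) (use bdry \<sigma> that in auto)
  define \<rho> where "\<rho> = min (d / 4) (d\<psi> / 2)"
  have \<rho>: "\<rho> > 0" "\<rho> \<le> d / 4" "\<rho> \<le> d\<psi> / 2" using d d\<psi> by (auto simp: \<rho>_def)
  \<comment> \<open>The supremum in the sup-convolution is then attained within distance \<rho>.\<close>
  define k where "k = (2 * M + 1) / \<rho>\<^sup>2"
  have k: "k \<ge> 0" "2 * M < k * \<rho>\<^sup>2" using M0 \<rho> by (auto simp: k_def)
  define s where "s = sup_convolution \<Omega> w0 k"
  have cs: "continuous_on UNIV s" unfolding s_def by (rule sup_convolution_continuous[where B = M and D = Q]) (use M k \<Omega> Q in auto)
  \<comment> \<open>The cut-off has no effect near the domain; it only provides the compact support.\<close>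
  define u where "u = (\<lambda>x. max 0 (min 1 (Q + 2 - norm x)) * s x)"
  have cu: "continuous_on UNIV u" unfolding u_def by (intro continuous_intros cs)
  have u0: "u x = 0" if "norm x > Q + 2" for x using that by (simp add: u_def)
  have us: "u x = s x" if "norm x < Q + 1" for x using that by (simp add: u_def)
  have us\<Omega>: "u x = s x" if "x \<in> \<Omega>" for x using us[of x] Q(1)[OF that] by simp
  have s_ge: "w0 x \<le> s x" if "x \<in> \<Omega>" for x
    using sup_convolution_ge[where A = \<Omega> and w = w0 and B = M and k = k and x = x and y = x, OF M k(1) that] by (simp add: s_def)
  have "uniformly_continuous_on (cball 0 (Q + 2)) u"
    by (rule compact_uniformly_continuous[OF continuous_on_subset[OF cu] compact_cball]) simp
  then obtain r1 where r1: "r1 > 0" "\<And>x y. x \<in> cball 0 (Q + 2) \<Longrightarrow> y \<in> cball 0 (Q + 2) \<Longrightarrow> dist y x < r1 \<Longrightarrow> dist (u y) (u x) < \<sigma> / 8"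
    using \<sigma> unfolding uniformly_continuous_on_def by (metis divide_pos_pos zero_less_numeral)
  define r' where "r' = min (min r1 (d / 4)) (min (d\<psi> / 2) 1)"
  have r': "r' > 0" "r' \<le> r1" "r' \<le> d / 4" "r' \<le> d\<psi> / 2" "r' \<le> 1" using r1 d d\<psi> by (auto simp: r'_def)
  have near: "\<bar>u y - u x\<bar> \<le> \<sigma> / 8" if "x \<in> \<Omega>" "dist x y < r'" for x y
  proof -
    have "norm y \<le> norm x + dist x y" by (metis dist_norm norm_minus_commute norm_triangle_sub)
    then have "x \<in> cball 0 (Q + 2)" "y \<in> cball 0 (Q + 2)" using Q(1)[OF that(1)] that(2) r'(5) by auto
    then have "dist (u y) (u x) < \<sigma> / 8" by (rule r1(2)) (use that(2) r'(2) in \<open>simp add: dist_commute\<close>)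
    then show ?thesis unfolding dist_real_def by linarith
  qed
  define r where "r = r' / 2"
  have r: "r > 0" "r < r'" using r' by (auto simp: r_def)
  obtain \<phi> :: "complex ^ 'n \<Rightarrow> real" and D\<phi> D2\<phi> where \<phi>: "C2w UNIV \<phi> D\<phi> D2\<phi>" "\<And>x. \<phi> x \<ge> 0" "\<And>x. norm x > r \<Longrightarrow> \<phi> x = 0"
    "(LINT x|lborel. \<phi> x) = 1" by (rule bump_kernel[OF r(1), where 'a = "complex ^ 'n"]) (use that in blast)
  obtain b :: "complex ^ 'n" where b: "cball 0 (Q + 2) \<subseteq> cbox (- b) b"
    using bounded_subset_cbox_symmetric[OF bounded_cball] by blast
  define J where "J = convolve (- b) b \<phi> u"
  note CJ = convolve_C2w[OF \<phi>(1) cu, of "- b" b, folded J_def]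
  have Ju: "\<bar>J x - u x\<bar> \<le> \<sigma> / 8" if "x \<in> \<Omega>" for x
    unfolding J_def
    by (rule convolve_close[OF cu u0 b C2w_continuous[OF \<phi>(1)] \<phi>(2,3,4)]) (use near[OF that] r in auto)
  define q where "q = (\<lambda>z. (1 - \<theta>) * J z + \<theta> * P z)"
  obtain DP D2P where CP: "C2w UNIV P DP D2P"
    unfolding P_def by (rule paraboloid_C2w[where 'a = "complex ^ 'n", of R "- R * Q\<^sup>2 - B"]) (use that in blast)
  have Cq: "C2w UNIV q (\<lambda>z. (1 - \<theta>) *\<^sub>R convolve (- b) b D\<phi> u z + \<theta> *\<^sub>R DP z)
      (\<lambda>z. (1 - \<theta>) *\<^sub>R convolve (- b) b D2\<phi> u z + \<theta> *\<^sub>R D2P z)"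
    unfolding q_def by (intro C2w_add C2w_scale CJ CP)
  \<comment> \<open>The maximum of q - v is taken over a compact set that omits a boundary strip of width d/2, while the
    boundary estimate is valid in the strip of width d.\<close>
  define K where "K = {z \<in> \<Omega>. \<forall>\<zeta>\<in>frontier \<Omega>. d / 2 \<le> dist z \<zeta>}"
  have K_eq: "K = closure \<Omega> \<inter> (\<Inter>\<zeta>\<in>frontier \<Omega>. {z. d / 2 \<le> dist z \<zeta>})"
  proof (intro equalityI subsetI)
    fix z assume z: "z \<in> closure \<Omega> \<inter> (\<Inter>\<zeta>\<in>frontier \<Omega>. {z. d / 2 \<le> dist z \<zeta>})"
    have "z \<notin> frontier \<Omega>"
    proof
      assume "z \<in> frontier \<Omega>"
      then have "d / 2 \<le> dist z z" using z by blast
      then show False using d(1) by simp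
    qed
    then have "z \<in> \<Omega>" using z \<Omega>(1) by (auto simp: frontier_def interior_open)
    then show "z \<in> K" using z by (auto simp: K_def)
  qed (use \<Omega>_closure in \<open>auto simp: K_def\<close>)
  have "closed K" unfolding K_eq by (intro closed_Int closed_closure closed_INT ballI closed_Collect_le continuous_intros)
  moreover have "bounded K" using \<Omega>(3) by (rule bounded_subset) (auto simp: K_def)
  ultimately have cK: "compact K" by (simp add: compact_eq_bounded_closed)
  have z1K: "z1 \<in> K"
  proof -
    have "d / 2 \<le> dist z1 \<zeta>" if "\<zeta> \<in> frontier \<Omega>" for \<zeta>
    proof (rule ccontr)
      assume "\<not> d / 2 \<le> dist z1 \<zeta>"
      then have "w0 z1 \<le> v z1 + \<sigma> / 4" using d(1) by (intro d(2)[OF z1 z1 that]) auto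
      moreover have "w0 z1 = v z1 + \<sigma>" by (simp add: \<sigma>_def)
      ultimately show False using \<sigma> by linarith
    qed
    then show ?thesis using z1 by (simp add: K_def)
  qed
  have "usc_on K (\<lambda>z. - v z)"
    using lsc_on_subset[OF v_lsc, of K] \<Omega>_closure unfolding usc_on_def lsc_on_def K_def by (force simp: minus_less_iff)
  then have "usc_on K (\<lambda>z. - v z - (- q z))"
    by (rule usc_on_diff_continuous) (intro continuous_intros continuous_on_subset[OF C2w_continuous[OF Cq]], simp)
  then have usc: "usc_on K (\<lambda>z. q z - v z)" by simp
  obtain z0 where z0: "z0 \<in> K" and mx: "\<And>z. z \<in> K \<Longrightarrow> q z - v z \<le> q z0 - v z0"
    by (rule usc_attains_max[OF cK _ usc]) (use z1K that in auto)
  have z0\<Omega>: "z0 \<in> \<Omega>" using z0 by (simp add: K_def)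
  have "\<sigma> / 2 \<le> q z1 - v z1"
  proof -
    have "v z1 + 7 * \<sigma> / 8 \<le> J z1" 
    proof -
      have "w0 z1 = v z1 + \<sigma>" by (simp add: \<sigma>_def)
      then show ?thesis using Ju[OF z1] s_ge[OF z1] us\<Omega>[OF z1] by linarith
    qed
    then have "(1 - \<theta>) * (v z1 + 7 * \<sigma> / 8) \<le> (1 - \<theta>) * J z1" using \<theta> by (intro mult_left_mono) auto
    moreover have "\<theta> * (v z1 - C) \<le> \<theta> * P z1" using vP[OF z1] \<theta> unfolding C_def by (intro mult_left_mono) auto
    moreover have "(1 - \<theta>) * (v z1 + 7 * \<sigma> / 8) + \<theta> * (v z1 - C) - v z1 = 7 * \<sigma> / 8 - \<theta> * (7 * \<sigma> / 8 + C)"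
      by (simp add: field_simps)
    ultimately show ?thesis using \<theta>C unfolding q_def by linarith
  qed
  then have big: "\<sigma> / 2 \<le> q z0 - v z0" using mx[OF z1K] by linarith
  have Jbig: "v z0 + \<sigma> / 2 \<le> J z0"
  proof (rule ccontr)
    assume "\<not> ?thesis"
    then have "(1 - \<theta>) * J z0 < (1 - \<theta>) * (v z0 + \<sigma> / 2)" using \<theta> by (intro mult_strict_left_mono) auto
    moreover have "\<theta> * P z0 \<le> \<theta> * v z0" using Pv[OF z0\<Omega>] \<theta> by (intro mult_left_mono) auto
    moreover have "(1 - \<theta>) * (v z0 + \<sigma> / 2) + \<theta> * v z0 = v z0 + \<sigma> / 2 - \<theta> * \<sigma> / 2" by (simp add: field_simps)
    moreover have "\<theta> * \<sigma> / 2 > 0" using \<theta> \<sigma> by simp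
    ultimately show False using big unfolding q_def by linarith
  qed
  have uz0: "v z0 + 3 * \<sigma> / 8 \<le> u z0" using Jbig Ju[OF z0\<Omega>] by linarith
  have cball_\<Omega>: "cball x \<rho> \<subseteq> \<Omega>" if "x \<in> \<Omega>" "\<And>\<zeta>. \<zeta> \<in> frontier \<Omega> \<Longrightarrow> d / 2 \<le> dist x \<zeta>" for x
  proof -
    have "cball x \<rho> \<subseteq> ball x (d / 2)" using \<rho> d(1) by auto
    then show ?thesis using ball_in_\<Omega>[OF that] by blast
  qed
  have z0_deep: "d \<le> dist z0 \<zeta>" if \<zeta>: "\<zeta> \<in> frontier \<Omega>" for \<zeta>
  proof (rule ccontr)
    assume n: "\<not> ?thesis"
    have "s z0 \<le> v z0 + \<sigma> / 4"
      unfolding s_def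
    proof (rule sup_convolution_le[where A = \<Omega> and w = w0 and B = M, OF M k(1) \<Omega>(2)])
      fix y assume y: "y \<in> \<Omega>"
      show "w0 y - k * (dist z0 y)\<^sup>2 \<le> v z0 + \<sigma> / 4"
      proof (cases "dist y z0 < d")
        case True
        have "w0 y \<le> v z0 + \<sigma> / 4" by (rule d(2)[OF z0\<Omega> y \<zeta> _ True]) (use n in simp)
        moreover have "0 \<le> k * (dist z0 y)\<^sup>2" using k by simp
        ultimately show ?thesis by linarith
      next
        case False
        have "\<rho>\<^sup>2 \<le> (dist z0 y)\<^sup>2" using False \<rho> d(1) by (intro power_mono) (auto simp: dist_commute)
        then have "k * \<rho>\<^sup>2 \<le> k * (dist z0 y)\<^sup>2" using k by (intro mult_left_mono) auto
        moreover have "w0 z0 \<le> v z0 + \<sigma> / 4" by (rule d(2)[OF z0\<Omega> z0\<Omega> \<zeta>]) (use n d(1) in auto)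
        ultimately show ?thesis using M[OF y] M[OF z0\<Omega>] k(2) by linarith
      qed
    qed
    then show False using uz0 us\<Omega>[OF z0\<Omega>] \<sigma> by simp
  qed
  have b_in: "x \<in> \<Omega> \<and> (\<forall>\<zeta>\<in>frontier \<Omega>. d / 2 \<le> dist x \<zeta>)" if x: "dist x z0 < d / 2" for x
  proof
    show "x \<in> \<Omega>" using ball_in_\<Omega>[OF z0\<Omega> z0_deep] x d(1) by (auto simp: dist_commute)
    show "\<forall>\<zeta>\<in>frontier \<Omega>. d / 2 \<le> dist x \<zeta>"
    proof
      fix \<zeta> assume "\<zeta> \<in> frontier \<Omega>"
      then have "d \<le> dist z0 \<zeta>" by (rule z0_deep)
      also have "\<dots> \<le> dist x z0 + dist x \<zeta>" by (metis dist_commute dist_triangle)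
      finally show "d / 2 \<le> dist x \<zeta>" using x by linarith
    qed
  qed
  define \<psi>0 where "\<psi>0 = \<psi> z0 (v z0)"
  define c where "c = \<psi>0 - \<eta>"
  have c2: "c \<le> C2" using R(2) R(3)[OF z0\<Omega>] \<eta> by (simp add: c_def \<psi>0_def)
  have ne: "level c \<noteq> {}" using R(4) level_antimono[OF c2] by blast
  have "spectral_in (level c) (complex_hessian J z0)"
    unfolding J_def
  proof (rule mollified_subsolution[OF cu u0 \<phi> b r(2) ne])
    fix x V p D D2
    assume x: "x \<in> ball z0 r'" and V: "open V" "x \<in> V" and Cp: "C2w V p D D2" and eq: "p x = u x"
      and le: "\<forall>\<^sub>F y in nhds x. u y \<le> p y"
    have xd: "dist x z0 < d / 2" using x r'(3) d(1) by (simp add: dist_commute)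
    then have x\<Omega>: "x \<in> \<Omega>" and xb: "\<And>\<zeta>. \<zeta> \<in> frontier \<Omega> \<Longrightarrow> d / 2 \<le> dist x \<zeta>" using b_in by auto
    have "\<forall>\<^sub>F y in nhds x. y \<in> \<Omega>" by (rule eventually_nhds_in_open[OF \<Omega>(1) x\<Omega>])
    with le have le': "\<forall>\<^sub>F y in nhds x. sup_convolution \<Omega> w0 k y \<le> p y"
      by eventually_elim (simp add: us\<Omega> s_def)
    obtain y where y: "y \<in> cball x \<rho>" "sup_convolution \<Omega> w0 k x \<le> w0 y"
      "spectral_in (level (\<psi> y (w0 y))) (complex_hessian p x)"
      by (rule sup_convolution_subsolution[OF w wr M k(1) cball_\<Omega>[OF x\<Omega> xb] \<rho>(1) k(2) Cp V _ le'])
         (use eq us\<Omega>[OF x\<Omega>] that in \<open>auto simp: s_def\<close>)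
    have y\<Omega>: "y \<in> \<Omega>" using y(1) cball_\<Omega>[OF x\<Omega> xb] by blast
    have "\<bar>u x - u z0\<bar> \<le> \<sigma> / 8" by (rule near[OF z0\<Omega>]) (use x in simp)
    then have "v z0 \<le> u x" using uz0 \<sigma> by linarith
    then have "v z0 \<le> w0 y" using y(2) us\<Omega>[OF x\<Omega>] by (simp add: s_def)
    then have "\<psi> y (v z0) \<le> \<psi> y (w0 y)" by (rule \<psi>_monoD[OF y\<Omega>])
    moreover have "\<bar>\<psi> y (v z0) - \<psi> z0 (v z0)\<bar> < \<eta>"
    proof (rule d\<psi>(2)[OF \<Omega>_closure[OF z0\<Omega>] \<Omega>_closure[OF y\<Omega>] B(1)[OF \<Omega>_closure[OF z0\<Omega>]]])
      have "dist y z0 \<le> dist x y + dist x z0" by (metis dist_commute dist_triangle)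
      then show "dist y z0 < d\<psi>" using y(1) x \<rho>(3) r'(4) by (simp add: dist_commute)
    qed
    ultimately have "c \<le> \<psi> y (w0 y)" unfolding c_def \<psi>0_def by linarith
    then show "spectral_in (level c) (complex_hessian p x)" by (rule spectral_in_level_antimono[OF y(3)])
  qed
  then have Jspec: "\<And>U. unitary_matrix U \<Longrightarrow> diag_in U (complex_hessian J z0) \<in> level c" by (simp add: spectral_in_def)
  have qspec: "spectral_in (level ((1 - \<theta>) * c + \<theta> * C2)) (complex_hessian (\<lambda>z. q z + (v z0 - q z0)) z0)"
    unfolding spectral_in_def
  proof (intro conjI allI impI)
    have he: "complex_hessian (\<lambda>z. q z + (v z0 - q z0)) z0 = complex_hessian q z0"
      using hessian_translate[where w = 0 and y = z0 and k = "v z0 - q z0", OF Cq open_UNIV UNIV_I] by simp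
    show "complex_hessian (\<lambda>z. q z + (v z0 - q z0)) z0 \<in> hermitian_matrices"
      unfolding he by (rule complex_hessian_hermitian[OF Cq open_UNIV UNIV_I])
    fix U :: "complex ^ 'n ^ 'n" assume U: "unitary_matrix U"
    have hq: "hform (complex_hessian q z0) x = (1 - \<theta>) * hform (complex_hessian J z0) x + \<theta> * (R * (x \<bullet> x))" for x
      unfolding q_def hform_hessian_add[OF C2w_scale[OF CJ] C2w_scale[OF CP] open_UNIV UNIV_I]
        hform_hessian_scale[OF CJ open_UNIV UNIV_I] hform_hessian_scale[OF CP open_UNIV UNIV_I]
      by (simp add: P_def hessian_paraboloid[of R "- R * Q\<^sup>2 - B", simplified])
    have "diag_in U (complex_hessian q z0) = (1 - \<theta>) *\<^sub>R diag_in U (complex_hessian J z0) + \<theta> *\<^sub>R (\<chi> i. R)"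
      by (simp add: diag_in_def vec_eq_iff hq inner_column_unitary[OF U])
    then show "diag_in U (complex_hessian (\<lambda>z. q z + (v z0 - q z0)) z0) \<in> level ((1 - \<theta>) * c + \<theta> * C2)"
      unfolding he using level_convex_combination[OF Jspec[OF U] R(4), of "1 - \<theta>" \<theta>] \<theta> by simp
  qed
  have "(1 - \<theta>) * c + \<theta> * C2 \<le> \<psi> z0 (v z0)"
  proof (rule supersolution_test[OF z0\<Omega> C2w_add[OF Cq C2w_const] open_UNIV UNIV_I _ _ qspec])
    have "\<forall>\<^sub>F y in nhds z0. y \<in> ball z0 (d / 2)" by (rule eventually_nhds_in_open) (use d(1) in auto)
    then show "\<forall>\<^sub>F y in nhds z0. q y + (v z0 - q z0) \<le> v y"
    proof (rule eventually_mono)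
      fix y assume "y \<in> ball z0 (d / 2)"
      then have "y \<in> K" using b_in[of y] by (simp add: K_def dist_commute)
      from mx[OF this] show "q y + (v z0 - q z0) \<le> v y" by linarith
    qed
  qed simp
  moreover have "(1 - \<theta>) * c + \<theta> * C2 = \<psi>0 - \<eta> + \<theta> * \<eta> + \<theta> * (C2 - \<psi>0)" by (simp add: c_def algebra_simps)
  moreover have "\<theta> * (C2 - C1) \<le> \<theta> * (C2 - \<psi>0)" using R(3)[OF z0\<Omega>] \<theta> by (intro mult_left_mono) (auto simp: \<psi>0_def)
  moreover have "\<theta> * (C2 - C1) = 2 * \<eta>" by (simp add: \<eta>_def)
  moreover have "\<theta> * \<eta> > 0" using \<theta> \<eta> by simp
  ultimately show False using \<eta> unfolding \<psi>0_def by linarith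
qed

end

section \<open>The Perron envelope\<close>

lemma usc_on_cong_near:
  assumes w: "usc_on A w" and z: "z \<in> A" and eq: "\<forall>\<^sub>F y in nhds z. w' y = w y" and c: "w' z < c"
  shows "\<forall>\<^sub>F y in at z within A. w' y < c"
proof -
  have "w' z = w z" using eq by (rule eventually_nhds_x_imp_x)
  then have "\<forall>\<^sub>F y in at z within A. w y < c" using w z c by (simp add: usc_on_def)
  moreover have "\<forall>\<^sub>F y in at z within A. w' y = w y"
    using eq unfolding eventually_at_filter by (rule eventually_mono) simp
  ultimately show ?thesis by eventually_elim simp
qed

context perron
begin

definition family :: "(complex ^ 'n \<Rightarrow> ereal) set" where
  "family = {w. subsolution w \<and> (\<forall>z\<in>\<Omega>. w z \<le> ereal (v z))}"

definition envelope :: "complex ^ 'n \<Rightarrow> ereal" where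
  "envelope z = (SUP w\<in>family. w z)"

lemma envelope_ge: "w \<in> family \<Longrightarrow> w z \<le> envelope z"
  unfolding envelope_def by (rule SUP_upper)

lemma envelope_le: "z \<in> \<Omega> \<Longrightarrow> envelope z \<le> ereal (v z)"
  unfolding envelope_def by (rule SUP_least) (auto simp: family_def)

lemma envelope_lower_bound:
  obtains m where "\<And>z. z \<in> \<Omega> \<Longrightarrow> ereal m \<le> envelope z"
proof -
  obtain B where B: "\<And>z. z \<in> closure \<Omega> \<Longrightarrow> \<bar>v z\<bar> \<le> B" "B \<ge> 0" by (rule v_bound) (use that in blast)
  obtain Q where Q: "\<And>z. z \<in> \<Omega> \<Longrightarrow> norm z \<le> Q" "Q \<ge> 0" by (rule \<Omega>_bound) (use that in blast)
  obtain R C1 C2 where R: "R > 0" "C1 < C2" "\<And>z. z \<in> \<Omega> \<Longrightarrow> \<psi> z (v z) \<le> C1" "(\<chi> i. R) \<in> level C2"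
    by (rule strict_paraboloid) (use that in blast)
  define k where "k = - R * Q\<^sup>2 - B"
  define P where "P = (\<lambda>z::complex ^ 'n. R * (z \<bullet> z) + k)"
  obtain DP D2P where CP: "C2w UNIV P DP D2P"
    unfolding P_def by (rule paraboloid_C2w[where 'a = "complex ^ 'n", of R k]) (use that in blast)
  have Pv: "P z \<le> v z" if z: "z \<in> \<Omega>" for z
  proof -
    have "z \<bullet> z \<le> Q\<^sup>2" using Q(1)[OF z] by (simp add: power2_norm_eq_inner[symmetric] power_mono)
    then have "R * (z \<bullet> z) \<le> R * Q\<^sup>2" using R by simp
    then show ?thesis using B(1)[OF \<Omega>_closure[OF z]] unfolding P_def k_def by linarith
  qed
  have Pk: "k \<le> P z" for z using R by (simp add: P_def)
  have "subsolution (\<lambda>z. ereal (P z))"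
  proof (rule subsolutionI)
    have cP: "continuous_on \<Omega> P" by (rule continuous_on_subset[OF C2w_continuous[OF CP]]) simp
    show "usc_on \<Omega> (\<lambda>z. ereal (P z))"
      unfolding usc_on_def
    proof (intro ballI allI impI)
      fix z c assume "z \<in> \<Omega>" "ereal (P z) < c"
      moreover have "(P \<longlongrightarrow> P z) (at z within \<Omega>)"
        using cP \<open>z \<in> \<Omega>\<close> by (simp add: continuous_on_def)
      ultimately show "\<forall>\<^sub>F y in at z within \<Omega>. ereal (P y) < c" by (intro order_tendstoD(2)[OF tendsto_ereal])
    qed
    fix z V q D D2 assume z: "z \<in> \<Omega>" and q: "C2w V q D D2" "open V" "z \<in> V" and eq: "ereal (P z) = ereal (q z)"
      and le: "\<forall>\<^sub>F y in nhds z. ereal (P y) \<le> ereal (q y)"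
    have "spectral_in (level C2) (complex_hessian q z)"
      by (rule spectral_in_touch[OF CP open_UNIV UNIV_I q])
         (use eq le spectral_in_paraboloid[OF R(4)] in \<open>auto simp: P_def\<close>)
    moreover have "\<psi> z (q z) \<le> C2" using \<psi>_monoD[OF z Pv[OF z]] R(2) R(3)[OF z] eq by simp
    ultimately show "spectral_in (level (\<psi> z (q z))) (complex_hessian q z)" by (rule spectral_in_level_antimono)
  qed simp
  then have "(\<lambda>z. ereal (P z)) \<in> family" using Pv by (simp add: family_def)
  then have "ereal k \<le> envelope z" for z using envelope_ge Pk by (metis ereal_less_eq(3) order.trans)
  then show ?thesis using that by blast
qed

text \<open>
  The comparison principle is applied to the regularized envelope itself; its boundary condition follows from
  \<open>u \<le> v\<close> and the continuity of \<open>v\<close> at boundary points.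
\<close>

lemma envelope_regularized_in_family: "usc_reg \<Omega> envelope \<in> family"
proof -
  obtain B where B: "\<And>z. z \<in> closure \<Omega> \<Longrightarrow> \<bar>v z\<bar> \<le> B" "B \<ge> 0" by (rule v_bound) (use that in blast)
  obtain m where m: "\<And>z. z \<in> \<Omega> \<Longrightarrow> ereal m \<le> envelope z" by (rule envelope_lower_bound) (use that in blast)
  have uB: "envelope z \<le> ereal B" if "z \<in> \<Omega>" for z
    using envelope_le[OF that] B(1)[OF \<Omega>_closure[OF that]] by (meson abs_le_D1 ereal_less_eq(3) order.trans)
  have usB: "usc_reg \<Omega> envelope z \<le> ereal B" for z by (rule usc_reg_le[of 1]) (auto intro: uB)
  have usm: "ereal m \<le> usc_reg \<Omega> envelope z" if "z \<in> \<Omega>" for z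
    using m[OF that] usc_reg_ge[OF that] by (rule order.trans)
  have sub: "subsolution (usc_reg \<Omega> envelope)"
    unfolding envelope_def[abs_def]
  proof (rule sup_of_subsolutions)
    fix z w assume "z \<in> \<Omega>" "w \<in> family"
    then have "w z \<le> envelope z" "envelope z \<le> ereal B" by (auto intro: envelope_ge uB)
    then show "w z \<le> ereal B" by (rule order.trans)
  qed (simp add: family_def)
  define w0 where "w0 = (\<lambda>z. real_of_ereal (usc_reg \<Omega> envelope z))"
  have wr: "usc_reg \<Omega> envelope z = ereal (w0 z)" if "z \<in> \<Omega>" for z
    using usB[of z] usm[OF that] unfolding w0_def by (cases "usc_reg \<Omega> envelope z") auto
  have M: "\<bar>w0 z\<bar> \<le> \<bar>B\<bar> + \<bar>m\<bar>" if "z \<in> \<Omega>" for z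
  proof -
    have "w0 z \<le> B" "m \<le> w0 z" using usB[of z] usm[OF that] by (simp_all add: wr[OF that])
    then show ?thesis by linarith
  qed
  have bdry: "\<exists>r>0. \<forall>z\<in>\<Omega>. dist z \<zeta> < r \<longrightarrow> w0 z \<le> v \<zeta> + e" if \<zeta>: "\<zeta> \<in> frontier \<Omega>" and e: "e > 0" for \<zeta> e
  proof -
    have "\<forall>\<^sub>F z in at \<zeta> within \<Omega>. dist (v z) (v \<zeta>) < e" by (rule tendstoD[OF v_boundary[OF \<zeta>] e])
    then obtain r where r: "r > 0" "\<And>z. z \<in> \<Omega> \<Longrightarrow> z \<noteq> \<zeta> \<Longrightarrow> dist z \<zeta> < r \<Longrightarrow> dist (v z) (v \<zeta>) < e"
      unfolding eventually_at by blast
    have \<zeta>n: "\<zeta> \<notin> \<Omega>" using \<zeta> \<Omega>(1) by (simp add: frontier_def interior_open)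
    have "w0 z \<le> v \<zeta> + e" if z: "z \<in> \<Omega>" "dist z \<zeta> < r" for z
    proof -
      have "usc_reg \<Omega> envelope z \<le> ereal (v \<zeta> + e)"
      proof (rule usc_reg_le[of "r - dist z \<zeta>"])
        fix y assume y: "y \<in> ball z (r - dist z \<zeta>)" "y \<in> \<Omega>"
        have "dist y \<zeta> \<le> dist z y + dist z \<zeta>" by (metis dist_commute dist_triangle)
        then have yr: "dist y \<zeta> < r" using y(1) by simp
        have "y \<noteq> \<zeta>" using y(2) \<zeta>n by auto
        then have "dist (v y) (v \<zeta>) < e" using r(2)[OF y(2) _ yr] by simp
        then have "v y \<le> v \<zeta> + e" unfolding dist_real_def by linarith
        then show "envelope y \<le> ereal (v \<zeta> + e)" using envelope_le[OF y(2)] by (meson ereal_less_eq(3) order.trans)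
      qed (use z in simp)
      then show ?thesis by (simp add: wr[OF z(1)])
    qed
    then show ?thesis using r(1) by blast
  qed
  have "usc_reg \<Omega> envelope z \<le> ereal (v z)" if "z \<in> \<Omega>" for z
    using comparison[OF sub wr M bdry that] by (simp add: wr[OF that])
  then show ?thesis using sub by (simp add: family_def)
qed

lemma envelope_eq_regularized: "z \<in> \<Omega> \<Longrightarrow> envelope z = usc_reg \<Omega> envelope z"
  by (intro antisym usc_reg_ge envelope_ge[OF envelope_regularized_in_family])

lemma subsolution_cong:
  assumes w: "subsolution w" and eq: "\<And>z. z \<in> \<Omega> \<Longrightarrow> w' z = w z"
  shows "subsolution w'"
proof (rule subsolutionI)
  have near: "\<forall>\<^sub>F y in nhds z. w' y = w y" if "z \<in> \<Omega>" for z
    using eventually_nhds_in_open[OF \<Omega>(1) that] by (rule eventually_mono) (simp add: eq)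
  have usc: "usc_on \<Omega> w" using w by (simp add: viscosity_subsolution_def)
  show "usc_on \<Omega> w'"
    unfolding usc_on_def by (intro ballI allI impI usc_on_cong_near[OF usc _ near])
  show "w' z < \<infinity>" if "z \<in> \<Omega>" for z
    using w that by (simp add: viscosity_subsolution_def eq)
  fix z V q D D2 assume z: "z \<in> \<Omega>" and q: "C2w V q D D2" "open V" "z \<in> V" and e: "w' z = ereal (q z)"
    and le: "\<forall>\<^sub>F y in nhds z. w' y \<le> ereal (q y)"
  from le near[OF z] have "\<forall>\<^sub>F y in nhds z. w y \<le> ereal (q y)" by eventually_elim simp
  then show "spectral_in (level (\<psi> z (q z))) (complex_hessian q z)"
    by (intro subsolution_test[OF w z q]) (use e eq[OF z] in simp)
qed

lemma envelope_in_family: "envelope \<in> family"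
proof -
  have "subsolution envelope"
    by (rule subsolution_cong[of "usc_reg \<Omega> envelope"])
       (use envelope_regularized_in_family envelope_eq_regularized in \<open>auto simp: family_def\<close>)
  then show ?thesis using envelope_le by (simp add: family_def)
qed

text \<open>
  The condition on the rim makes the glued function agree with \<open>u\<close> on a neighbourhood of each point outside the
  closed ball of radius \<open>r/2\<close>, so that only points of the open ball need the maximum.
\<close>

lemma glued_subsolution:
  assumes u: "subsolution u" and Cp: "C2w V p D D2" and V: "open V" and b: "cball z0 r \<subseteq> V \<inter> \<Omega>" and r: "r > 0"
    and ps: "\<And>z. z \<in> ball z0 r \<Longrightarrow> spectral_in (level (\<psi> z (p z))) (complex_hessian p z)"
    and rim: "\<And>z. r / 2 \<le> dist z z0 \<Longrightarrow> dist z z0 < r \<Longrightarrow> ereal (p z) \<le> u z"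
  defines "w \<equiv> \<lambda>z. if z \<in> ball z0 r then max (u z) (ereal (p z)) else u z"
  shows "subsolution w"
proof (rule subsolutionI)
  have uw: "u z \<le> w z" for z by (simp add: w_def)
  have outer: "w z = u z" if "r / 2 \<le> dist z z0" for z
    using rim[OF that] by (auto simp: w_def dist_commute)
  have usc: "usc_on \<Omega> u" and fin: "\<And>z. z \<in> \<Omega> \<Longrightarrow> u z < \<infinity>" using u by (auto simp: viscosity_subsolution_def)
  show "w z < \<infinity>" if "z \<in> \<Omega>" for z using fin[OF that] by (auto simp: w_def max_def)
  have near_out: "\<forall>\<^sub>F y in nhds z. w y = u y" if "r / 2 < dist z z0" for z
  proof -
    have "open {y. r / 2 < dist y z0}" by (intro open_Collect_less continuous_intros)
    then have "\<forall>\<^sub>F y in nhds z. y \<in> {y. r / 2 < dist y z0}" using that by (intro eventually_nhds_in_open) auto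
    then show ?thesis by (rule eventually_mono) (simp add: outer)
  qed
  have near_in: "\<forall>\<^sub>F y in nhds z. y \<in> ball z0 r" if "dist z z0 < r" for z
    using that by (intro eventually_nhds_in_open) (auto simp: dist_commute)
  show "usc_on \<Omega> w"
    unfolding usc_on_def
  proof (intro ballI allI impI)
    fix z c assume z: "z \<in> \<Omega>" and c: "w z < c"
    show "\<forall>\<^sub>F y in at z within \<Omega>. w y < c"
    proof (cases "r / 2 < dist z z0")
      case True
      show ?thesis by (rule usc_on_cong_near[OF usc z near_out[OF True] c])
    next
      case False
      then have "dist z z0 < r" using r by simp
      then have zV: "z \<in> V" "z \<in> ball z0 r" using b by (auto simp: dist_commute)
      have "isCont p z" using C2w_continuous[OF Cp] V zV by (simp add: continuous_on_eq_continuous_at)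
      then have "((\<lambda>y. ereal (p y)) \<longlongrightarrow> ereal (p z)) (at z within \<Omega>)"
        unfolding isCont_def by (intro tendsto_ereal) (rule tendsto_within_subset[OF _ subset_UNIV])
      moreover have "ereal (p z) < c" "u z < c" using c zV by (auto simp: w_def)
      ultimately have "\<forall>\<^sub>F y in at z within \<Omega>. ereal (p y) < c" by (simp only: order_tendstoD(2))
      moreover have "\<forall>\<^sub>F y in at z within \<Omega>. u y < c" using usc z \<open>u z < c\<close> by (simp add: usc_on_def)
      ultimately show ?thesis by eventually_elim (simp add: w_def)
    qed
  qed
  fix z W q E E2 assume z: "z \<in> \<Omega>" and q: "C2w W q E E2" "open W" "z \<in> W" and e: "w z = ereal (q z)"
    and le: "\<forall>\<^sub>F y in nhds z. w y \<le> ereal (q y)"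
  show "spectral_in (level (\<psi> z (q z))) (complex_hessian q z)"
  proof (cases "w z = u z")
    case True
    have "\<forall>\<^sub>F y in nhds z. u y \<le> ereal (q y)" using le by (rule eventually_mono) (rule order.trans[OF uw])
    then show ?thesis by (intro subsolution_test[OF u z q]) (use e True in simp)
  next
    case False
    then have zb: "z \<in> ball z0 r" and wp: "w z = ereal (p z)" by (auto simp: w_def max_def split: if_splits)
    then have zV: "z \<in> V" using b ball_subset_cball by blast
    have pq: "p z = q z" using wp e by simp
    have "\<forall>\<^sub>F y in nhds z. y \<in> ball z0 r" using near_in zb by (simp add: dist_commute)
    with le have "\<forall>\<^sub>F y in nhds z. p y \<le> q y"
    proof eventually_elim
      case (elim y)
      then have "ereal (p y) \<le> ereal (q y)" by (simp add: w_def)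
      then show ?case by simp
    qed
    from spectral_in_touch[OF Cp V zV q pq this ps[OF zb]] show ?thesis by (simp add: pq)
  qed
qed

text \<open>
  The estimate is uniform in \<open>x\<close>, which requires continuity of the second derivative in operator norm.
\<close>

lemma hessian_lower_semicontinuous:
  fixes q :: "complex ^ 'n \<Rightarrow> real"
  assumes q: "C2w V q D D2" and V: "open V" "z0 \<in> V" and \<eta>: "\<eta> > 0"
  shows "\<forall>\<^sub>F z in nhds z0. \<forall>x. hform (complex_hessian q z0) x - \<eta> * (x \<bullet> x) \<le> hform (complex_hessian q z) x"
proof -
  have "isCont D2 z0" using q V by (simp add: C2w_def continuous_on_eq_continuous_at)
  then have "(D2 \<longlongrightarrow> D2 z0) (nhds z0)" by (rule isCont_tendsto_nhds)
  then have "\<forall>\<^sub>F z in nhds z0. dist (D2 z) (D2 z0) < \<eta>" using \<eta> by (rule tendstoD)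
  moreover have "\<forall>\<^sub>F z in nhds z0. z \<in> V" by (rule eventually_nhds_in_open[OF V])
  ultimately show ?thesis
  proof eventually_elim
    case (elim z)
    have b: "\<bar>D2 z0 h h - D2 z h h\<bar> \<le> \<eta> * (h \<bullet> h)" for h
    proof -
      have "\<bar>(D2 z0 - D2 z) h h\<bar> \<le> norm ((D2 z0 - D2 z) h) * norm h"
        using norm_blinfun[of "(D2 z0 - D2 z) h" h] by simp
      also have "\<dots> \<le> (norm (D2 z0 - D2 z) * norm h) * norm h"
        by (intro mult_right_mono norm_blinfun) auto
      also have "\<dots> \<le> (\<eta> * norm h) * norm h"
        using elim(1) by (intro mult_right_mono) (auto simp: dist_norm norm_minus_commute)
      finally show ?thesis by (simp add: minus_blinfun.rep_eq power2_eq_square[symmetric] power2_norm_eq_inner mult.assoc)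
    qed
    show ?case
    proof
      fix x
      have "\<bar>D2 z0 (cnjv x) (cnjv x) - D2 z (cnjv x) (cnjv x)\<bar> \<le> \<eta> * (x \<bullet> x)"
        using b[of "cnjv x"] by (simp add: norm_cnjv)
      moreover have "\<bar>D2 z0 (\<i> *s cnjv x) (\<i> *s cnjv x) - D2 z (\<i> *s cnjv x) (\<i> *s cnjv x)\<bar> \<le> \<eta> * (x \<bullet> x)"
        using b[of "\<i> *s cnjv x"] by (simp add: norm_cnjv inner_i_smult)
      moreover have "\<eta> * (x \<bullet> x) \<ge> 0" using \<eta> by simp
      moreover have "(s + t) / 4 - e \<le> (s' + t') / 4" if "\<bar>s - s'\<bar> \<le> e" "\<bar>t - t'\<bar> \<le> e" "e \<ge> 0" for s t s' t' e :: real
        using that by (simp add: field_simps abs_le_iff)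
      ultimately show "hform (complex_hessian q z0) x - \<eta> * (x \<bullet> x) \<le> hform (complex_hessian q z) x"
        unfolding hform_hessian[OF q V] hform_hessian[OF q V(1) elim(2)] by blast
    qed
  qed
qed

text \<open>
  The bump is \<open>q - (\<eta>/2) |z - z\<^sub>0|\<^sup>2 + \<delta>\<close>. It stays below \<open>v\<close> because \<open>q z\<^sub>0 < v z\<^sub>0\<close> and \<open>v\<close> is lower
  semicontinuous; the case \<open>q z\<^sub>0 = v z\<^sub>0\<close> is excluded since \<open>q\<close> would then be a test function for \<open>v\<close>.
  Glueing it to the envelope gives a member of the family that is larger than \<open>q z\<^sub>0 + \<delta>/2\<close> near \<open>z\<^sub>0\<close>, which
  the lower regularization cannot miss.
\<close>

lemma envelope_supersolution: "viscosity_supersolution \<Omega> (F_op \<Gamma> f) \<psi> (lsc_reg \<Omega> envelope)"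
  unfolding viscosity_supersolution_def
proof (intro conjI ballI allI impI)
  show "lsc_on \<Omega> (lsc_reg \<Omega> envelope)" by (rule lsc_on_lsc_reg)
  obtain m where m: "\<And>z. z \<in> \<Omega> \<Longrightarrow> ereal m \<le> envelope z" by (rule envelope_lower_bound) (use that in blast)
  show "- \<infinity> < lsc_reg \<Omega> envelope z" if "z \<in> \<Omega>" for z
  proof -
    have "ereal m \<le> lsc_reg \<Omega> envelope z" by (rule lsc_reg_ge[of 1]) (auto intro: m)
    then show ?thesis by (rule less_le_trans[rotated]) simp
  qed
  fix z0 q assume z0: "z0 \<in> \<Omega>" and lt: "lower_test (lsc_reg \<Omega> envelope) z0 q"
  obtain V D D2 where V: "open V" "z0 \<in> V" and Cq: "C2w V q D D2" using lt by (auto simp: lower_test_def C2_on_iff)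
  have eq: "lsc_reg \<Omega> envelope z0 = ereal (q z0)"
    and le: "\<forall>\<^sub>F z in nhds z0. ereal (q z) \<le> lsc_reg \<Omega> envelope z" using lt by (auto simp: lower_test_def)
  show "F_op \<Gamma> f (complex_hessian q z0) \<le> ereal (\<psi> z0 (real_of_ereal (lsc_reg \<Omega> envelope z0)))"
  proof (rule ccontr)
    assume "\<not> F_op \<Gamma> f (complex_hessian q z0) \<le> ereal (\<psi> z0 (real_of_ereal (lsc_reg \<Omega> envelope z0)))"
    then have "ereal (\<psi> z0 (q z0)) < F_op \<Gamma> f (complex_hessian q z0)" by (simp add: eq not_le)
    then obtain c where c: "\<psi> z0 (q z0) < c" "ereal c < F_op \<Gamma> f (complex_hessian q z0)" using ereal_dense2 by force
    have sp: "spectral_in (level c) (complex_hessian q z0)" using c(2) F_op_ge_iff[of c] less_imp_le by blast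
    have ev\<Omega>: "\<forall>\<^sub>F z in nhds z0. z \<in> \<Omega>" by (rule eventually_nhds_in_open[OF \<Omega>(1) z0])
    have qv: "q z \<le> v z" if "z \<in> \<Omega>" "ereal (q z) \<le> lsc_reg \<Omega> envelope z" for z
    proof -
      note that(2)
      also have "lsc_reg \<Omega> envelope z \<le> envelope z" by (rule lsc_reg_le[OF that(1)])
      also have "envelope z \<le> ereal (v z)" by (rule envelope_le[OF that(1)])
      finally have "ereal (q z) \<le> ereal (v z)" .
      then show ?thesis by simp
    qed
    have "q z0 \<noteq> v z0"
    proof
      assume e: "q z0 = v z0"
      from le ev\<Omega> have "\<forall>\<^sub>F z in nhds z0. q z \<le> v z" by eventually_elim (rule qv)
      then have "c \<le> \<psi> z0 (v z0)" by (intro supersolution_test[OF z0 Cq V _ _ sp]) (simp_all add: e)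
      then show False using c(1) e by simp
    qed
    then have gap: "q z0 < v z0" using qv[OF z0] eq by simp
    define g where "g = (v z0 - q z0) / 3"
    have g: "g > 0" using gap by (simp add: g_def)
    have \<psi>0: "0 \<le> \<psi> z0 (q z0)" using \<psi>_nonneg[OF \<Omega>_closure[OF z0]] .
    define c' where "c' = (\<psi> z0 (q z0) + c) / 2"
    have c': "\<psi> z0 (q z0) < c'" "c' < c" "0 < c" using c(1) \<psi>0 by (auto simp: c'_def)
    obtain \<eta> where \<eta>: "\<eta> > 0" "\<And>H'. H' \<in> hermitian_matrices \<Longrightarrow>
        (\<And>x. hform (complex_hessian q z0) x - \<eta> * inner x x \<le> hform H' x) \<Longrightarrow> spectral_in (level c') H'"
      by (rule spectral_in_level_stable[OF sp c'(3,2)]) (use that in blast)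
    obtain d1 where d1: "d1 > 0" "\<And>y t. y \<in> \<Omega> \<Longrightarrow> dist y z0 < d1 \<Longrightarrow> t < q z0 + d1 \<Longrightarrow> \<psi> y t < c'"
      by (rule \<psi>_below[OF z0 c'(1)]) (use that in blast)
    have tq: "(q \<longlongrightarrow> q z0) (nhds z0)" by (rule C2w_tendsto[OF Cq V])
    have evv: "\<forall>\<^sub>F z in nhds z0. z \<in> \<Omega> \<longrightarrow> v z0 - g < v z"
    proof -
      have "lsc_on \<Omega> v" by (rule lsc_on_subset[OF v_lsc closure_subset])
      then have "\<forall>\<^sub>F z in at z0 within \<Omega>. v z0 - g < v z" using z0 g by (simp add: lsc_on_def)
      then show ?thesis unfolding eventually_at_filter using g by (auto elim!: eventually_mono)
    qed
    have "\<forall>\<^sub>F z in nhds z0. dist (q z) (q z0) < min g (d1 / 2)" by (rule tendstoD[OF tq]) (use g d1 in simp)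
    moreover have "\<forall>\<^sub>F z in nhds z0. z \<in> V" by (rule eventually_nhds_in_open[OF V])
    moreover have "\<forall>\<^sub>F z in nhds z0. z \<in> ball z0 d1" by (rule eventually_nhds_in_open) (use d1 in auto)
    moreover have "\<forall>\<^sub>F z in nhds z0. \<forall>x. hform (complex_hessian q z0) x - \<eta> / 2 * (x \<bullet> x) \<le> hform (complex_hessian q z) x"
      by (rule hessian_lower_semicontinuous[OF Cq V]) (use \<eta> in simp)
    ultimately have "\<forall>\<^sub>F z in nhds z0. dist (q z) (q z0) < min g (d1 / 2) \<and> z \<in> V \<and> z \<in> ball z0 d1 \<and>
        (\<forall>x. hform (complex_hessian q z0) x - \<eta> / 2 * (x \<bullet> x) \<le> hform (complex_hessian q z) x) \<and> z \<in> \<Omega> \<and>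
        (z \<in> \<Omega> \<longrightarrow> v z0 - g < v z) \<and> ereal (q z) \<le> lsc_reg \<Omega> envelope z"
      using ev\<Omega> evv le by (intro eventually_conj)
    then obtain r0 where r0: "r0 > 0" "\<And>z. dist z z0 < r0 \<Longrightarrow> dist (q z) (q z0) < min g (d1 / 2) \<and> z \<in> V \<and> z \<in> ball z0 d1 \<and>
        (\<forall>x. hform (complex_hessian q z0) x - \<eta> / 2 * (x \<bullet> x) \<le> hform (complex_hessian q z) x) \<and> z \<in> \<Omega> \<and>
        (z \<in> \<Omega> \<longrightarrow> v z0 - g < v z) \<and> ereal (q z) \<le> lsc_reg \<Omega> envelope z"
      unfolding eventually_nhds_metric by blast
    define r where "r = r0 / 2"
    have r: "r > 0" using r0 by (simp add: r_def)
    have N: "dist (q z) (q z0) < g" "dist (q z) (q z0) < d1 / 2" "z \<in> V" "dist z z0 < d1"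
      "\<And>x. hform (complex_hessian q z0) x - \<eta> / 2 * (x \<bullet> x) \<le> hform (complex_hessian q z) x" "z \<in> \<Omega>"
      "v z0 - g < v z" "ereal (q z) \<le> lsc_reg \<Omega> envelope z" if "z \<in> cball z0 r" for z
      using r0(2)[of z] that r0(1) by (auto simp: r_def dist_commute)
    \<comment> \<open>On the outer half of the ball the quadratic term is at least twice the lift \<delta>.\<close>
    define \<delta> where "\<delta> = min (\<eta> * r\<^sup>2 / 16) (min g (d1 / 4))"
    have \<delta>: "\<delta> > 0" "\<delta> \<le> \<eta> * r\<^sup>2 / 16" "\<delta> \<le> g" "\<delta> \<le> d1 / 4" using \<eta> r g d1 by (auto simp: \<delta>_def)
    define h where "h = (\<lambda>z::complex ^ 'n. (- \<eta> / 2) * ((z - z0) \<bullet> (z - z0)))"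
    obtain Dh D2h where Ch: "C2w UNIV h Dh D2h"
      and hh: "\<And>z x. hform (complex_hessian h z) x = (- \<eta> / 2) * (x \<bullet> x)"
      unfolding h_def by (rule shifted_paraboloid_C2w[of "- \<eta> / 2" z0]) (use that in blast)
    define p where "p = (\<lambda>z. (q z + h z) + \<delta>)"
    have Cqh: "C2w V (\<lambda>z. q z + h z) (\<lambda>z. D z + Dh z) (\<lambda>z. D2 z + D2h z)"
      by (rule C2w_add[OF Cq C2w_subset[OF Ch]]) simp
    have Cp: "C2w V p (\<lambda>z. (D z + Dh z) + 0) (\<lambda>z. (D2 z + D2h z) + 0)"
      unfolding p_def by (rule C2w_add[OF Cqh C2w_const])
    have h0: "h z \<le> 0" for z using \<eta> by (simp add: h_def)
    have pq: "p z \<le> q z + \<delta>" for z using h0[of z] by (simp add: p_def)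
    have hp: "hform (complex_hessian p z) x = hform (complex_hessian q z) x - \<eta> / 2 * (x \<bullet> x)" if "z \<in> V" for z x
    proof -
      have "complex_hessian p z = complex_hessian (\<lambda>z. q z + h z) z"
        using hessian_translate[where w = 0 and y = z and k = \<delta>, OF Cqh V(1)] that by (simp add: p_def)
      then show ?thesis
        using hform_hessian_add[OF Cq C2w_subset[OF Ch, of V] V(1) that] by (simp add: hh)
    qed
    define w where "w = (\<lambda>z. if z \<in> ball z0 r then max (envelope z) (ereal (p z)) else envelope z)"
    have env: "subsolution envelope" using envelope_in_family by (simp add: family_def)
    have "subsolution w"
      unfolding w_def
    proof (rule glued_subsolution[OF env Cp V(1) _ r])
      show "cball z0 r \<subseteq> V \<inter> \<Omega>" using N(3,6) by blast
      fix z assume z: "z \<in> ball z0 r"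
      then have zc: "z \<in> cball z0 r" by auto
      have "spectral_in (level c') (complex_hessian p z)"
      proof (rule \<eta>(2))
        show "complex_hessian p z \<in> hermitian_matrices" by (rule complex_hessian_hermitian[OF Cp V(1) N(3)[OF zc]])
        show "hform (complex_hessian q z0) x - \<eta> * (x \<bullet> x) \<le> hform (complex_hessian p z) x" for x
          using N(5)[OF zc, of x] unfolding hp[OF N(3)[OF zc]] by (simp add: field_simps)
      qed
      moreover have "\<psi> z (p z) < c'"
      proof (rule d1(2)[OF N(6)[OF zc] N(4)[OF zc]])
        show "p z < q z0 + d1" using pq[of z] N(2)[OF zc] \<delta>(4) d1(1) unfolding dist_real_def by linarith
      qed
      ultimately show "spectral_in (level (\<psi> z (p z))) (complex_hessian p z)"
        by (meson spectral_in_level_antimono less_imp_le)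
    next
      fix z assume z: "r / 2 \<le> dist z z0" "dist z z0 < r"
      then have zc: "z \<in> cball z0 r" by (simp add: dist_commute)
      have "(r / 2)\<^sup>2 \<le> (dist z z0)\<^sup>2" using z r by (intro power_mono) auto
      then have "\<eta> / 2 * (r / 2)\<^sup>2 \<le> \<eta> / 2 * ((z - z0) \<bullet> (z - z0))"
        using \<eta> by (intro mult_left_mono) (auto simp: dist_norm power2_norm_eq_inner)
      then have "h z \<le> - (\<eta> * r\<^sup>2 / 8)" by (simp add: h_def power_divide)
      moreover have "\<eta> * r\<^sup>2 > 0" using \<eta> r by simp
      ultimately have "p z \<le> q z" using \<delta>(2) unfolding p_def by linarith
      then have "ereal (p z) \<le> ereal (q z)" by simp
      also have "\<dots> \<le> lsc_reg \<Omega> envelope z" by (rule N(8)[OF zc])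
      also have "\<dots> \<le> envelope z" by (rule lsc_reg_le[OF N(6)[OF zc]])
      finally show "ereal (p z) \<le> envelope z" .
    qed
    moreover have "w z \<le> ereal (v z)" if z: "z \<in> \<Omega>" for z
    proof (cases "z \<in> ball z0 r")
      case True
      then have zc: "z \<in> cball z0 r" by auto
      have "p z \<le> v z"
        using pq[of z] N(1)[OF zc] N(7)[OF zc] \<delta>(3) unfolding dist_real_def g_def by argo
      then show ?thesis using envelope_le[OF z] by (simp add: w_def)
    qed (use envelope_le[OF z] in \<open>simp add: w_def\<close>)
    ultimately have "w \<in> family" by (simp add: family_def)
    then have pe: "ereal (p z) \<le> envelope z" if "z \<in> ball z0 r" for z
      using envelope_ge[of w z] that by (simp add: w_def)
    have "(p \<longlongrightarrow> p z0) (nhds z0)" by (rule C2w_tendsto[OF Cp V])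
    then have "\<forall>\<^sub>F z in nhds z0. dist (p z) (p z0) < \<delta> / 2" by (rule tendstoD) (use \<delta> in simp)
    then obtain r2 where r2: "r2 > 0" "\<And>z. dist z z0 < r2 \<Longrightarrow> dist (p z) (p z0) < \<delta> / 2"
      unfolding eventually_nhds_metric by blast
    have p0: "p z0 = q z0 + \<delta>" by (simp add: p_def h_def)
    have "ereal (q z0 + \<delta> / 2) \<le> lsc_reg \<Omega> envelope z0"
    proof (rule lsc_reg_ge[of "min r r2"])
      fix z assume "z \<in> ball z0 (min r r2)"
      then have z: "z \<in> ball z0 r" "dist z z0 < r2" by (auto simp: dist_commute)
      have "q z0 + \<delta> / 2 \<le> p z" using r2(2)[OF z(2)] unfolding p0 dist_real_def by argo
      then have "ereal (q z0 + \<delta> / 2) \<le> ereal (p z)" by simp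
      then show "ereal (q z0 + \<delta> / 2) \<le> envelope z" using pe[OF z(1)] by (rule order.trans)
    qed (use r r2 in simp)
    then show False using eq \<delta>(1) by simp
  qed
qed

theorem envelope_solution:
  "discontinuous_viscosity_solution \<Omega> (F_op \<Gamma> f) \<psi> envelope"
  unfolding discontinuous_viscosity_solution_def
proof (intro conjI)
  obtain B where B: "\<And>z. z \<in> closure \<Omega> \<Longrightarrow> \<bar>v z\<bar> \<le> B" "B \<ge> 0" by (rule v_bound) (use that in blast)
  obtain m where m: "\<And>z. z \<in> \<Omega> \<Longrightarrow> ereal m \<le> envelope z" by (rule envelope_lower_bound) (use that in blast)
  have "\<bar>envelope z\<bar> \<le> ereal (\<bar>B\<bar> + \<bar>m\<bar>)" if z: "z \<in> \<Omega>" for z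
    using envelope_le[OF z] m[OF z] B(1)[OF \<Omega>_closure[OF z]] by (cases "envelope z") auto
  then show "\<exists>B::real. \<forall>z\<in>\<Omega>. \<bar>envelope z\<bar> \<le> ereal B" by blast
  show "subsolution (usc_reg \<Omega> envelope)" using envelope_regularized_in_family by (simp add: family_def)
qed (rule envelope_supersolution)

end

theorem proposition4p2:
  fixes \<Omega> :: "(complex ^ 'n) set"
    and \<psi> :: "complex ^ 'n \<Rightarrow> real \<Rightarrow> real"
    and \<Gamma> :: "(real ^ 'n) set"
    and f :: "real ^ 'n \<Rightarrow> real"
    and v :: "complex ^ 'n \<Rightarrow> real"
    and S :: "(complex ^ 'n \<Rightarrow> ereal) set"
    and u :: "complex ^ 'n \<Rightarrow> ereal"
    and L :: ereal
  assumes "open \<Omega>" and "connected \<Omega>" and "\<Omega> \<noteq> {}" and "bounded \<Omega>"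
    and "continuous_on (closure \<Omega> \<times> UNIV) (\<lambda>(z, t). \<psi> z t)"
    and "\<And>z t. z \<in> closure \<Omega> \<Longrightarrow> \<psi> z t \<ge> 0"
    and "\<And>z. z \<in> closure \<Omega> \<Longrightarrow> mono (\<psi> z)"
    and "admissible_cone \<Gamma>" and "admissible_fun \<Gamma> f"
    and "bounded (v ` closure \<Omega>)" and "lsc_on (closure \<Omega>) v"
    and "viscosity_supersolution \<Omega> (F_op \<Gamma> f) \<psi> (\<lambda>z. ereal (v z))"
    and "\<And>\<zeta>. \<zeta> \<in> frontier \<Omega> \<Longrightarrow> (v \<longlongrightarrow> v \<zeta>) (at \<zeta> within \<Omega>)"
    and "((\<lambda>R. ereal (f (\<chi> i. R))) \<longlongrightarrow> L) at_top"
    and "L > (SUP z\<in>\<Omega>. ereal (\<psi> z (v z)))"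
    and "S = {w. viscosity_subsolution \<Omega> (F_op \<Gamma> f) \<psi> w \<and> (\<forall>z\<in>\<Omega>. w z \<le> ereal (v z))}"
    and "u = (\<lambda>z. SUP w\<in>S. w z)"
  shows "discontinuous_viscosity_solution \<Omega> (F_op \<Gamma> f) \<psi> u \<and>
         (\<forall>z\<in>\<Omega>. u z = usc_reg \<Omega> u z) \<and> u \<in> S"
proof -
  interpret perron \<Gamma> f \<Omega> \<psi> v L
    by unfold_locales (fact assms)+
  have S: "S = family" by (simp add: assms(16) family_def)
  have u: "u = envelope" by (simp add: assms(17) S envelope_def fun_eq_iff)
  show ?thesis
    unfolding S u using envelope_solution envelope_eq_regularized envelope_in_family by blast
qed

end
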